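(* Let $L:[0,T]\times\mathbb{R}^N\times\mathbb{R}^N\to\mathbb{R}\cup\{\pm\infty\}$ satisfy (L1)–(L5), and let $U:[0,T]\times\mathbb{R}^N\to\mathbb{R}\cup\{\pm\infty\}$ be proper and lower semicontinuous and satisfy: for every $(t,x)\in\mathrm{dom}\,U\cap[0,T)\times\mathbb{R}^N$ and every $(n^t,n^x,n^u)\in N_{\mathrm{epi}\,U}(t,x,U(t,x))$ there exist sequences $(t_k,x_k)\to(t,x)$, $\alpha_k\to0$ and $v_k\in\mathrm{dom}\,L(t_k,x_k,\cdot)$ such that $n^t+\langle v_k,n^x\rangle-n^uL(t_k,x_k,v_k)\leq\alpha_k$ for all $k\in\mathbb{N}$. Then for every $(t_0,x_0)\in\mathrm{dom}\,U\cap[0,T)\times\mathbb{R}^N$ there exists an absolutely continuous $(x,u):[t_0,T]\to\mathbb{R}^N\times\mathbb{R}$ with $(x,u)(t_0)=(x_0,U(t_0,x_0))$, $(\dot x(t),\dot u(t))\in Q(t,x(t))$ for a.e. $t\in[t_0,T]$, and $u(t)\geq U(t,x(t))$ for all $t\in[t_0,T]$.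
   Context: $\mathbb{B}_R$ is the closed ball of radius $R$ at $0$. For a function $\varphi$, $\mathrm{dom}\,\varphi=\{z:\varphi(z)\neq\pm\infty\}$, $\mathrm{epi}\,\varphi=\{(z,r):\varphi(z)\leq r\}$; $\varphi$ is proper if it never equals $-\infty$ and is not identically $+\infty$. $U$ is regarded as $+\infty$ outside $[0,T]\times\mathbb{R}^N$. For $E\subset\mathbb{R}^M$, $w\in E$: tangent cone $T_E(w)=\{\zeta:\liminf_{\tau\to0^+}\mathrm{dist}(w+\tau\zeta,E)/\tau=0\}$, normal cone $N_E(w)=\{\xi:\langle\zeta,\xi\rangle\leq0\ \forall\zeta\in T_E(w)\}$. $Q(t,x):=\{(v,\eta)\in\mathbb{R}^N\times\mathbb{R}: L(t,x,v)\leq-\eta\}$. (L1) $L$ is lower semicontinuous in all variables. (L2) $L(t,x,\cdot)$ is convex and proper for every $t,x$. (L3) for every $(t,x,v)$ and every $(t_n,x_n)\to(t,x)$ there exist $v_n\to v$ with $L(t_n,x_n,v_n)\to L(t,x,v)$. (L4) for every $R\geq0$ there is $C_R\geq0$ with $L(t,x,v)=+\infty$ whenever $t\in[0,T]$, $x\in\mathbb{B}_R$, $|v|>C_R$. (L5) there are an integrable $c:[0,T]\to[0,\infty)$ and a null set $\mathcal{N}$ with $L(t,x,v)=+\infty$ whenever $t\notin\mathcal{N}$ and $|v|>c(t)(1+|x|)$. *)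

theory Defs
  imports "HOL-Analysis.Analysis"
begin

definition ext_dom :: "('z \<Rightarrow> ereal) \<Rightarrow> 'z set" where
  "ext_dom \<phi> = {z. \<phi> z \<noteq> \<infinity> \<and> \<phi> z \<noteq> -\<infinity>}"

definition ext_epi :: "('z \<Rightarrow> ereal) \<Rightarrow> ('z \<times> real) set" where
  "ext_epi \<phi> = {(z, r). \<phi> z \<le> ereal r}"

definition ext_proper :: "('z \<Rightarrow> ereal) \<Rightarrow> bool" where
  "ext_proper \<phi> \<longleftrightarrow> (\<forall>z. \<phi> z \<noteq> -\<infinity>) \<and> (\<exists>z. \<phi> z \<noteq> \<infinity>)"

definition ext_convex :: "('z::real_vector \<Rightarrow> ereal) \<Rightarrow> bool" where
  "ext_convex \<phi> \<longleftrightarrow> convex (ext_epi \<phi>)"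

definition lsc_on :: "'z::topological_space set \<Rightarrow> ('z \<Rightarrow> ereal) \<Rightarrow> bool" where
  "lsc_on S \<phi> \<longleftrightarrow> (\<forall>z\<in>S. \<phi> z \<le> Liminf (at z within S) \<phi>)"

definition tangent_cone :: "'z::real_normed_vector set \<Rightarrow> 'z \<Rightarrow> 'z set" where
  "tangent_cone E w =
     {\<zeta>. Liminf (at_right (0::real)) (\<lambda>\<tau>. ereal (infdist (w + \<tau> *\<^sub>R \<zeta>) E / \<tau>)) = 0}"

definition normal_cone :: "'z::real_inner set \<Rightarrow> 'z \<Rightarrow> 'z set" where
  "normal_cone E w = {\<xi>. \<forall>\<zeta>\<in>tangent_cone E w. inner \<zeta> \<xi> \<le> 0}"

definition U_ext :: "real \<Rightarrow> (real \<Rightarrow> 'a \<Rightarrow> ereal) \<Rightarrow> real \<times> 'a \<Rightarrow> ereal" where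
  "U_ext T U = (\<lambda>(t, x). if t \<in> {0..T} then U t x else \<infinity>)"

definition Qset :: "(real \<Rightarrow> 'a \<Rightarrow> 'a \<Rightarrow> ereal) \<Rightarrow> real \<Rightarrow> 'a \<Rightarrow> ('a \<times> real) set" where
  "Qset L t x = {(v, \<eta>). L t x v \<le> ereal (- \<eta>)}"

definition abs_continuous_on :: "real \<Rightarrow> real \<Rightarrow> (real \<Rightarrow> 'b::metric_space) \<Rightarrow> bool" where
  "abs_continuous_on a b f \<longleftrightarrow>
     (\<forall>\<epsilon>>0. \<exists>\<delta>>0. \<forall>(n::nat) (s::nat \<Rightarrow> real) (e::nat \<Rightarrow> real).
        (\<forall>i<n. a \<le> s i \<and> s i \<le> e i \<and> e i \<le> b) \<and>
        (\<forall>i<n. \<forall>j<n. i \<noteq> j \<longrightarrow> e i \<le> s j \<or> e j \<le> s i) \<and>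
        (\<Sum>i<n. e i - s i) < \<delta>
        \<longrightarrow> (\<Sum>i<n. dist (f (s i)) (f (e i))) < \<epsilon>)"

definition L1 :: "real \<Rightarrow> (real \<Rightarrow> 'a::real_normed_vector \<Rightarrow> 'a \<Rightarrow> ereal) \<Rightarrow> bool" where
  "L1 T L \<longleftrightarrow> lsc_on ({0..T} \<times> UNIV \<times> UNIV) (\<lambda>(t, x, v). L t x v)"

definition L2 :: "real \<Rightarrow> (real \<Rightarrow> 'a::real_normed_vector \<Rightarrow> 'a \<Rightarrow> ereal) \<Rightarrow> bool" where
  "L2 T L \<longleftrightarrow> (\<forall>t\<in>{0..T}. \<forall>x. ext_convex (L t x) \<and> ext_proper (L t x))"

definition L3 :: "real \<Rightarrow> (real \<Rightarrow> 'a::real_normed_vector \<Rightarrow> 'a \<Rightarrow> ereal) \<Rightarrow> bool" where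
  "L3 T L \<longleftrightarrow> (\<forall>t\<in>{0..T}. \<forall>x v. \<forall>(tn::nat \<Rightarrow> real) (xn::nat \<Rightarrow> 'a).
      (\<forall>n. tn n \<in> {0..T}) \<and> tn \<longlonglongrightarrow> t \<and> xn \<longlonglongrightarrow> x \<longrightarrow>
      (\<exists>vn::nat \<Rightarrow> 'a. vn \<longlonglongrightarrow> v \<and> (\<lambda>n. L (tn n) (xn n) (vn n)) \<longlonglongrightarrow> L t x v))"

definition L4 :: "real \<Rightarrow> (real \<Rightarrow> 'a::real_normed_vector \<Rightarrow> 'a \<Rightarrow> ereal) \<Rightarrow> bool" where
  "L4 T L \<longleftrightarrow> (\<forall>R\<ge>0. \<exists>C\<ge>0. \<forall>t\<in>{0..T}. \<forall>x v.
      norm x \<le> R \<and> norm v > C \<longrightarrow> L t x v = \<infinity>)"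

definition L5 :: "real \<Rightarrow> (real \<Rightarrow> 'a::real_normed_vector \<Rightarrow> 'a \<Rightarrow> ereal) \<Rightarrow> bool" where
  "L5 T L \<longleftrightarrow> (\<exists>(c::real \<Rightarrow> real) \<N>. c integrable_on {0..T} \<and> (\<forall>t\<in>{0..T}. c t \<ge> 0) \<and>
      \<N> \<in> null_sets lborel \<and>
      (\<forall>t\<in>{0..T} - \<N>. \<forall>x v. norm v > c t * (1 + norm x) \<longrightarrow> L t x v = \<infinity>))"

end

theory Submission
  imports Defs "HOL-Complex_Analysis.Great_Picard"
begin

text \<open>
  Let \<open>H t x\<close> be the convex conjugate of \<open>L t x\<close>. From a point \<open>w\<close> near the epigraph of \<open>U\<close>, with projection \<open>s\<close>
  on it, an Euler polygon moves in a direction \<open>((1, v), - l)\<close> having nonpositive inner product with the normal \<open>w - s\<close>;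
  then one step of length \<open>h\<close> increases the squared distance to the epigraph by a term of order \<open>h\<^sup>2\<close> only. The cost rate
  \<open>l\<close> is required to dominate \<open>p \<bullet> v - H s p\<close> merely for \<open>norm p \<le> k\<close>, which keeps it bounded, and \<open>k\<close>
  tends to infinity slowly as the step size tends to \<open>0\<close>.

  The state components converge to a Lipschitz curve \<open>x\<close>. Up to a linear drift the accumulated costs are monotone, so
  Fatou's lemma applied to their difference quotients yields an integrable cost rate along \<open>x\<close>. By upper
  semicontinuity of \<open>H\<close> it dominates \<open>p \<bullet> x' - H t x p\<close> for every \<open>p\<close>, hence \<open>L t x x'\<close> by biconjugation, and by
  lower semicontinuity of \<open>U\<close> its integral is at most the decrease of \<open>U\<close> along \<open>x\<close>. Gronwall's inequality and (L5)
  keep \<open>x\<close> in the ball for which the constants of the scheme were chosen.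
\<close>

section \<open>Differentiation of indefinite integrals\<close>

text \<open>Nothing bounds \<open>L\<close> above on its domain, so the cost rates of the polygons
  have no bound uniform in \<open>k\<close>, and part of the cost may concentrate on a null set in
  the limit. Fatou's lemma loses that part, but in the harmless direction: cost is subtracted from
  \<open>u\<close>, so losing some only raises the limit of \<open>u\<close> and preserves
  \<open>u \<ge> U\<close>.

  Convexity enters only through linear functionals. For a fixed momentum the inequality between
  velocity, cost and Hamiltonian can be summed along a polygon and passed to the limit, so no weak
  compactness of derivatives and no convex combinations are required.

  It applies to the limit curve almost everywhere, as soon as its cost rate is known to be finite.
  Hence the radius is fixed beforehand from Gronwall's inequality, the polygons are controlled only
  while they stay in that ball, and confinement of the limit curve is recovered by continuation in
  time.\<close>

lemma AE_lborel_iff_negligible: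
  "(AE x in lborel. P x) \<longleftrightarrow> negligible {x. \<not> P x}"
  unfolding AE_completion_iff[of P lborel, symmetric] negligible_iff_null_sets
  by (simp add: AE_iff_null_sets[symmetric] eventually_ae_filter)
   (metis (mono_tags, lifting) completion.complete2 mem_Collect_eq order_refl)

text \<open>Henstock's lemma makes the total defect over a fine partial division small. A bad point
  \<open>x\<close> is an endpoint of an interval whose defect exceeds \<epsilon> times its length,
  so a disjoint Vitali subfamily has total length below \<eta> / 10. The ball around
  \<open>x\<close> is twice as long as the interval and the Vitali enlargement is fivefold, whence
  the factor 10.\<close>

lemma negligible_bad_integral_quotients:
  fixes f :: "real \<Rightarrow> 'n::euclidean_space"
  assumes f: "f integrable_on {a..b}" and "\<epsilon> > 0"
  shows "negligible {x \<in> {a<..<b}. \<forall>r>0. \<exists>y\<in>{a<..<b}. 0 < \<bar>y - x\<bar> \<and> \<bar>y - x\<bar> < r \<and>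
     norm (integral {min x y..max x y} f - \<bar>y - x\<bar> *\<^sub>R f x) > \<epsilon> * \<bar>y - x\<bar>}"
    (is "negligible ?B")
proof -
  define B where "B = ?B"
  have Bab: "x \<in> {a<..<b}" if "x \<in> B" for x using that by (simp add: B_def)
  have "negligible B"
    unfolding negligible_outer_le
  proof (intro allI impI)
    fix \<eta> :: real assume "\<eta> > 0"
    then have e: "\<epsilon> * \<eta> / 10 > 0" using assms by simp
    obtain \<gamma> where "gauge \<gamma>" and \<gamma>: "\<And>p. \<lbrakk>p tagged_partial_division_of (cbox a b); \<gamma> fine p\<rbrakk> \<Longrightarrow>
               sum (\<lambda>(x,k). norm(measure lborel k *\<^sub>R f x - integral k f)) p < \<epsilon> * \<eta> / 10"
      using Henstock_lemma[OF _ e, of f a b] f by auto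
    have "\<exists>y. y\<in>{a<..<b} \<and> 0 < \<bar>y - x\<bar> \<and> {min x y..max x y} \<subseteq> \<gamma> x \<and>
        norm (integral {min x y..max x y} f - \<bar>y - x\<bar> *\<^sub>R f x) > \<epsilon> * \<bar>y - x\<bar>" if x: "x \<in> B" for x
    proof -
      obtain r where r: "r > 0" "ball x r \<subseteq> \<gamma> x"
        using \<open>gauge \<gamma>\<close> by (meson gauge_def open_contains_ball)
      from x r(1) have "\<exists>y\<in>{a<..<b}. 0 < \<bar>y - x\<bar> \<and> \<bar>y - x\<bar> < r \<and> \<epsilon> * \<bar>y - x\<bar> < norm (integral {min x y..max x y} f - \<bar>y - x\<bar> *\<^sub>R f x)"
        unfolding B_def by blast
      then obtain y where y: "y\<in>{a<..<b}" "0 < \<bar>y - x\<bar>" "\<bar>y - x\<bar> < r"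
        "norm (integral {min x y..max x y} f - \<bar>y - x\<bar> *\<^sub>R f x) > \<epsilon> * \<bar>y - x\<bar>" by auto
      have "{min x y..max x y} \<subseteq> ball x r"
        using y by (auto simp: dist_real_def min_def max_def split: if_splits)
      then show ?thesis using y r by auto
    qed
    then obtain Y where Y: "\<And>x. x \<in> B \<Longrightarrow> Y x \<in> {a<..<b} \<and> 0 < \<bar>Y x - x\<bar> \<and> {min x (Y x)..max x (Y x)} \<subseteq> \<gamma> x \<and>
        norm (integral {min x (Y x)..max x (Y x)} f - \<bar>Y x - x\<bar> *\<^sub>R f x) > \<epsilon> * \<bar>Y x - x\<bar>"
      using bchoice[of B "\<lambda>x y. y \<in> {a<..<b} \<and> 0 < \<bar>y - x\<bar> \<and> {min x y..max x y} \<subseteq> \<gamma> x \<and>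
        norm (integral {min x y..max x y} f - \<bar>y - x\<bar> *\<^sub>R f x) > \<epsilon> * \<bar>y - x\<bar>"] by blast
    define R where "R x = \<bar>Y x - x\<bar>" for x
    have cov: "B \<subseteq> (\<Union>x\<in>B. cball x (R x))"
      by (auto simp: R_def)
    have Rb: "0 < R x \<and> R x \<le> b - a" if "x \<in> B" for x
    proof -
      have "x \<in> {a<..<b}" using that by (rule Bab)
      then show ?thesis using Y[OF that] by (auto simp: R_def abs_if)
    qed
    obtain C where C: "countable C" "C \<subseteq> B"
       and dj: "pairwise (\<lambda>i j. disjnt (cball i (R i)) (cball j (R j))) C"
       and BC: "B \<subseteq> (\<Union>i\<in>C. cball i (5 * R i))"
      by (rule Vitali_covering_lemma_cballs[OF cov Rb]) auto
    have bnd: "measure lebesgue (\<Union>i\<in>D. cball i (5 * R i)) \<le> \<eta>" if D: "D \<subseteq> C" "finite D" for D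
    proof -
      define J where "J x = {min x (Y x)..max x (Y x)}" for x
      define p where "p = (\<lambda>x. (x, J x)) ` D"
      have JR: "J x \<subseteq> cball x (R x)" for x
        by (auto simp: J_def R_def dist_real_def)
      have DB: "x \<in> B" if "x \<in> D" for x using that D C by blast
      have "p tagged_partial_division_of cbox a b"
        unfolding tagged_partial_division_of_def
      proof (intro conjI allI impI)
        show "finite p" using D by (simp add: p_def)
      next
        fix x K assume "(x, K) \<in> p"
        then have xk: "x \<in> D" "K = J x" by (auto simp: p_def)
        show "x \<in> K" using xk by (auto simp: J_def)
        have "x \<in> {a<..<b}" "Y x \<in> {a<..<b}" using Bab[OF DB[OF xk(1)]] Y[OF DB[OF xk(1)]] by auto
        then show "K \<subseteq> cbox a b" using xk by (auto simp: J_def)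
        show "\<exists>a b. K = cbox a b" using xk by (auto simp: J_def)
      next
        fix x1 K1 x2 K2 assume as: "(x1, K1) \<in> p \<and> (x2, K2) \<in> p \<and> (x1, K1) \<noteq> (x2, K2)"
        then have *: "x1 \<in> D" "x2 \<in> D" "x1 \<noteq> x2" "K1 = J x1" "K2 = J x2" by (auto simp: p_def)
        then have "disjnt (cball x1 (R x1)) (cball x2 (R x2))"
          using pairwiseD[OF dj, of x1 x2] D by auto
        then have "J x1 \<inter> J x2 = {}" using JR by (auto simp: disjnt_def)
        then show "interior K1 \<inter> interior K2 = {}"
          using * interior_subset by blast
      qed
      moreover have "\<gamma> fine p"
        using Y DB by (auto simp: p_def fine_def J_def)
      ultimately have "sum (\<lambda>(x,k). norm(measure lborel k *\<^sub>R f x - integral k f)) p < \<epsilon> * \<eta> / 10"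
        by (rule \<gamma>)
      also have "sum (\<lambda>(x,k). norm(measure lborel k *\<^sub>R f x - integral k f)) p
         = (\<Sum>x\<in>D. norm(measure lborel (J x) *\<^sub>R f x - integral (J x) f))"
        unfolding p_def by (subst sum.reindex) (auto simp: inj_on_def)
      finally have 1: "(\<Sum>x\<in>D. norm(measure lborel (J x) *\<^sub>R f x - integral (J x) f)) < \<epsilon> * \<eta> / 10" .
      have "(\<Sum>x\<in>D. \<epsilon> * R x) \<le> (\<Sum>x\<in>D. norm(measure lborel (J x) *\<^sub>R f x - integral (J x) f))"
      proof (rule sum_mono)
        fix x assume "x \<in> D"
        have "measure lborel (J x) = R x" by (auto simp: J_def R_def)
        then show "\<epsilon> * R x \<le> norm(measure lborel (J x) *\<^sub>R f x - integral (J x) f)"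
          using Y[OF DB[OF \<open>x \<in> D\<close>]] by (simp add: R_def J_def norm_minus_commute)
      qed
      then have "\<epsilon> * (\<Sum>x\<in>D. R x) < \<epsilon> * (\<eta> / 10)" using 1 by (simp add: sum_distrib_left)
      then have 2: "(\<Sum>x\<in>D. R x) < \<eta> / 10" using \<open>\<epsilon> > 0\<close> by simp
      have "measure lebesgue (\<Union>i\<in>D. cball i (5 * R i)) \<le> (\<Sum>i\<in>D. measure lebesgue (cball i (5 * R i)))"
        by (rule measure_UNION_le) (use D in auto)
      also have "\<dots> = (\<Sum>i\<in>D. 10 * R i)"
        by (rule sum.cong) (auto simp: cball_eq_atLeastAtMost R_def)
      also have "\<dots> = 10 * (\<Sum>x\<in>D. R x)" by (simp add: sum_distrib_left)
      finally show ?thesis using 2 by simp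
    qed
    show "\<exists>T. B \<subseteq> T \<and> T \<in> lmeasurable \<and> measure lebesgue T \<le> \<eta>"
      using BC fmeasurable_UN_bound[OF C(1) _ bnd] measure_UN_bound[OF C(1) _ bnd]
      by (intro exI[of _ "\<Union>i\<in>C. cball i (5 * R i)"]) auto
  qed
  then show ?thesis by (simp add: B_def)
qed

text \<open>Outside the bad sets for the thresholds \<open>1 / Suc n\<close>, a countable union of
  negligible sets, the error of the difference quotient is eventually below every positive
  bound.\<close>

lemma AE_has_vector_derivative_integral:
  fixes f :: "real \<Rightarrow> 'n::euclidean_space"
  assumes f: "f integrable_on {a..b}"
  shows "AE x in lborel. x \<in> {a<..<b} \<longrightarrow> ((\<lambda>t. integral {a..t} f) has_vector_derivative f x) (at x)"
proof -
  let ?B = "\<lambda>\<epsilon>. {x \<in> {a<..<b}. \<forall>r>0. \<exists>y\<in>{a<..<b}. 0 < \<bar>y - x\<bar> \<and> \<bar>y - x\<bar> < r \<and>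
     norm (integral {min x y..max x y} f - \<bar>y - x\<bar> *\<^sub>R f x) > \<epsilon> * \<bar>y - x\<bar>}"
  have "negligible (\<Union>n. ?B (1 / real (Suc n)))"
    by (intro negligible_Union_nat negligible_bad_integral_quotients[OF f]) simp
  moreover have "{x. \<not> (x \<in> {a<..<b} \<longrightarrow> ((\<lambda>t. integral {a..t} f) has_vector_derivative f x) (at x))}
     \<subseteq> (\<Union>n. ?B (1 / real (Suc n)))"
  proof (rule subsetI, rule ccontr)
    fix x assume "x \<in> {x. \<not> (x \<in> {a<..<b} \<longrightarrow> ((\<lambda>t. integral {a..t} f) has_vector_derivative f x) (at x))}"
      and nB: "x \<notin> (\<Union>n. ?B (1 / real (Suc n)))"
    then have x: "a < x" "x < b" and nd: "\<not> ((\<lambda>t. integral {a..t} f) has_vector_derivative f x) (at x)"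
      by auto
    have no: "\<exists>r>0. \<forall>y\<in>{a<..<b}. 0 < \<bar>y - x\<bar> \<longrightarrow> \<bar>y - x\<bar> < r \<longrightarrow>
         norm (integral {min x y..max x y} f - \<bar>y - x\<bar> *\<^sub>R f x) \<le> 1 / real (Suc n) * \<bar>y - x\<bar>" for n
    proof -
      have "x \<notin> ?B (1 / real (Suc n))" using nB by blast
      then show ?thesis using x unfolding mem_Collect_eq greaterThanLessThan_iff by (meson not_le)
    qed
    have "((\<lambda>t. integral {a..t} f) has_vector_derivative f x) (at x)"
      unfolding has_vector_derivative_def has_derivative_at_alt
    proof (intro conjI allI impI)
      show "bounded_linear (\<lambda>h. h *\<^sub>R f x)" by (rule bounded_linear_scaleR_left)
      fix e :: real assume "e > 0"
      then obtain n where n: "1 / real (Suc n) < e"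
        using nat_approx_posE[of e] by blast
      obtain r where r: "r > 0" "\<And>y. y\<in>{a<..<b} \<Longrightarrow> 0 < \<bar>y - x\<bar> \<Longrightarrow> \<bar>y - x\<bar> < r \<Longrightarrow>
         norm (integral {min x y..max x y} f - \<bar>y - x\<bar> *\<^sub>R f x) \<le> 1 / real (Suc n) * \<bar>y - x\<bar>"
        using no[of n] by auto
      define d where "d = min r (min (x - a) (b - x))"
      have "norm (integral {a..y} f - integral {a..x} f - (y - x) *\<^sub>R f x) \<le> e * norm (y - x)"
        if y: "norm (y - x) < d" for y
      proof (cases "y = x")
        case False
        have yab: "y \<in> {a<..<b}" using y x by (auto simp: d_def abs_if split: if_splits)
        have i: "f integrable_on {c..d}" if "a \<le> c" "d \<le> b" for c d
          using f that by (meson atLeastatMost_subset_iff integrable_on_subinterval)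
        have "norm (integral {a..y} f - integral {a..x} f - (y - x) *\<^sub>R f x)
           = norm (integral {min x y..max x y} f - \<bar>y - x\<bar> *\<^sub>R f x)"
        proof (cases "x \<le> y")
          case True
          have "integral {a..x} f + integral {x..y} f = integral {a..y} f"
            by (rule Henstock_Kurzweil_Integration.integral_combine) (use True x yab i in auto)
          then have "integral {a..y} f = integral {a..x} f + integral {x..y} f" by simp
          then have "integral {a..y} f - integral {a..x} f - (y - x) *\<^sub>R f x
            = integral {min x y..max x y} f - \<bar>y - x\<bar> *\<^sub>R f x"
            using True by (simp add: algebra_simps)
          then show ?thesis by simp
        next
          case False
          have "integral {a..y} f + integral {y..x} f = integral {a..x} f"
            by (rule Henstock_Kurzweil_Integration.integral_combine) (use False x yab i in auto)
          then have "integral {a..x} f = integral {a..y} f + integral {y..x} f" by simp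
          then have "integral {a..y} f - integral {a..x} f - (y - x) *\<^sub>R f x
            = - (integral {min x y..max x y} f - \<bar>y - x\<bar> *\<^sub>R f x)"
            using False by (simp add: min_def max_def abs_if algebra_simps)
          then show ?thesis by (metis norm_minus_cancel)
        qed
        also have "\<dots> \<le> 1 / real (Suc n) * \<bar>y - x\<bar>"
          by (rule r(2)) (use yab False y in \<open>auto simp: d_def\<close>)
        also have "\<dots> \<le> e * norm (y - x)"
          using mult_right_mono[OF less_imp_le[OF n], of "\<bar>y - x\<bar>"] by simp
        finally show ?thesis .
      qed simp
      then show "\<exists>d>0. \<forall>y. norm (y - x) < d \<longrightarrow>
          norm (integral {a..y} f - integral {a..x} f - (y - x) *\<^sub>R f x) \<le> e * norm (y - x)"
        using r(1) x by (intro exI[of _ d]) (auto simp: d_def)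
    qed
    with nd show False by simp
  qed
  ultimately show ?thesis
    unfolding AE_lborel_iff_negligible by (rule negligible_subset)
qed

section \<open>Lipschitz and absolutely continuous functions\<close>

text \<open>A finite integral forces \<open>g\<close> to be finite almost everywhere on
  \<open>S\<close>, so the value 0 of \<open>enn2real\<close> at infinity does no harm.\<close>

lemma set_nn_integral_has_integral:
  fixes g :: "real \<Rightarrow> ennreal"
  assumes [measurable]: "g \<in> borel_measurable borel" "S \<in> sets borel"
    and eq: "(\<integral>\<^sup>+x. g x * indicator S x \<partial>lborel) = ennreal r" and "0 \<le> r"
  shows "((\<lambda>x. enn2real (g x)) has_integral r) S"
proof -
  have fin: "AE x in lborel. g x * indicator S x \<noteq> \<infinity>"
    by (rule nn_integral_PInf_AE) (auto simp: eq)
  have "(\<integral>\<^sup>+x. ennreal (enn2real (g x) * indicator S x) \<partial>lborel) = (\<integral>\<^sup>+x. g x * indicator S x \<partial>lborel)"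
    by (rule nn_integral_cong_AE) (use fin in eventually_elim,
      auto split: split_indicator simp: ennreal_enn2real_if)
  then have "((\<lambda>x. enn2real (g x) * indicator S x) has_integral r) UNIV"
    by (intro nn_integral_has_integral) (auto simp: eq \<open>0 \<le> r\<close>)
  moreover have "(\<lambda>x. enn2real (g x) * indicator S x) = (\<lambda>x. if x \<in> S then enn2real (g x) else 0)"
    by (auto split: split_indicator)
  ultimately show ?thesis by (simp add: has_integral_restrict_UNIV)
qed

lemma lipschitz_real_has_integral:
  fixes f :: "real \<Rightarrow> real"
  assumes "\<And>s t. \<bar>f s - f t\<bar> \<le> C * \<bar>s - t\<bar>"
  shows "\<exists>g. \<forall>a b. a \<le> b \<longrightarrow> (g has_integral (f b - f a)) {a..b}"
proof -
  \<comment> \<open>The shear \<open>F\<close> is bi-Lipschitz, so pulling back Lebesgue measure along it gives an absolutely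
    continuous measure whose Radon-Nikodym density differs from the one sought by a constant.\<close>
  define F where "F t = f t + (C + 1) * t" for t
  \<comment> \<open>Slopes of at least 1 make the inverse 1-Lipschitz, hence Borel; slopes of at
    most \<open>2 * C + 1\<close> make images of null sets null.\<close>
  have up: "t - s \<le> F t - F s \<and> F t - F s \<le> (2 * C + 1) * (t - s)" if "s \<le> t" for s t
    using assms[of t s] that by (auto simp: F_def algebra_simps abs_le_iff)
  have "strict_mono F"
  proof (rule strict_monoI)
    show "F s < F t" if "s < t" for s t using up[of s t] that by simp
  qed
  have lip: "\<bar>F t - F s\<bar> \<le> (2 * C + 1) * \<bar>t - s\<bar>" for s t
    using up[of s t] up[of t s] by (cases "s \<le> t") auto
  have contF: "continuous_on UNIV F"
  proof (intro lipschitz_on_continuous_on[where L="max 0 (2*C+1)"] lipschitz_onI)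
    show "dist (F s) (F t) \<le> max 0 (2*C+1) * dist s t" for s t
      using order_trans[OF lip mult_right_mono[of "2*C+1" "max 0 (2*C+1)" "\<bar>s - t\<bar>"]]
      by (simp add: dist_real_def)
  qed simp
  have "surj F"
  proof (rule surjI[where f = "\<lambda>y. SOME x. F x = y"])
    fix y
    define M where "M = \<bar>y - F 0\<bar>"
    have "\<exists>x\<ge>-M. x \<le> M \<and> F x = y"
      by (rule IVT') (use up[of "-M" 0] up[of 0 M] in \<open>auto simp: M_def intro!: continuous_on_subset[OF contF]\<close>)
    then have "\<exists>x. F x = y" by blast
    then show "F (SOME x. F x = y) = y" by (rule someI_ex)
  qed
  define G where "G = inv F"
  have FG: "F (G y) = y" for y by (simp add: G_def surj_f_inv_f[OF \<open>surj F\<close>])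
  have GF: "G (F y) = y" for y
    by (simp add: G_def strict_mono_imp_inj_on[OF \<open>strict_mono F\<close>])
  have "\<bar>G y - G z\<bar> \<le> 1 * \<bar>y - z\<bar>" for y z
    using up[of "G y" "G z"] up[of "G z" "G y"] FG by (cases "G y \<le> G z") auto
  then have "continuous_on UNIV G"
    by (intro lipschitz_on_continuous_on[where L=1] lipschitz_onI) (auto simp: dist_real_def)
  then have Gm[measurable]: "G \<in> borel_measurable borel" by (rule borel_measurable_continuous_onI)
  define N where "N = distr lborel borel G"
  have N: "emeasure N A = emeasure lborel (F ` A)" if "A \<in> sets borel" for A
  proof -
    have "G -` A = F ` A" by (auto simp: GF image_iff) (metis FG)
    then show ?thesis using that by (simp add: N_def emeasure_distr)
  qed
  have "absolutely_continuous lborel N"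
    unfolding absolutely_continuous_def
  proof
    fix A :: "real set" assume A: "A \<in> null_sets lborel"
    then have As: "A \<in> sets borel" by auto
    have "negligible A" using A by (simp add: negligible_iff_null_sets null_sets_completionI)
    then have "negligible (F ` A)"
      by (intro negligible_locally_Lipschitz_image) (use lip in \<open>auto intro!: exI[of _ UNIV]\<close>)
    then have "F ` A \<in> null_sets lebesgue" by (simp add: negligible_iff_null_sets)
    moreover have "F ` A = G -` A \<inter> space borel" by (auto simp: GF image_iff) (metis FG)
    then have "F ` A \<in> sets borel" using measurable_sets[OF Gm As] by simp
    ultimately have "emeasure lborel (F ` A) = 0"
      by (simp add: null_sets_completion_iff null_setsD1)
    then show "A \<in> null_sets N"
      using N[OF As] As by (auto simp: null_sets_def N_def)
  qed
  moreover have "sets N = sets lborel" by (simp add: N_def)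
  ultimately obtain g where g[measurable]: "g \<in> borel_measurable borel" and dens: "density lborel g = N"
    using sigma_finite_measure.Radon_Nikodym[OF sigma_finite_lborel] by fastforce
  have I: "((\<lambda>x. enn2real (g x)) has_integral (F b - F a)) {a..b}" if "a \<le> b" for a b
  proof -
    have "F ` {a..b} = {F a..F b}"
    proof (intro subset_antisym subsetI)
      fix y assume "y \<in> {F a..F b}"
      then have "F a \<le> F (G y)" "F (G y) \<le> F b" by (simp_all add: FG)
      then have "G y \<in> {a..b}" by (simp add: strict_mono_less_eq[OF \<open>strict_mono F\<close>])
      then show "y \<in> F ` {a..b}" using FG[of y] by (metis imageI)
    qed (auto simp: strict_mono_less_eq[OF \<open>strict_mono F\<close>])
    then have "(\<integral>\<^sup>+x. g x * indicator {a..b} x \<partial>lborel) = ennreal (F b - F a)"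
      using N[of "{a..b}"] up[OF that] that by (simp add: dens[symmetric] emeasure_density)
    then show ?thesis
      by (intro set_nn_integral_has_integral) (use up[OF that] that in auto)
  qed
  show ?thesis
  proof (intro exI allI impI)
    fix a b :: real assume "a \<le> b"
    have "((\<lambda>x. C + 1) has_integral (b - a) *\<^sub>R (C + 1)) {a..b}"
      using has_integral_const_real[of "C+1" a b] \<open>a \<le> b\<close> by simp
    from has_integral_diff[OF I[OF \<open>a \<le> b\<close>] this]
    show "((\<lambda>x. enn2real (g x) - (C + 1)) has_integral (f b - f a)) {a..b}"
      by (simp add: F_def algebra_simps)
  qed
qed

text \<open>Rademacher's theorem in one variable. The densities of the components are assembled into
  \<open>g\<close>; on each interval from \<open>- n\<close> to \<open>n\<close> the function
  differs from the indefinite integral of \<open>g\<close> by a constant, so the differentiation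
  theorem applies there.\<close>

lemma lipschitz_has_integral_derivative:
  fixes f :: "real \<Rightarrow> 'n::euclidean_space"
  assumes lip: "\<And>s t. norm (f s - f t) \<le> C * \<bar>s - t\<bar>"
  shows "\<exists>g. (\<forall>a b. a \<le> b \<longrightarrow> (g has_integral (f b - f a)) {a..b}) \<and>
    (AE t in lborel. (f has_vector_derivative g t) (at t))"
proof -
  have "\<exists>g. \<forall>a b. a \<le> b \<longrightarrow> (g has_integral ((f b - f a) \<bullet> i)) {a..b}" if "i \<in> Basis" for i
  proof -
    have "\<bar>f s \<bullet> i - f t \<bullet> i\<bar> \<le> C * \<bar>s - t\<bar>" for s t
      using order_trans[OF Basis_le_norm[OF that] lip, of s t] by (simp add: inner_diff_left)
    from lipschitz_real_has_integral[OF this] show ?thesis by (simp add: inner_diff_left)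
  qed
  then obtain h where h: "\<And>i a b. i \<in> Basis \<Longrightarrow> a \<le> b \<Longrightarrow> (h i has_integral ((f b - f a) \<bullet> i)) {a..b}"
    by metis
  define g where "g t = (\<Sum>i\<in>Basis. h i t *\<^sub>R i)" for t
  have gi: "g t \<bullet> i = h i t" if "i \<in> Basis" for t i
    using that by (simp add: g_def inner_sum_left inner_Basis if_distrib cong: if_cong)
  have I: "(g has_integral (f b - f a)) {a..b}" if "a \<le> b" for a b
    by (rule has_integral_componentwise) (simp add: gi h that)
  have "AE t in lborel. \<forall>n::nat. t \<in> {- real n<..<real n} \<longrightarrow>
      ((\<lambda>s. integral {- real n..s} g) has_vector_derivative g t) (at t)"
  proof (subst AE_all_countable, rule allI)
    fix n :: nat
    have "g integrable_on {- real n..real n}" using I[of "- real n" "real n"] by auto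
    then show "AE t in lborel. t \<in> {- real n<..<real n} \<longrightarrow>
      ((\<lambda>s. integral {- real n..s} g) has_vector_derivative g t) (at t)"
      by (rule AE_has_vector_derivative_integral)
  qed
  then have "AE t in lborel. (f has_vector_derivative g t) (at t)"
  proof eventually_elim
    fix t assume t: "\<forall>n::nat. t \<in> {- real n<..<real n} \<longrightarrow>
      ((\<lambda>s. integral {- real n..s} g) has_vector_derivative g t) (at t)"
    obtain n :: nat where n: "\<bar>t\<bar> < real n" using reals_Archimedean2 by blast
    then have tn: "t \<in> {- real n<..<real n}" by auto
    have "((\<lambda>s. f (- real n) + integral {- real n..s} g) has_vector_derivative 0 + g t) (at t)"
      by (intro has_vector_derivative_add has_vector_derivative_const) (use t tn in blast)
    then have "((\<lambda>s. f (- real n) + integral {- real n..s} g) has_vector_derivative g t) (at t)" by simp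
    then show "(f has_vector_derivative g t) (at t)"
    proof (rule has_vector_derivative_transform_within_open[where S="{- real n<..<real n}"])
      fix s assume "s \<in> {- real n<..<real n}"
      then have "integral {- real n..s} g = f s - f (- real n)"
        by (intro integral_unique I) auto
      then show "f (- real n) + integral {- real n..s} g = f s" by simp
    qed (use tn in auto)
  qed
  with I show ?thesis by blast
qed

text \<open>Intervals that may touch become disjoint once their endpoints are dropped, so at each
  point at most one summand is nonzero.\<close>

lemma sum_integral_nonoverlapping_le:
  fixes h :: "real \<Rightarrow> real"
  assumes h: "h integrable_on {a..b}" and nn: "\<And>x. 0 \<le> h x"
    and I: "\<forall>i<n. a \<le> s i \<and> s i \<le> e i \<and> e i \<le> b"
    and disj: "\<forall>i<n. \<forall>j<n. i \<noteq> j \<longrightarrow> e i \<le> s j \<or> e j \<le> s i"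
  shows "(\<Sum>i<n::nat. integral {s i..e i} h) \<le> integral {a..b} h"
proof -
  have int: "((\<lambda>x. if x \<in> {s i<..<e i} then h x else 0) has_integral (integral {s i..e i} h)) {a..b}"
    if "i < n" for i
  proof -
    have sub: "{s i..e i} \<subseteq> {a..b}" using I that by auto
    then have "h integrable_on {s i..e i}" using h integrable_on_subinterval by blast
    then have "(h has_integral (integral {s i..e i} h)) {s i<..<e i}"
      using has_integral_open_interval[of h "integral {s i..e i} h" "s i" "e i"] by (simp add: integrable_integral box_real)
    moreover have "{s i<..<e i} \<subseteq> {a..b}" using sub by auto
    ultimately show ?thesis using has_integral_restrict by blast
  qed
  have "((\<lambda>x. \<Sum>i<n. if x \<in> {s i<..<e i} then h x else 0) has_integral
     (\<Sum>i<n. integral {s i..e i} h)) {a..b}"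
    by (rule has_integral_sum) (use int in auto)
  then show ?thesis
  proof (rule has_integral_le[OF _ integrable_integral[OF h]])
    fix x assume "x \<in> {a..b}"
    have "card {i. i < n \<and> x \<in> {s i<..<e i}} \<le> 1"
    proof (subst One_nat_def, subst card_le_Suc0_iff_eq)
      show "\<forall>i\<in>{i. i < n \<and> x \<in> {s i<..<e i}}. \<forall>j\<in>{i. i < n \<and> x \<in> {s i<..<e i}}. i = j"
      proof (intro ballI, rule ccontr)
        fix i j assume "i \<in> {i. i < n \<and> x \<in> {s i<..<e i}}" "j \<in> {i. i < n \<and> x \<in> {s i<..<e i}}" "i \<noteq> j"
        then show False using disj[rule_format, of i j] by auto
      qed
    qed auto
    then have "real (card {i. i < n \<and> x \<in> {s i<..<e i}}) * h x \<le> 1 * h x"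
      using nn by (intro mult_right_mono) auto
    moreover have "(\<Sum>i<n. if x \<in> {s i<..<e i} then h x else 0) =
       real (card {i. i < n \<and> x \<in> {s i<..<e i}}) * h x"
      by (subst sum.inter_filter[symmetric]) (auto simp: lessThan_def Collect_conj_eq)
    ultimately show "(\<Sum>i<n. if x \<in> {s i<..<e i} then h x else 0) \<le> h x" by simp
  qed
qed

text \<open>Truncation at a height \<open>N\<close>: the excess \<open>h\<close> has total integral
  below \<epsilon> / 2, and the truncated part contributes at most \<open>N\<close> times the total
  length, which is again at most \<epsilon> / 2 by the choice of \<delta>.\<close>

lemma abs_continuous_on_integral:
  fixes f :: "real \<Rightarrow> real"
  assumes f: "f integrable_on {a..b}" and nn: "\<And>x. 0 \<le> f x"
  shows "abs_continuous_on a b (\<lambda>t. integral {a..t} f)"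
  unfolding abs_continuous_on_def
proof (intro allI impI)
  fix \<epsilon> :: real assume "\<epsilon> > 0"
  have fa: "f absolutely_integrable_on {a..b}"
    using f nn by (intro nonnegative_absolutely_integrable_1) auto
  have fn: "(\<lambda>x. min (f x) (real n)) integrable_on {a..b}" for n
    using absolutely_integrable_min_1[OF fa absolutely_integrable_on_const[of "{a..b}" "real n"]]
    by (auto simp: absolutely_integrable_on_def)
  have "(\<lambda>n. integral {a..b} (\<lambda>x. min (f x) (real n))) \<longlonglongrightarrow> integral {a..b} f"
  proof (rule dominated_convergence[OF fn f])
    show "norm (min (f x) (real n)) \<le> f x" for n x using nn[of x] by auto
    fix x
    have "eventually (\<lambda>n. min (f x) (real n) = f x) sequentially"
      using eventually_ge_at_top[of "nat \<lceil>f x\<rceil>"] by eventually_elim (simp add: min_def nat_le_iff ceiling_le_iff)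
    then show "(\<lambda>n. min (f x) (real n)) \<longlonglongrightarrow> f x" by (rule tendsto_eventually)
  qed
  then have "eventually (\<lambda>n. integral {a..b} (\<lambda>x. min (f x) (real n)) > integral {a..b} f - \<epsilon>/2) sequentially"
    using \<open>\<epsilon> > 0\<close> by (intro order_tendstoD) auto
  then obtain N :: nat where N: "integral {a..b} (\<lambda>x. min (f x) (real N)) > integral {a..b} f - \<epsilon>/2"
    by (auto simp: eventually_sequentially)
  define h where "h x = f x - min (f x) (real N)" for x
  have hint: "h integrable_on {a..b}" unfolding h_def by (intro integrable_diff f fn)
  have hle: "integral {a..b} h < \<epsilon> / 2"
    unfolding h_def using N by (subst Henstock_Kurzweil_Integration.integral_diff[OF f fn]) auto
  have hnn: "0 \<le> h x" for x by (simp add: h_def)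
  define \<delta> where "\<delta> = \<epsilon> / (2 * (real N + 1))"
  have "(\<Sum>i<n. dist (integral {a..s i} f) (integral {a..e i} f)) < \<epsilon>"
    if I: "\<forall>i<n. a \<le> s i \<and> s i \<le> e i \<and> e i \<le> b"
      and disj: "\<forall>i<n. \<forall>j<n. i \<noteq> j \<longrightarrow> e i \<le> s j \<or> e j \<le> s i"
      and small: "(\<Sum>i<n. e i - s i) < \<delta>" for n :: nat and s e
  proof -
    have "dist (integral {a..s i} f) (integral {a..e i} f) \<le> integral {s i..e i} h + real N * (e i - s i)"
      if "i < n" for i
    proof -
      have i: "a \<le> s i" "s i \<le> e i" "e i \<le> b" using I that by auto
      have "f integrable_on {a..e i}" "f integrable_on {s i..e i}" "h integrable_on {s i..e i}"
        using f hint i by (auto intro: integrable_on_subinterval)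
      note fi = this
      have "integral {a..s i} f + integral {s i..e i} f = integral {a..e i} f"
        by (rule Henstock_Kurzweil_Integration.integral_combine) (use i fi in auto)
      moreover have "integral {s i..e i} f \<ge> 0"
        using nn by (intro Henstock_Kurzweil_Integration.integral_nonneg fi) auto
      moreover have "integral {s i..e i} f \<le> integral {s i..e i} (\<lambda>x. h x + real N)"
        by (rule integral_le[OF fi(2) integrable_add[OF fi(3)]]) (auto simp: h_def)
      moreover have "integral {s i..e i} (\<lambda>x. h x + real N) = integral {s i..e i} h + real N * (e i - s i)"
        by (subst Henstock_Kurzweil_Integration.integral_add) (use fi i in auto)
      ultimately show ?thesis by (simp add: dist_real_def)
    qed
    then have "(\<Sum>i<n. dist (integral {a..s i} f) (integral {a..e i} f)) \<le>
       (\<Sum>i<n. integral {s i..e i} h + real N * (e i - s i))"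
      by (intro sum_mono) auto
    also have "\<dots> = (\<Sum>i<n. integral {s i..e i} h) + real N * (\<Sum>i<n. e i - s i)"
      by (simp add: sum.distrib sum_distrib_left)
    also have "\<dots> \<le> integral {a..b} h + real N * \<delta>"
      using small by (intro add_mono sum_integral_nonoverlapping_le hint hnn I disj mult_left_mono) auto
    also have "\<dots> < \<epsilon> / 2 + \<epsilon> / 2"
    proof (rule add_less_le_mono[OF hle])
      have "real N * \<delta> \<le> (real N + 1) * \<delta>" using \<open>\<epsilon> > 0\<close> by (intro mult_right_mono) (auto simp: \<delta>_def)
      also have "\<dots> = \<epsilon> / 2" by (simp add: \<delta>_def field_simps add_nonneg_eq_0_iff)
      finally show "real N * \<delta> \<le> \<epsilon> / 2" .
    qed
    finally show ?thesis by simp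
  qed
  moreover have "\<delta> > 0" using \<open>\<epsilon> > 0\<close> by (auto simp: \<delta>_def)
  ultimately show "\<exists>\<delta>>0. \<forall>(n::nat) s e.
        (\<forall>i<n. a \<le> s i \<and> s i \<le> e i \<and> e i \<le> b) \<and>
        (\<forall>i<n. \<forall>j<n. i \<noteq> j \<longrightarrow> e i \<le> s j \<or> e j \<le> s i) \<and>
        (\<Sum>i<n. e i - s i) < \<delta> \<longrightarrow> (\<Sum>i<n. dist (integral {a..s i} f) (integral {a..e i} f)) < \<epsilon>"
    by blast
qed

text \<open>Translating the integral cancels everything except a window of length \<delta> at each
  end, and monotonicity estimates both windows by end values. The bound does not depend on \<delta>
  except through \<open>b + \<delta>\<close>, which is what the later application of Fatou's lemma
  requires.\<close>

lemma nn_integral_mono_diff_quotient_le: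
  fixes \<phi> :: "real \<Rightarrow> real"
  assumes "mono \<phi>" and "\<delta> > 0" and "a \<le> b"
  shows "(\<integral>\<^sup>+s. ennreal ((\<phi> (s + \<delta>) - \<phi> s) / \<delta>) * indicator {a..b} s \<partial>lborel) \<le> ennreal (\<phi> (b + \<delta>) - \<phi> a)"
proof -
  have I: "\<phi> integrable_on {c..d}" for c d
    using \<open>mono \<phi>\<close> by (intro integrable_on_mono_on) (auto simp: mono_def mono_on_def)
  have I': "(\<lambda>s. \<phi> (s + \<delta>)) integrable_on {c..d}" for c d
    using \<open>mono \<phi>\<close> by (intro integrable_on_mono_on) (auto simp: mono_def mono_on_def)
  have sh: "integral {a..b} (\<lambda>s. \<phi> (s + \<delta>)) = integral {a+\<delta>..b+\<delta>} \<phi>"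
    using integral_shift_real_ivl[of "a+\<delta>" \<delta> "b+\<delta>" \<phi>] by simp
  have "integral {a..b} \<phi> + integral {b..b+\<delta>} \<phi> = integral {a..b+\<delta>} \<phi>"
    by (rule Henstock_Kurzweil_Integration.integral_combine) (use assms I in auto)
  moreover have "integral {a..a+\<delta>} \<phi> + integral {a+\<delta>..b+\<delta>} \<phi> = integral {a..b+\<delta>} \<phi>"
    by (rule Henstock_Kurzweil_Integration.integral_combine) (use assms I in auto)
  moreover have "integral {b..b+\<delta>} \<phi> \<le> integral {b..b+\<delta>} (\<lambda>s. \<phi> (b+\<delta>))"
    by (rule integral_le) (use I \<open>mono \<phi>\<close> in \<open>auto simp: mono_def\<close>)
  moreover have "integral {a..a+\<delta>} (\<lambda>s. \<phi> a) \<le> integral {a..a+\<delta>} \<phi>"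
    by (rule integral_le) (use I \<open>mono \<phi>\<close> in \<open>auto simp: mono_def\<close>)
  ultimately have le: "integral {a..b} (\<lambda>s. \<phi> (s + \<delta>)) - integral {a..b} \<phi> \<le> \<delta> * (\<phi> (b+\<delta>) - \<phi> a)"
    using sh \<open>\<delta> > 0\<close> by (simp add: algebra_simps)
  have hi: "((\<lambda>s. (\<phi> (s + \<delta>) - \<phi> s) / \<delta>) has_integral
      ((integral {a..b} (\<lambda>s. \<phi> (s + \<delta>)) - integral {a..b} \<phi>) / \<delta>)) {a..b}"
    by (intro has_integral_divide has_integral_diff integrable_integral I I')
  have "(\<integral>\<^sup>+s. ennreal ((\<phi> (s + \<delta>) - \<phi> s) / \<delta>) * indicator {a..b} s \<partial>lborel)
    = ennreal ((integral {a..b} (\<lambda>s. \<phi> (s + \<delta>)) - integral {a..b} \<phi>) / \<delta>)"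
    by (rule nn_integral_has_integral_lebesgue'[OF _ hi]) (use \<open>mono \<phi>\<close> \<open>\<delta> > 0\<close> in \<open>auto simp: mono_def\<close>)
  also have "\<dots> \<le> ennreal (\<phi> (b + \<delta>) - \<phi> a)"
    using le \<open>\<delta> > 0\<close> by (intro ennreal_leI) (simp add: field_simps)
  finally show ?thesis .
qed

section \<open>Gronwall estimate for Lipschitz curves\<close>

lemma half_ln_one_plus_square_lipschitz:
  "\<bar>ln (1 + r\<^sup>2) / 2 - ln (1 + s\<^sup>2) / 2\<bar> \<le> \<bar>r - s\<bar>" for r s :: real
proof -
  have "norm (ln (1 + r\<^sup>2) / 2 - ln (1 + s\<^sup>2) / 2) \<le> 1 * norm (r - s)"
  proof (rule field_differentiable_bound[where S=UNIV and f'="\<lambda>z. z / (1 + z\<^sup>2)"])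
    fix z :: real
    have pos: "1 + z\<^sup>2 > 0" by (simp add: add_pos_nonneg)
    show "((\<lambda>r. ln (1 + r\<^sup>2) / 2) has_field_derivative z / (1 + z\<^sup>2)) (at z within UNIV)"
      using pos by (auto intro!: derivative_eq_intros simp: field_simps)
    have "\<bar>z\<bar> \<le> 1 + z\<^sup>2"
    proof (cases "\<bar>z\<bar> \<le> 1")
      case False
      then have "\<bar>z\<bar> * 1 \<le> \<bar>z\<bar> * \<bar>z\<bar>" by (intro mult_left_mono) auto
      then show ?thesis by (simp add: power2_eq_square)
    qed (simp add: add_increasing2)
    then show "norm (z / (1 + z\<^sup>2)) \<le> 1" using pos by (simp add: field_simps)
  qed auto
  then show ?thesis by simp
qed

text \<open>A logarithm turns linear growth into a bound on a derivative. With the square,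
  \<open>z\<close> is differentiable wherever \<open>x\<close> is, also at zeros of
  \<open>x\<close>, and it stays Lipschitz, hence is the integral of its derivative. From
  \<open>r + r\<^sup>2 \<le> 2 * (1 + r\<^sup>2)\<close> one gets the rate \<open>2 * c t\<close>
  for \<open>z\<close>, that is \<open>4 * c t\<close> for the logarithm of
  \<open>1 + (norm (x t))\<^sup>2\<close>.\<close>

lemma gronwall_lipschitz:
  fixes x :: "real \<Rightarrow> 'a::euclidean_space"
  assumes lip: "\<And>s t. norm (x s - x t) \<le> C * \<bar>s - t\<bar>" and "a \<le> b"
    and c: "c integrable_on {a..b}" "\<And>t. t \<in> {a..b} \<Longrightarrow> c t \<ge> 0"
    and growth: "AE t in lborel. t \<in> {a..b} \<longrightarrow>
      (\<exists>d. (x has_vector_derivative d) (at t) \<and> norm d \<le> c t * (1 + norm (x t)))"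
  shows "norm (x b) \<le> (1 + (norm (x a))\<^sup>2) * exp (4 * integral {a..b} c)"
proof -
  define z where "z t = ln (1 + (norm (x t))\<^sup>2) / 2" for t
  have pos: "1 + (norm (x t))\<^sup>2 > 0" for t by (simp add: add_pos_nonneg)
  have "norm (z s - z t) \<le> C * \<bar>s - t\<bar>" for s t
  proof -
    have "norm (z s - z t) \<le> \<bar>norm (x s) - norm (x t)\<bar>"
      unfolding z_def real_norm_def by (rule half_ln_one_plus_square_lipschitz)
    also have "\<dots> \<le> norm (x s - x t)" by (rule norm_triangle_ineq3)
    finally show ?thesis using lip[of s t] by linarith
  qed
  from lipschitz_has_integral_derivative[of z, OF this] obtain g where
    g: "\<And>a b. a \<le> b \<Longrightarrow> (g has_integral (z b - z a)) {a..b}" "AE t in lborel. (z has_vector_derivative g t) (at t)"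
    by blast
  have "AE t in lborel. t \<in> {a..b} \<longrightarrow> g t \<le> 2 * c t"
    using g(2) growth
  proof eventually_elim
    case (elim t)
    show ?case
    proof
      assume t: "t \<in> {a..b}"
      then obtain d where d: "(x has_vector_derivative d) (at t)" "norm d \<le> c t * (1 + norm (x t))"
        using elim(2) by blast
      have "((\<lambda>t. x t \<bullet> x t) has_derivative (\<lambda>h. x t \<bullet> (h *\<^sub>R d) + (h *\<^sub>R d) \<bullet> x t)) (at t)"
        using d(1) by (intro has_derivative_inner) (simp_all add: has_vector_derivative_def)
      then have "((\<lambda>t. x t \<bullet> x t) has_real_derivative 2 * (x t \<bullet> d)) (at t)"
        unfolding has_field_derivative_def
        by (rule has_derivative_eq_rhs) (simp add: fun_eq_iff inner_commute[of d])
      then have "((\<lambda>t. ln (1 + x t \<bullet> x t) / 2) has_real_derivative (x t \<bullet> d) / (1 + x t \<bullet> x t)) (at t)"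
        using pos[of t] by (auto intro!: derivative_eq_intros simp: power2_norm_eq_inner field_simps)
      then have "(z has_vector_derivative (x t \<bullet> d) / (1 + (norm (x t))\<^sup>2)) (at t)"
        by (simp add: z_def[abs_def] power2_norm_eq_inner has_real_derivative_iff_has_vector_derivative)
      with elim(1) have gt: "g t = (x t \<bullet> d) / (1 + (norm (x t))\<^sup>2)" by (rule vector_derivative_unique_at)
      define r where "r = norm (x t)"
      have "r \<ge> 0" by (simp add: r_def)
      have ct: "c t \<ge> 0" using c(2)[OF t] .
      have "x t \<bullet> d \<le> r * norm d" unfolding r_def by (rule norm_cauchy_schwarz)
      also have "\<dots> \<le> r * (c t * (1 + r))" using d(2) \<open>r \<ge> 0\<close> by (intro mult_left_mono) (auto simp: r_def)
      also have "\<dots> = c t * (r + r\<^sup>2)" by (simp add: power2_eq_square algebra_simps)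
      also have "\<dots> \<le> c t * (2 * (1 + r\<^sup>2))"
      proof (intro mult_left_mono ct)
        have "0 \<le> (r - 1)\<^sup>2" by simp
        then have r2: "2 * r \<le> 1 + r\<^sup>2" by (simp add: power2_eq_square algebra_simps)
        have le: "r + q \<le> 2 * (1 + q)" if "2 * r \<le> 1 + q" "0 \<le> q" for q using that by simp
        show "r + r\<^sup>2 \<le> 2 * (1 + r\<^sup>2)" by (rule le[OF r2]) simp
      qed
      finally show "g t \<le> 2 * c t"
        using pos[of t] unfolding gt by (simp add: pos_divide_le_eq r_def algebra_simps)
    qed
  qed
  then have "negligible {t. \<not> (t \<in> {a..b} \<longrightarrow> g t \<le> 2 * c t)}" by (simp add: AE_lborel_iff_negligible)
  \<comment> \<open>The comparison of integrals asks for an inequality at every point; the minimum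
    provides it and changes \<open>g\<close> only on a null set.\<close>
  then have "((\<lambda>t. min (g t) (2 * c t)) has_integral (z b - z a)) {a..b}"
    by (rule has_integral_spike[OF _ _ g(1)[OF \<open>a \<le> b\<close>]]) auto
  moreover have "((\<lambda>t. 2 * c t) has_integral 2 * integral {a..b} c) {a..b}"
    using c(1) by (intro has_integral_mult_right integrable_integral)
  ultimately have "z b - z a \<le> 2 * integral {a..b} c" by (rule has_integral_le) auto
  then have "ln (1 + (norm (x b))\<^sup>2) \<le> ln (1 + (norm (x a))\<^sup>2) + 4 * integral {a..b} c"
    by (simp add: z_def)
  then have "exp (ln (1 + (norm (x b))\<^sup>2)) \<le> exp (ln (1 + (norm (x a))\<^sup>2) + 4 * integral {a..b} c)" by simp
  then have "1 + (norm (x b))\<^sup>2 \<le> (1 + (norm (x a))\<^sup>2) * exp (4 * integral {a..b} c)"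
    using pos by (simp add: exp_add)
  moreover have "norm (x b) \<le> 1 + (norm (x b))\<^sup>2"
  proof -
    have "0 \<le> (norm (x b) - 1)\<^sup>2" by simp
    then have "2 * norm (x b) \<le> 1 + (norm (x b))\<^sup>2" by (simp add: power2_eq_square algebra_simps)
    then show ?thesis using norm_ge_zero[of "x b"] by linarith
  qed
  ultimately show ?thesis by linarith
qed

lemma abs_continuous_on_dominated:
  assumes g: "abs_continuous_on a b g" and "A \<ge> 0"
    and le: "\<And>s e. a \<le> s \<Longrightarrow> s \<le> e \<Longrightarrow> e \<le> b \<Longrightarrow> dist (f s) (f e) \<le> A * (e - s) + dist (g s) (g e)"
  shows "abs_continuous_on a b f"
  unfolding abs_continuous_on_def
proof (intro allI impI)
  fix \<epsilon> :: real assume "\<epsilon> > 0"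
  then have "\<epsilon> / 2 > 0" by simp
  from g[unfolded abs_continuous_on_def, rule_format, OF this]
  obtain \<delta> where \<delta>: "\<delta> > 0" "\<forall>(n::nat) s e. (\<forall>i<n. a \<le> s i \<and> s i \<le> e i \<and> e i \<le> b) \<and>
        (\<forall>i<n. \<forall>j<n. i \<noteq> j \<longrightarrow> e i \<le> s j \<or> e j \<le> s i) \<and>
        (\<Sum>i<n. e i - s i) < \<delta> \<longrightarrow> (\<Sum>i<n. dist (g (s i)) (g (e i))) < \<epsilon> / 2"
    by blast
  define \<delta>' where "\<delta>' = min \<delta> (\<epsilon> / (2 * (A + 1)))"
  have "(\<Sum>i<n. dist (f (s i)) (f (e i))) < \<epsilon>"
    if I: "\<forall>i<n. a \<le> s i \<and> s i \<le> e i \<and> e i \<le> b"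
      and d: "\<forall>i<n. \<forall>j<n. i \<noteq> j \<longrightarrow> e i \<le> s j \<or> e j \<le> s i"
      and small: "(\<Sum>i<n. e i - s i) < \<delta>'" for n :: nat and s e
  proof -
    have "(\<Sum>i<n. dist (f (s i)) (f (e i))) \<le> (\<Sum>i<n. A * (e i - s i) + dist (g (s i)) (g (e i)))"
      using I by (intro sum_mono le) auto
    also have "\<dots> = A * (\<Sum>i<n. e i - s i) + (\<Sum>i<n. dist (g (s i)) (g (e i)))"
      by (simp add: sum.distrib sum_distrib_left)
    also have "\<dots> < \<epsilon> / 2 + \<epsilon> / 2"
    proof (rule add_le_less_mono)
      have "A * (\<Sum>i<n. e i - s i) \<le> A * (\<epsilon> / (2 * (A + 1)))"
        using small \<open>A \<ge> 0\<close> by (intro mult_left_mono) (auto simp: \<delta>'_def)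
      also have "\<dots> \<le> (A + 1) * (\<epsilon> / (2 * (A + 1)))"
        using \<open>A \<ge> 0\<close> \<open>\<epsilon> > 0\<close> by (intro mult_right_mono) auto
      also have "\<dots> = \<epsilon> / 2" using \<open>A \<ge> 0\<close> by (simp add: field_simps)
      finally show "A * (\<Sum>i<n. e i - s i) \<le> \<epsilon> / 2" .
      show "(\<Sum>i<n. dist (g (s i)) (g (e i))) < \<epsilon> / 2"
        using \<delta>(2)[THEN spec, THEN spec, THEN spec, of n s e] I d small by (simp add: \<delta>'_def)
    qed
    finally show ?thesis by simp
  qed
  moreover have "\<delta>' > 0" using \<delta>(1) \<open>\<epsilon> > 0\<close> \<open>A \<ge> 0\<close> by (simp add: \<delta>'_def)
  ultimately show "\<exists>\<delta>>0. \<forall>(n::nat) s e.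
        (\<forall>i<n. a \<le> s i \<and> s i \<le> e i \<and> e i \<le> b) \<and>
        (\<forall>i<n. \<forall>j<n. i \<noteq> j \<longrightarrow> e i \<le> s j \<or> e j \<le> s i) \<and>
        (\<Sum>i<n. e i - s i) < \<delta> \<longrightarrow> (\<Sum>i<n. dist (f (s i)) (f (e i))) < \<epsilon>"
    by blast
qed

section \<open>Epigraphs and normal cones\<close>

lemma lsc_on_eventually:
  assumes "lsc_on S \<phi>" "z \<in> S" "c < \<phi> z"
  shows "eventually (\<lambda>y. y \<in> S \<longrightarrow> c < \<phi> y) (nhds z)"
proof -
  have "eventually (\<lambda>y. c < \<phi> y) (at z within S)"
    using assms by (auto simp: lsc_on_def le_Liminf_iff)
  then show ?thesis
    unfolding eventually_at_filter by eventually_elim (use assms in auto)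
qed

lemma lsc_on_seq:
  assumes "lsc_on S \<phi>" "z \<in> S" "c < \<phi> z" "\<And>n. zn n \<in> S" "zn \<longlonglongrightarrow> z"
  shows "eventually (\<lambda>n. c < \<phi> (zn n)) sequentially"
  using filterlim_iff[THEN iffD1, rule_format, OF assms(5) lsc_on_eventually[OF assms(1-3)]]
  by eventually_elim (use assms in auto)

lemma closed_ext_epi:
  fixes \<phi> :: "'z::first_countable_topology \<Rightarrow> ereal"
  assumes "lsc_on UNIV \<phi>"
  shows "closed (ext_epi \<phi>)"
  unfolding closed_sequential_limits
proof (intro allI impI)
  fix w l assume as: "(\<forall>n. w n \<in> ext_epi \<phi>) \<and> w \<longlonglongrightarrow> l"
  obtain z r where l: "l = (z, r)" by force
  have z: "(\<lambda>n. fst (w n)) \<longlonglongrightarrow> z" and r: "(\<lambda>n. snd (w n)) \<longlonglongrightarrow> r"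
    using as l by (auto dest: tendsto_fst tendsto_snd)
  have "\<phi> z \<le> ereal r"
  proof (rule ccontr)
    assume "\<not> \<phi> z \<le> ereal r"
    then obtain c where c: "ereal r < ereal c" "ereal c < \<phi> z"
      using ereal_dense2 by (meson not_le)
    have "eventually (\<lambda>n. ereal c < \<phi> (fst (w n))) sequentially"
      by (rule lsc_on_seq[OF assms _ c(2) _ z]) auto
    moreover have "eventually (\<lambda>n. snd (w n) < c) sequentially"
      using r c by (intro order_tendstoD) auto
    ultimately have "eventually (\<lambda>n. False) sequentially"
    proof eventually_elim
      case (elim n)
      have "\<phi> (fst (w n)) \<le> ereal (snd (w n))" using as by (auto simp: ext_epi_def split_beta)
      with elim show False by (metis less_ereal.simps(1) not_less order_trans less_imp_le)
    qed
    then show False by simp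
  qed
  then show "l \<in> ext_epi \<phi>" by (simp add: l ext_epi_def)
qed

lemma tangent_cone_approx:
  assumes "\<zeta> \<in> tangent_cone E w" "\<epsilon> > 0" "\<delta> > 0"
  shows "\<exists>\<tau>>0. \<tau> < \<delta> \<and> infdist (w + \<tau> *\<^sub>R \<zeta>) E < \<epsilon> * \<tau>"
proof (rule ccontr)
  assume no: "\<not> ?thesis"
  have "eventually (\<lambda>\<tau>. ereal \<epsilon> \<le> ereal (infdist (w + \<tau> *\<^sub>R \<zeta>) E / \<tau>)) (at_right 0)"
    unfolding eventually_at_right_field
  proof (intro exI[of _ \<delta>] conjI allI impI)
    fix \<tau> :: real assume "\<tau> > 0" "\<tau> < \<delta>"
    then have "\<epsilon> * \<tau> \<le> infdist (w + \<tau> *\<^sub>R \<zeta>) E" using no by auto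
    then show "ereal \<epsilon> \<le> ereal (infdist (w + \<tau> *\<^sub>R \<zeta>) E / \<tau>)"
      using \<open>\<tau> > 0\<close> by (simp add: field_simps)
  qed (use assms in auto)
  then have "ereal \<epsilon> \<le> Liminf (at_right (0::real)) (\<lambda>\<tau>. ereal (infdist (w + \<tau> *\<^sub>R \<zeta>) E / \<tau>))"
    by (rule Liminf_bounded)
  then show False using assms by (simp add: tangent_cone_def)
qed

text \<open>Minimality of the distance gives an inequality with a quadratic error for all points of
  \<open>E\<close>. For points approaching \<open>s\<close> along a tangent direction, at distance
  of order \<tau>, that error is of order \<open>\<tau>\<^sup>2\<close> and disappears after
  division by \<tau>.\<close>

lemma closest_point_normal_cone:
  fixes w :: "'z::euclidean_space"
  assumes "closed E" "E \<noteq> {}"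
  shows "w - closest_point E w \<in> normal_cone E (closest_point E w)"
proof -
  define s where "s = closest_point E w"
  define n where "n = w - s"
  have prox: "(y - s) \<bullet> n \<le> (norm (y - s))\<^sup>2 / 2" if "y \<in> E" for y
  proof -
    have "dist w s \<le> dist w y" using closest_point_le[OF assms(1) that] by (simp add: s_def)
    then have "(norm n)\<^sup>2 \<le> (norm (n - (y - s)))\<^sup>2"
      by (intro power_mono) (auto simp: n_def dist_norm)
    also have "\<dots> = (norm n)\<^sup>2 - 2 * ((y - s) \<bullet> n) + (norm (y - s))\<^sup>2"
      by (simp add: power2_norm_eq_inner inner_diff_left inner_diff_right inner_commute)
    finally show ?thesis by simp
  qed
  have "\<zeta> \<bullet> n \<le> 0" if \<zeta>: "\<zeta> \<in> tangent_cone E s" for \<zeta>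
  proof (rule field_le_epsilon)
    fix e :: real assume "e > 0"
    \<comment> \<open>Two errors share \<open>e\<close>: deviating from the tangent ray costs
      \<open>\<epsilon> * norm n\<close>, and the quadratic term costs \<open>\<tau> * A\<close>,
      where \<open>A\<close> bounds half the squared distance from \<open>s\<close> divided by
      \<open>\<tau>\<^sup>2\<close>. Each is at most \<open>e / 2\<close>.\<close>
    define \<epsilon> where "\<epsilon> = e / (2 * (norm n + 1))"
    have \<epsilon>: "\<epsilon> > 0" using \<open>e > 0\<close> by (auto simp: \<epsilon>_def intro!: divide_pos_pos add_nonneg_pos)
    define A where "A = (norm \<zeta> + \<epsilon>)\<^sup>2 / 2"
    have "norm \<zeta> + \<epsilon> > 0" using \<epsilon> by (rule add_nonneg_pos[OF norm_ge_zero])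
    then have A: "A > 0" by (simp add: A_def)
    have "e / (2 * A) > 0" using A \<open>e > 0\<close> by simp
    from tangent_cone_approx[OF \<zeta> \<epsilon> this]
    obtain \<tau> where \<tau>: "\<tau> > 0" "\<tau> < e / (2 * A)" "infdist (s + \<tau> *\<^sub>R \<zeta>) E < \<epsilon> * \<tau>" by auto
    obtain y where y: "y \<in> E" "infdist (s + \<tau> *\<^sub>R \<zeta>) E = dist (s + \<tau> *\<^sub>R \<zeta>) y"
      using infdist_attains_inf[OF assms] by metis
    define q where "q = s + \<tau> *\<^sub>R \<zeta> - y"
    have q: "norm q \<le> \<epsilon> * \<tau>" using y \<tau> by (simp add: q_def dist_norm)
    have ys: "y - s = \<tau> *\<^sub>R \<zeta> - q" by (simp add: q_def)
    have "norm (y - s) \<le> \<tau> * norm \<zeta> + norm q"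
      unfolding ys using norm_triangle_ineq4[of "\<tau> *\<^sub>R \<zeta>" q] \<tau>(1) by simp
    also have "\<dots> \<le> \<tau> * (norm \<zeta> + \<epsilon>)" using q by (simp add: algebra_simps)
    finally have "(norm (y - s))\<^sup>2 \<le> (\<tau> * (norm \<zeta> + \<epsilon>))\<^sup>2" by (intro power_mono) auto
    then have 1: "(norm (y - s))\<^sup>2 / 2 \<le> \<tau> * (\<tau> * A)" by (simp add: A_def power2_eq_square mult_ac)
    have 2: "q \<bullet> n \<le> \<tau> * (\<epsilon> * norm n)"
      using norm_cauchy_schwarz[of q n] mult_right_mono[OF q, of "norm n"] by (simp add: algebra_simps)
    have "\<tau> * (\<zeta> \<bullet> n) = (y - s) \<bullet> n + q \<bullet> n" unfolding ys by (simp add: inner_diff_left)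
    also have "\<dots> \<le> \<tau> * (\<tau> * A + \<epsilon> * norm n)" using prox[OF y(1)] 1 2 by (simp add: algebra_simps)
    finally have "\<zeta> \<bullet> n \<le> \<tau> * A + \<epsilon> * norm n" using \<tau>(1) by simp
    also have "\<tau> * A \<le> e / 2" using \<tau>(2) A by (simp add: field_simps)
    also have "\<epsilon> * norm n \<le> \<epsilon> * (norm n + 1)" using \<epsilon> by simp
    also have "\<dots> = e / 2" using norm_ge_zero[of n] by (simp add: \<epsilon>_def field_simps add_nonneg_eq_0_iff)
    finally show "\<zeta> \<bullet> n \<le> 0 + e" by simp
  qed
  then show ?thesis by (simp add: normal_cone_def n_def s_def)
qed

text \<open>Raising a point together with its competitors keeps the competitors in the epigraph and
  all distances unchanged.\<close>

lemma infdist_ext_epi_shift: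
  fixes z :: "'z::real_normed_vector"
  assumes "c \<ge> 0"
  shows "infdist (z, r + c) (ext_epi \<phi>) \<le> infdist (z, r) (ext_epi \<phi>)"
proof (cases "ext_epi \<phi> = {}")
  case False
  have "infdist (z, r + c) (ext_epi \<phi>) \<le> dist (z, r) a" if "a \<in> ext_epi \<phi>" for a
  proof -
    obtain y q where a: "a = (y, q)" by force
    have "\<phi> y \<le> ereal q" using that by (simp add: a ext_epi_def)
    also have "\<dots> \<le> ereal (q + c)" using assms by simp
    finally have "(y, q + c) \<in> ext_epi \<phi>" by (simp add: ext_epi_def)
    then have "infdist (z, r + c) (ext_epi \<phi>) \<le> dist (z, r + c) (y, q + c)" by (rule infdist_le)
    also have "\<dots> = dist (z, r) a" by (simp add: a dist_prod_def dist_real_def)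
    finally show ?thesis .
  qed
  then show ?thesis using False unfolding infdist_def[of "(z, r)"] by (auto intro: cINF_greatest)
qed (simp add: infdist_def)

text \<open>A projection on the epigraph may lie strictly above the graph, while the hypothesis on
  \<open>U\<close> speaks of normals at points of the graph. Lifting the base point enlarges the
  tangent cone, so a normal found higher up is also one on the graph.\<close>

lemma normal_cone_ext_epi_mono:
  fixes z :: "'z::real_inner"
  assumes "r0 \<le> r"
  shows "normal_cone (ext_epi \<phi>) (z, r) \<subseteq> normal_cone (ext_epi \<phi>) (z, r0)"
proof -
  have "tangent_cone (ext_epi \<phi>) (z, r0) \<subseteq> tangent_cone (ext_epi \<phi>) (z, r)"
  proof
    fix \<zeta> assume \<zeta>: "\<zeta> \<in> tangent_cone (ext_epi \<phi>) (z, r0)"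
    have le: "infdist ((z, r) + \<tau> *\<^sub>R \<zeta>) (ext_epi \<phi>) \<le> infdist ((z, r0) + \<tau> *\<^sub>R \<zeta>) (ext_epi \<phi>)" for \<tau>
      using infdist_ext_epi_shift[of "r - r0" "z + \<tau> *\<^sub>R fst \<zeta>" "r0 + \<tau> *\<^sub>R snd \<zeta>" \<phi>] assms
      by (cases \<zeta>) (simp add: algebra_simps)
    have pos: "eventually (\<lambda>\<tau>::real. \<tau> > 0) (at_right 0)" by (simp add: eventually_at_right_less)
    have "Liminf (at_right (0::real)) (\<lambda>\<tau>. ereal (infdist ((z, r) + \<tau> *\<^sub>R \<zeta>) (ext_epi \<phi>) / \<tau>)) \<le>
       Liminf (at_right (0::real)) (\<lambda>\<tau>. ereal (infdist ((z, r0) + \<tau> *\<^sub>R \<zeta>) (ext_epi \<phi>) / \<tau>))"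
      by (rule Liminf_mono) (use pos in eventually_elim, use le in \<open>auto intro: divide_right_mono\<close>)
    also have "\<dots> = 0" using \<zeta> by (simp add: tangent_cone_def)
    finally have "Liminf (at_right (0::real)) (\<lambda>\<tau>. ereal (infdist ((z, r) + \<tau> *\<^sub>R \<zeta>) (ext_epi \<phi>) / \<tau>)) \<le> 0" .
    moreover have "0 \<le> Liminf (at_right (0::real)) (\<lambda>\<tau>. ereal (infdist ((z, r) + \<tau> *\<^sub>R \<zeta>) (ext_epi \<phi>) / \<tau>))"
      by (rule Liminf_bounded) (use pos in eventually_elim, auto simp: infdist_nonneg)
    ultimately show "\<zeta> \<in> tangent_cone (ext_epi \<phi>) (z, r)" by (simp add: tangent_cone_def)
  qed
  then show ?thesis by (auto simp: normal_cone_def)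
qed

text \<open>The upward direction is tangent to an epigraph. The sign decides in which direction
  lower bounds on \<open>L\<close> can be multiplied by \<open>nu\<close>.\<close>

lemma normal_cone_ext_epi_nonpos:
  fixes z :: "'z::real_inner"
  assumes "(n, nu) \<in> normal_cone (ext_epi \<phi>) (z, r)" "\<phi> z \<le> ereal r"
  shows "nu \<le> 0"
proof -
  have 0: "infdist ((z, r) + \<tau> *\<^sub>R (0, 1)) (ext_epi \<phi>) = 0" if "\<tau> > 0" for \<tau> :: real
  proof -
    have "\<phi> z \<le> ereal (r + \<tau>)" using assms(2) that by (meson ereal_less_eq(3) le_add_same_cancel1 less_imp_le order_trans)
    then show ?thesis by (intro infdist_zero) (simp add: ext_epi_def)
  qed
  have "Liminf (at_right (0::real)) (\<lambda>\<tau>. ereal (infdist ((z, r) + \<tau> *\<^sub>R (0, 1)) (ext_epi \<phi>) / \<tau>))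
     = Liminf (at_right (0::real)) (\<lambda>\<tau>. 0)"
    by (rule Liminf_eq) (use eventually_at_right_less[of "0::real"] in eventually_elim, simp only: 0, simp)
  then have "(0, 1) \<in> tangent_cone (ext_epi \<phi>) (z, r)" by (simp add: tangent_cone_def Liminf_const)
  then show ?thesis using assms(1) by (force simp: normal_cone_def)
qed

section \<open>The Hamiltonian\<close>

locale lagrangian =
  fixes T :: real and L :: "real \<Rightarrow> 'a::euclidean_space \<Rightarrow> 'a \<Rightarrow> ereal"
  assumes L1: "L1 T L" and L2: "L2 T L" and L3: "L3 T L" and L4: "L4 T L"
begin

text \<open>Taking the supremum over the effective domain only keeps the conjugate real-valued: for
  \<open>t \<in> {0..T}\<close> the function \<open>L t x\<close> is finite there and the family is
  bounded above (\<open>Ham_bdd\<close>).\<close>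

definition Ham :: "real \<Rightarrow> 'a \<Rightarrow> 'a \<Rightarrow> real" where
  "Ham t x p = (SUP w\<in>{w. L t x w \<noteq> \<infinity>}. p \<bullet> w - real_of_ereal (L t x w))"

section \<open>Local bounds on the Lagrangian by compactness\<close>

lemma L_seq:
  assumes "t \<in> {0..T}" "\<And>n. tn n \<in> {0..T}" "tn \<longlonglongrightarrow> t" "xn \<longlonglongrightarrow> x" "vn \<longlonglongrightarrow> v" "c < L t x v"
  shows "eventually (\<lambda>n. c < L (tn n) (xn n) (vn n)) sequentially"
proof -
  have "eventually (\<lambda>n. c < (\<lambda>(t, x, v). L t x v) (tn n, xn n, vn n)) sequentially"
    using L1 unfolding L1_def
    by (rule lsc_on_seq[where z="(t, x, v)"]) (use assms in \<open>auto intro!: tendsto_Pair\<close>)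
  then show ?thesis by simp
qed

lemma L_proper: "t \<in> {0..T} \<Longrightarrow> L t x v \<noteq> -\<infinity>" "t \<in> {0..T} \<Longrightarrow> \<exists>w. L t x w \<noteq> \<infinity>"
  using L2 by (auto simp: L2_def ext_proper_def)

lemma real_below_L:
  assumes "t \<in> {0..T}" obtains c where "ereal c < L t x v"
  using L_proper(1)[OF assms, of x v] by (metis ereal_dense2 ereal_infty_less(2))

lemma velocity_bound:
  assumes "R \<ge> 0" obtains C where "C \<ge> 0" "\<And>t x v. t \<in> {0..T} \<Longrightarrow> norm x \<le> R \<Longrightarrow> L t x v \<noteq> \<infinity> \<Longrightarrow> norm v \<le> C"
  using L4 assms unfolding L4_def by (meson not_le)

lemma convergent_subseq_txv:
  assumes "\<And>n. tn n \<in> {0..T}" "\<And>n. norm (xn n :: 'a) \<le> R" "\<And>n. norm (vn n :: 'a) \<le> C"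
  obtains t x v r where "strict_mono (r :: nat \<Rightarrow> nat)" "t \<in> {0..T}" "norm x \<le> R" "norm v \<le> C"
    "(tn \<circ> r) \<longlonglongrightarrow> t" "(xn \<circ> r) \<longlonglongrightarrow> x" "(vn \<circ> r) \<longlonglongrightarrow> v"
proof -
  have "compact ({0..T} \<times> cball (0::'a) R \<times> cball (0::'a) C)"
    by (intro compact_Times compact_cball compact_Icc)
  moreover have "\<forall>n. (tn n, xn n, vn n) \<in> {0..T} \<times> cball (0::'a) R \<times> cball (0::'a) C"
    using assms by (auto simp: mem_Times_iff)
  ultimately obtain l r where r: "l \<in> {0..T} \<times> cball (0::'a) R \<times> cball (0::'a) C" "strict_mono (r :: nat \<Rightarrow> nat)"
      "((\<lambda>n. (tn n, xn n, vn n)) \<circ> r) \<longlonglongrightarrow> l"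
    unfolding compact_def by (metis (no_types, lifting))
  obtain t x v where l: "l = (t, x, v)" by (cases l)
  have "((\<lambda>n. (tn (r n), xn (r n), vn (r n))) \<longlonglongrightarrow> (t, x, v))" using r(3) by (simp add: l o_def)
  then have "(tn \<circ> r) \<longlonglongrightarrow> t" "(xn \<circ> r) \<longlonglongrightarrow> x" "(vn \<circ> r) \<longlonglongrightarrow> v"
    using tendsto_fst tendsto_fst[OF tendsto_snd] tendsto_snd[OF tendsto_snd] by (fastforce simp: o_def)+
  then show ?thesis using that[OF r(2)] r(1) l by auto
qed

text \<open>If values tended to minus infinity, (L4) would keep the velocities in a compact set, and
  lower semicontinuity at an accumulation point would give the value minus infinity, against
  properness.\<close>

lemma L_bounded_below:
  assumes "R \<ge> 0"
  obtains K where "K \<ge> 0" "\<And>t x v. t \<in> {0..T} \<Longrightarrow> norm x \<le> R \<Longrightarrow> ereal (- K) \<le> L t x v"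
proof -
  obtain C where C: "C \<ge> 0" "\<And>t x v. t \<in> {0..T} \<Longrightarrow> norm x \<le> R \<Longrightarrow> L t x v \<noteq> \<infinity> \<Longrightarrow> norm v \<le> C"
    using velocity_bound[OF assms] by blast
  have "\<exists>n::nat. \<forall>t x v. t \<in> {0..T} \<longrightarrow> norm x \<le> R \<longrightarrow> ereal (- real n) \<le> L t x v"
  proof (rule ccontr)
    assume "\<not> ?thesis"
    then obtain tn xn vn where n: "\<And>n. tn n \<in> {0..T}" "\<And>n::nat. norm (xn n) \<le> R" 
      and lt: "\<And>n. L (tn n) (xn n) (vn n) < ereal (- real n)"
      by (simp add: not_le) metis
    have "norm (vn n) \<le> C" for n by (rule C(2)[OF n(1)[of n] n(2)[of n]]) (use lt[of n] in auto)
    then obtain t x v r where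
      r: "strict_mono (r :: nat \<Rightarrow> nat)" "t \<in> {0..T}" "norm x \<le> R" "norm v \<le> C"
      "(tn \<circ> r) \<longlonglongrightarrow> t" "(xn \<circ> r) \<longlonglongrightarrow> x" "(vn \<circ> r) \<longlonglongrightarrow> v"
      by (rule convergent_subseq_txv[of tn xn R vn C, OF n])
    obtain c where c: "ereal c < L t x v" using real_below_L[OF r(2)] by blast
    have "eventually (\<lambda>n. ereal c < L ((tn \<circ> r) n) ((xn \<circ> r) n) ((vn \<circ> r) n)) sequentially"
      by (rule L_seq[OF r(2) _ r(5-7) c]) (use n in auto)
    moreover have "eventually (\<lambda>n. nat \<lceil>\<bar>c\<bar>\<rceil> \<le> n) sequentially" by (rule eventually_ge_at_top)
    ultimately have "eventually (\<lambda>n. False) sequentially"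
    proof eventually_elim
      case (elim n)
      have "n \<le> r n" using r(1) by (rule seq_suble)
      then have "- real (r n) \<le> c" using elim(2) by linarith
      moreover have "ereal c < ereal (- real (r n))"
        using less_trans[OF elim(1), of "ereal (- real (r n))"] lt[of "r n"] by (simp only: o_def)
      ultimately show False by simp
    qed
    then show False by simp
  qed
  then show ?thesis using that by (metis of_nat_0_le_iff)
qed

text \<open>This is where (L3) enters: at an accumulation point of a sequence of counterexamples
  some velocity has finite cost, and (L3) supplies velocities with nearly that cost at the nearby
  points.\<close>

lemma L_bounded_above:
  assumes "R \<ge> 0"
  obtains M where "M \<ge> 0" "\<And>t x. t \<in> {0..T} \<Longrightarrow> norm x \<le> R \<Longrightarrow> \<exists>w. L t x w \<le> ereal M"
proof -
  have "\<exists>n::nat. \<forall>t x. t \<in> {0..T} \<longrightarrow> norm x \<le> R \<longrightarrow> (\<exists>w. L t x w \<le> ereal (real n))"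
  proof (rule ccontr)
    assume "\<not> ?thesis"
    then obtain tn xn where n: "\<And>n. tn n \<in> {0..T}" "\<And>n::nat. norm (xn n) \<le> R" 
      and gt: "\<And>n w. ereal (real n) < L (tn n) (xn n) w"
      by (simp add: not_le) metis
    obtain t x r where
      r: "strict_mono (r :: nat \<Rightarrow> nat)" "t \<in> {0..T}" "(tn \<circ> r) \<longlonglongrightarrow> t" "(xn \<circ> r) \<longlonglongrightarrow> x"
      using convergent_subseq_txv[of tn xn R "\<lambda>_. 0" 0] n by (metis norm_zero order_refl)
    obtain w where w: "L t x w \<noteq> \<infinity>" using L_proper(2)[OF r(2)] by blast
    then obtain c where c: "L t x w < ereal c" by (metis ereal_dense2 ereal_infty_less(1))
    have "(\<forall>n. (tn \<circ> r) n \<in> {0..T}) \<and> (tn \<circ> r) \<longlonglongrightarrow> t \<and> (xn \<circ> r) \<longlonglongrightarrow> x" using n r by auto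
    then obtain vn where vn: "(\<lambda>n. L ((tn \<circ> r) n) ((xn \<circ> r) n) (vn n)) \<longlonglongrightarrow> L t x w"
      using L3 r(2) unfolding L3_def by blast
    have "eventually (\<lambda>n. L ((tn \<circ> r) n) ((xn \<circ> r) n) (vn n) < ereal c) sequentially"
      by (rule order_tendstoD(2)[OF vn c])
    moreover have "eventually (\<lambda>n. nat \<lceil>\<bar>c\<bar>\<rceil> \<le> n) sequentially" by (rule eventually_ge_at_top)
    ultimately have "eventually (\<lambda>n. False) sequentially"
    proof eventually_elim
      case (elim n)
      have "n \<le> r n" using r(1) by (rule seq_suble)
      then have "c \<le> real (r n)" using elim(2) by linarith
      moreover have "ereal (real (r n)) < ereal c"
        using less_trans[OF gt[of "r n" "vn n"], of "ereal c"] elim(1) by (simp only: o_def)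
      ultimately show False by simp
    qed
    then show False by simp
  qed
  then show ?thesis using that by (metis of_nat_0_le_iff)
qed

lemma L_real:
  assumes "t \<in> {0..T}" "L t x v \<noteq> \<infinity>"
  shows "L t x v = ereal (real_of_ereal (L t x v))"
  using assms L_proper(1)[OF assms(1)] by (auto simp: ereal_real)

section \<open>Conjugacy between the Lagrangian and the Hamiltonian\<close>

lemma Ham_bdd:
  assumes t: "t \<in> {0..T}"
  shows "bdd_above ((\<lambda>w. p \<bullet> w - real_of_ereal (L t x w)) ` {w. L t x w \<noteq> \<infinity>})"
proof -
  obtain C where C: "\<And>v. L t x v \<noteq> \<infinity> \<Longrightarrow> norm v \<le> C"
    using velocity_bound[of "norm x"] t by (metis norm_ge_zero order_refl)
  obtain K where K: "\<And>v. ereal (- K) \<le> L t x v"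
    using L_bounded_below[of "norm x"] t by (metis norm_ge_zero order_refl)
  show ?thesis
  proof (rule bdd_aboveI2)
    fix w assume "w \<in> {w. L t x w \<noteq> \<infinity>}"
    then have w: "L t x w \<noteq> \<infinity>" by simp
    have "p \<bullet> w \<le> norm p * C"
      using norm_cauchy_schwarz[of p w] mult_left_mono[OF C[OF w], of "norm p"] by simp
    moreover have "- K \<le> real_of_ereal (L t x w)" using K[of w] L_real[OF t w] by (metis ereal_less_eq(3))
    ultimately show "p \<bullet> w - real_of_ereal (L t x w) \<le> norm p * C + K" by simp
  qed
qed

lemma Ham_ge:
  assumes "t \<in> {0..T}" "L t x v \<le> ereal r"
  shows "p \<bullet> v - r \<le> Ham t x p"
proof -
  have v: "L t x v \<noteq> \<infinity>" using assms by auto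
  have "real_of_ereal (L t x v) \<le> r" using L_real[OF assms(1) v] assms(2) by (metis ereal_less_eq(3))
  moreover have "p \<bullet> v - real_of_ereal (L t x v) \<le> Ham t x p"
    unfolding Ham_def by (rule cSUP_upper[OF _ Ham_bdd[OF assms(1)]]) (use v in simp)
  ultimately show ?thesis by simp
qed

lemma Ham_le:
  assumes "t \<in> {0..T}" "\<And>w r. L t x w = ereal r \<Longrightarrow> p \<bullet> w - r \<le> c"
  shows "Ham t x p \<le> c"
  unfolding Ham_def
  by (rule cSUP_least) (use L_proper(2)[OF assms(1)] L_real[OF assms(1)] assms(2) in auto)

text \<open>Near-maximizers at nearby points are bounded by (L4). Lower semicontinuity of
  \<open>L\<close> makes an accumulation point of them a competitor at \<open>(t, x)\<close> whose
  value exceeds the supremum by \<epsilon>.\<close>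

lemma Ham_usc:
  assumes t: "t \<in> {0..T}" and "\<epsilon> > 0"
  obtains \<delta> where "\<delta> > 0" "\<And>t' x'. t' \<in> {0..T} \<Longrightarrow> \<bar>t' - t\<bar> < \<delta> \<Longrightarrow> norm (x' - x) < \<delta> \<Longrightarrow> Ham t' x' p \<le> Ham t x p + \<epsilon>"
proof -
  have "\<exists>n::nat. \<forall>t' x'. t' \<in> {0..T} \<longrightarrow> \<bar>t' - t\<bar> < 1 / real (Suc n) \<longrightarrow> norm (x' - x) < 1 / real (Suc n) \<longrightarrow> Ham t' x' p \<le> Ham t x p + \<epsilon>"
  proof (rule ccontr)
    assume "\<not> ?thesis"
    then obtain tn xn where tn: "\<And>n. tn n \<in> {0..T}" and near: "\<And>n. \<bar>tn n - t\<bar> < 1 / real (Suc n)"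
       "\<And>n. norm (xn n - x) < 1 / real (Suc n)" and big: "\<And>n. Ham t x p + \<epsilon> < Ham (tn n) (xn n) p"
      by (simp add: not_le del: of_nat_Suc) metis
    have "\<exists>w r. L (tn n) (xn n) w = ereal r \<and> Ham t x p + \<epsilon> < p \<bullet> w - r" for n
      using Ham_le[OF tn[of n], of "xn n" p "Ham t x p + \<epsilon>"] big[of n] by (meson not_le)
    then obtain wn rn where w: "\<And>n. L (tn n) (xn n) (wn n) = ereal (rn n)" "\<And>n. Ham t x p + \<epsilon> < p \<bullet> wn n - rn n"
      by metis
    have to0: "(\<lambda>n. 1 / real (Suc n)) \<longlonglongrightarrow> 0" by (rule LIMSEQ_Suc[OF lim_1_over_n])
    have tlim: "tn \<longlonglongrightarrow> t" unfolding LIM_zero_iff[symmetric, of _ t]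
      by (rule Lim_null_comparison[OF _ to0]) (use near in \<open>auto intro!: always_eventually less_imp_le\<close>)
    have xlim: "xn \<longlonglongrightarrow> x" unfolding LIM_zero_iff[symmetric, of _ x]
      by (rule Lim_null_comparison[OF _ to0]) (use near in \<open>auto intro!: always_eventually less_imp_le\<close>)
    have xb: "norm (xn n) \<le> norm x + 1" for n
    proof -
      have "1 / real (Suc n) \<le> 1" by simp
      then show ?thesis using near(2)[of n] norm_triangle_ineq2[of "xn n" x] by linarith
    qed
    obtain C where C: "\<And>t x' v. t \<in> {0..T} \<Longrightarrow> norm x' \<le> norm x + 1 \<Longrightarrow> L t x' v \<noteq> \<infinity> \<Longrightarrow> norm v \<le> C"
      using velocity_bound[of "norm x + 1"] by (metis norm_ge_zero add_nonneg_nonneg zero_le_one)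
    have "norm (wn n) \<le> C" for n by (rule C[OF tn[of n] xb[of n]]) (simp add: w)
    from convergent_subseq_txv[of tn xn "norm x + 1" wn C, OF tn xb this] obtain t' x' v r where
      r: "strict_mono (r :: nat \<Rightarrow> nat)" "(wn \<circ> r) \<longlonglongrightarrow> v" by blast
    have "L t x v \<le> ereal (p \<bullet> v - Ham t x p - \<epsilon>)"
    proof (rule ccontr)
      assume "\<not> ?thesis"
      then obtain c where c: "ereal (p \<bullet> v - Ham t x p - \<epsilon>) < ereal c" "ereal c < L t x v"
        using ereal_dense2 by (meson not_le)
      have "eventually (\<lambda>n. ereal c < L ((tn \<circ> r) n) ((xn \<circ> r) n) ((wn \<circ> r) n)) sequentially"
        by (rule L_seq[OF t _ _ _ r(2) c(2)])
          (use tn LIMSEQ_subseq_LIMSEQ[OF tlim r(1)] LIMSEQ_subseq_LIMSEQ[OF xlim r(1)] in \<open>simp_all add: o_def\<close>)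
      moreover have "(\<lambda>n. p \<bullet> (wn \<circ> r) n - Ham t x p - \<epsilon>) \<longlonglongrightarrow> p \<bullet> v - Ham t x p - \<epsilon>"
        by (intro tendsto_intros r)
      then have "eventually (\<lambda>n. p \<bullet> (wn \<circ> r) n - Ham t x p - \<epsilon> < c) sequentially"
        by (rule order_tendstoD) (use c in simp)
      ultimately have "eventually (\<lambda>n. False) sequentially"
        by eventually_elim (use w in \<open>auto simp: o_def\<close>, smt (verit))
      then show False by simp
    qed
    from Ham_ge[OF t this, of p] \<open>\<epsilon> > 0\<close> show False by simp
  qed
  then show ?thesis using that by (metis zero_less_divide_1_iff of_nat_0_less_iff zero_less_Suc)
qed

text \<open>The nontrivial half of Fenchel-Moreau: a point below the graph is separated strictly
  from the closed convex epigraph, and the separating hyperplane yields a momentum violating the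
  assumption.\<close>

lemma L_le_if_Ham:
  assumes t: "t \<in> {0..T}" and le: "\<And>p. p \<bullet> v - Ham t x p \<le> r"
  shows "L t x v \<le> ereal r"
proof (rule ccontr)
  assume no: "\<not> ?thesis"
  have "lsc_on UNIV (L t x)"
    unfolding lsc_on_def le_Liminf_iff
  proof (intro ballI allI impI)
    fix v c assume "c < L t x v"
    have "lsc_on ({0..T} \<times> UNIV \<times> UNIV) (\<lambda>(t, x, v). L t x v)" using L1 by (simp add: L1_def)
    from lsc_on_eventually[OF this, of "(t, x, v)" c] t \<open>c < L t x v\<close>
    have "eventually (\<lambda>y. y \<in> {0..T} \<times> UNIV \<times> UNIV \<longrightarrow> c < (\<lambda>(t, x, v). L t x v) y) (nhds (t, x, v))" by simp
    moreover have "((\<lambda>w. (t, x, w)) \<longlongrightarrow> (t, x, v)) (at v)" by (intro tendsto_intros)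
    ultimately have "eventually (\<lambda>w. (t, x, w) \<in> {0..T} \<times> UNIV \<times> UNIV \<longrightarrow> c < L t x w) (at v)"
      by (auto simp: filterlim_iff)
    then show "eventually (\<lambda>w. c < L t x w) (at v)" by eventually_elim (use t in auto)
  qed
  then have cl: "closed (ext_epi (L t x))" by (rule closed_ext_epi)
  have cv: "convex (ext_epi (L t x))" using L2 t by (simp add: L2_def ext_convex_def)
  have "(v, r) \<notin> ext_epi (L t x)" using no by (simp add: ext_epi_def)
  from separating_hyperplane_closed_point[OF cv cl this] obtain a \<gamma> where
    a: "inner a (v, r) < \<gamma>" "\<And>z. z \<in> ext_epi (L t x) \<Longrightarrow> \<gamma> < inner a z" by blast
  obtain q \<beta> where q: "a = (q, \<beta>)" by force
  have lo: "q \<bullet> v + \<beta> * r < \<gamma>" using a(1) by (simp add: q)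
  have hi: "\<gamma> < q \<bullet> w + \<beta> * s" if "L t x w \<le> ereal s" for w s
    using a(2)[of "(w, s)"] that by (simp add: q ext_epi_def)
  obtain w0 where "L t x w0 \<noteq> \<infinity>" using L_proper(2)[OF t] by blast
  then have "L t x w0 = ereal (real_of_ereal (L t x w0))" by (rule L_real[OF t])
  then obtain s0 where w0: "L t x w0 = ereal s0" by blast
  have "\<beta> \<ge> 0"
  proof (rule ccontr)
    assume "\<not> \<beta> \<ge> 0"
    define s where "s = max s0 ((\<gamma> - q \<bullet> w0) / \<beta>)"
    have "\<gamma> < q \<bullet> w0 + \<beta> * s" by (rule hi) (simp add: w0 s_def)
    moreover have "\<beta> * s \<le> \<beta> * ((\<gamma> - q \<bullet> w0) / \<beta>)"
      using \<open>\<not> \<beta> \<ge> 0\<close> by (intro mult_left_mono_neg) (auto simp: s_def)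
    ultimately show False using \<open>\<not> \<beta> \<ge> 0\<close> by simp
  qed
  show False
  proof (cases "\<beta> = 0")
    case False
    then have \<beta>: "\<beta> > 0" using \<open>\<beta> \<ge> 0\<close> by simp
    define p where "p = (- 1 / \<beta>) *\<^sub>R q"
    have "Ham t x p \<le> - \<gamma> / \<beta>"
    proof (rule Ham_le[OF t])
      fix w s assume "L t x w = ereal s"
      then have "\<gamma> < q \<bullet> w + \<beta> * s" by (intro hi) simp
      then have "- (q \<bullet> w + \<beta> * s) / \<beta> \<le> - \<gamma> / \<beta>" using \<beta> by (intro divide_right_mono) auto
      moreover have "p \<bullet> w - s = - (q \<bullet> w + \<beta> * s) / \<beta>" using \<beta> by (simp add: p_def field_simps)
      ultimately show "p \<bullet> w - s \<le> - \<gamma> / \<beta>" by simp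
    qed
    then have "p \<bullet> v + \<gamma> / \<beta> \<le> r" using le[of p] by simp
    then have "\<beta> * (p \<bullet> v + \<gamma> / \<beta>) \<le> \<beta> * r" using \<beta> by simp
    moreover have "\<beta> * (p \<bullet> v + \<gamma> / \<beta>) = \<gamma> - q \<bullet> v" using \<beta> by (simp add: p_def field_simps)
    ultimately show False using lo by simp
  next
    case True
    \<comment> \<open>A vertical hyperplane is no affine minorant. Multiples of it are therefore
      added to the constant minorant \<open>- Ham t x 0\<close>: on the domain they are negative, so
      the sum remains a minorant, while at \<open>v\<close> it grows by \<open>\<mu> * d\<close>.
      The factor \<mu> is chosen so that this exceeds \<open>r\<close>.\<close>
    define d where "d = \<gamma> - q \<bullet> v"
    have d: "d > 0" using lo True by (simp add: d_def)
    define \<mu> where "\<mu> = (\<bar>r\<bar> + \<bar>Ham t x 0\<bar> + 1) / d"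
    have \<mu>: "\<mu> > 0" using d by (simp add: \<mu>_def)
    define p where "p = (- \<mu>) *\<^sub>R q"
    have "Ham t x p \<le> - \<mu> * \<gamma> + Ham t x 0"
    proof (rule Ham_le[OF t])
      fix w s assume ws: "L t x w = ereal s"
      then have "\<gamma> < q \<bullet> w" using hi[of w s] True by simp
      then have "\<mu> * \<gamma> \<le> \<mu> * (q \<bullet> w)" using \<mu> by simp
      moreover have "- s \<le> Ham t x 0" using Ham_ge[OF t, of x w s 0] ws by simp
      ultimately show "p \<bullet> w - s \<le> - \<mu> * \<gamma> + Ham t x 0" by (simp add: p_def)
    qed
    then have "\<mu> * d - Ham t x 0 \<le> r" using le[of p] by (simp add: p_def d_def algebra_simps)
    moreover have "\<mu> * d = \<bar>r\<bar> + \<bar>Ham t x 0\<bar> + 1" using d by (simp add: \<mu>_def)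
    ultimately show False by linarith
  qed
qed

text \<open>The velocities accumulate, but the costs \<open>L (tk k) (xk k) (vk k)\<close> may be
  unbounded. They are bounded below by \<open>p \<bullet> vk k - Ham (tk k) (xk k) p\<close>, and
  since \<open>- nu \<ge> 0\<close> this bound can replace them in the inequality; upper
  semicontinuity of \<open>Ham\<close> then allows the limit for each fixed
  \<open>p\<close>.\<close>

lemma limit_velocity:
  assumes t: "t \<in> {0..T}" and C: "\<forall>t\<in>{0..T}. \<forall>x' v. norm x' \<le> norm x + 1 \<longrightarrow> L t x' v \<noteq> \<infinity> \<longrightarrow> norm v \<le> C"
    and lim: "tk \<longlonglongrightarrow> t" "xk \<longlonglongrightarrow> x" "\<alpha> \<longlonglongrightarrow> 0"
    and k: "\<forall>k. tk k \<in> {0..T} \<and> vk k \<in> ext_dom (L (tk k) (xk k)) \<and>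
               ereal (nt + inner (vk k) nx) - ereal nu * L (tk k) (xk k) (vk k) \<le> ereal (\<alpha> k)"
    and nu: "nu \<le> 0"
  obtains v where "norm v \<le> C" "\<And>p. nt + v \<bullet> nx - nu * (p \<bullet> v - Ham t x p) \<le> 0"
proof -
  have tk: "tk k \<in> {0..T}" for k using k by blast
  have "eventually (\<lambda>k. dist (xk k) x < 1) sequentially" using lim(2) by (rule tendstoD) simp
  then have "eventually (\<lambda>k. norm (xk k) \<le> norm x + 1) sequentially"
    by eventually_elim (smt (verit) dist_norm norm_triangle_ineq2)
  then obtain N where N: "\<And>k. k \<ge> N \<Longrightarrow> norm (xk k) \<le> norm x + 1" by (auto simp: eventually_sequentially)
  have Lk: "L (tk k) (xk k) (vk k) = ereal (real_of_ereal (L (tk k) (xk k) (vk k)))" for k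
    using k by (intro L_real) (auto simp: ext_dom_def)
  define lam where "lam k = real_of_ereal (L (tk k) (xk k) (vk k))" for k
  have in0: "nt + vk k \<bullet> nx - nu * lam k \<le> \<alpha> k" for k
  proof -
    have "ereal (nt + inner (vk k) nx) - ereal nu * ereal (lam k) \<le> ereal (\<alpha> k)"
      using k Lk[of k] by (metis lam_def)
    then show ?thesis by simp
  qed
  have vb: "norm (vk (k + N)) \<le> C" for k
    by (rule C[rule_format, OF tk[of "k + N"] N[of "k + N"]]) (use Lk[of "k + N"] in auto)
  have xb: "norm (xk (k + N)) \<le> norm x + 1" for k by (rule N) simp
  from convergent_subseq_txv[of "\<lambda>k. tk (k + N)" "\<lambda>k. xk (k + N)" "norm x + 1" "\<lambda>k. vk (k + N)" C, OF tk xb vb]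
  obtain t' x' v r where r: "strict_mono (r :: nat \<Rightarrow> nat)" "norm v \<le> C" "((\<lambda>k. vk (k + N)) \<circ> r) \<longlonglongrightarrow> v"
    by blast
  define m where "m k = r k + N" for k
  have "strict_mono m" using r(1) by (auto simp: m_def strict_mono_def)
  have vm: "(\<lambda>k. vk (m k)) \<longlonglongrightarrow> v" using r(3) by (simp add: o_def m_def)
  have tm: "(\<lambda>k. tk (m k)) \<longlonglongrightarrow> t" and xm: "(\<lambda>k. xk (m k)) \<longlonglongrightarrow> x" and am: "(\<lambda>k. \<alpha> (m k)) \<longlonglongrightarrow> 0"
    using LIMSEQ_subseq_LIMSEQ[OF lim(1) \<open>strict_mono m\<close>] LIMSEQ_subseq_LIMSEQ[OF lim(2) \<open>strict_mono m\<close>]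
      LIMSEQ_subseq_LIMSEQ[OF lim(3) \<open>strict_mono m\<close>] by (auto simp: o_def)
  show ?thesis
  proof (rule that[OF r(2)])
    fix p
    have *: "nt + v \<bullet> nx - nu * (p \<bullet> v - (Ham t x p + \<epsilon>)) \<le> 0" if eps: "\<epsilon> > 0" for \<epsilon>
    proof -
      obtain \<delta> where \<delta>: "\<delta> > 0" "\<And>t' x'. t' \<in> {0..T} \<Longrightarrow> \<bar>t' - t\<bar> < \<delta> \<Longrightarrow> norm (x' - x) < \<delta> \<Longrightarrow> Ham t' x' p \<le> Ham t x p + \<epsilon>"
        using Ham_usc[OF t eps, where x=x and p=p] by blast
      have "eventually (\<lambda>k. nt + vk (m k) \<bullet> nx - nu * (p \<bullet> vk (m k) - (Ham t x p + \<epsilon>)) \<le> \<alpha> (m k)) sequentially"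
        using tendstoD[OF tm \<delta>(1)] tendstoD[OF xm \<delta>(1)]
      proof eventually_elim
        case (elim k)
        have "Ham (tk (m k)) (xk (m k)) p \<le> Ham t x p + \<epsilon>"
          using elim by (intro \<delta>(2) tk) (auto simp: dist_norm)
        moreover have "p \<bullet> vk (m k) - lam (m k) \<le> Ham (tk (m k)) (xk (m k)) p"
          by (rule Ham_ge[OF tk]) (use Lk[of "m k"] in \<open>simp add: lam_def\<close>)
        ultimately have "nu * lam (m k) \<le> nu * (p \<bullet> vk (m k) - (Ham t x p + \<epsilon>))"
          using nu by (intro mult_left_mono_neg) auto
        then show ?case using in0[of "m k"] by simp
      qed
      then show ?thesis
        by (intro tendsto_le[OF _ am, where g="\<lambda>k. nt + vk (m k) \<bullet> nx - nu * (p \<bullet> vk (m k) - (Ham t x p + \<epsilon>))"])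
          (auto intro!: tendsto_intros vm)
    qed
    have "((\<lambda>\<epsilon>. nt + v \<bullet> nx - nu * (p \<bullet> v - (Ham t x p + \<epsilon>))) \<longlongrightarrow> nt + v \<bullet> nx - nu * (p \<bullet> v - (Ham t x p + 0))) (at_right 0)"
      by (intro tendsto_intros)
    from tendsto_upperbound[OF this, of 0] * 
    show "nt + v \<bullet> nx - nu * (p \<bullet> v - Ham t x p) \<le> 0"
      by (auto simp: eventually_at_right_less intro: eventually_mono[OF eventually_at_right_less])
  qed
qed

lemma aiming_constants:
  assumes "R \<ge> 0"
  obtains C K M where "C \<ge> 0" "K \<ge> 0"
    "\<And>(k::nat) t x nt nx nu tk xk \<alpha> vk. \<lbrakk>t \<in> {0..T}; norm x \<le> R; nu \<le> 0; tk \<longlonglongrightarrow> t; xk \<longlonglongrightarrow> x; \<alpha> \<longlonglongrightarrow> 0;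
      \<forall>k. tk k \<in> {0..T} \<and> vk k \<in> ext_dom (L (tk k) (xk k)) \<and>
               ereal (nt + inner (vk k) nx) - ereal nu * L (tk k) (xk k) (vk k) \<le> ereal (\<alpha> k)\<rbrakk> \<Longrightarrow>
      \<exists>v lam. norm v \<le> C \<and> - K \<le> lam \<and> \<bar>lam\<bar> \<le> M k \<and> (\<forall>p. norm p \<le> real k \<longrightarrow> p \<bullet> v - Ham t x p \<le> lam) \<and>
        nt + v \<bullet> nx - nu * lam \<le> 0"
proof -
  \<comment> \<open>The points \<open>xk k\<close> merely converge to a point of the ball of radius
    \<open>R\<close>, so the velocities have to be bounded on a larger ball.\<close>
  have "R + 1 \<ge> 0" using assms by simp
  from velocity_bound[OF this] obtain C where C: "C \<ge> 0"
     "\<And>t x v. t \<in> {0..T} \<Longrightarrow> norm x \<le> R + 1 \<Longrightarrow> L t x v \<noteq> \<infinity> \<Longrightarrow> norm v \<le> C" by blast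
  obtain K where K: "K \<ge> 0" "\<And>t x v. t \<in> {0..T} \<Longrightarrow> norm x \<le> R \<Longrightarrow> ereal (- K) \<le> L t x v"
    using L_bounded_below[OF assms] by blast
  obtain m where m: "m \<ge> 0" "\<And>t x. t \<in> {0..T} \<Longrightarrow> norm x \<le> R \<Longrightarrow> \<exists>w. L t x w \<le> ereal m"
    using L_bounded_above[OF assms] by blast
  \<comment> \<open>A horizontal normal (\<open>nu = 0\<close>) bounds no value of \<open>L\<close>, and the limit of the velocities may leave the
    domain of \<open>L t x\<close>. Restricting to momenta with \<open>norm p \<le> k\<close> replaces \<open>L\<close> by a \<open>k\<close>-Lipschitz minorant,
    which is finite at every velocity.\<close>
  define M where "M k = 2 * real k * C + m + K" for k :: nat
  show ?thesis
  proof (rule that[OF C(1) K(1)])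
    fix k :: nat and t x nt nx nu tk xk \<alpha> vk
    assume t: "t \<in> {0..T}" and x: "norm x \<le> R" and nu: "nu \<le> 0"
      and lim: "tk \<longlonglongrightarrow> t" "xk \<longlonglongrightarrow> x" "\<alpha> \<longlonglongrightarrow> 0"
      and ks: "\<forall>k. tk k \<in> {0..T} \<and> vk k \<in> ext_dom (L (tk k) (xk k)) \<and>
               ereal (nt + inner (vk k) nx) - ereal nu * L (tk k) (xk k) (vk k) \<le> ereal (\<alpha> k)"
    have C': "\<forall>t\<in>{0..T}. \<forall>x' v. norm x' \<le> norm x + 1 \<longrightarrow> L t x' v \<noteq> \<infinity> \<longrightarrow> norm v \<le> C"
    proof (intro ballI allI impI)
      show "norm v \<le> C" if "t \<in> {0..T}" "norm x' \<le> norm x + 1" "L t x' v \<noteq> \<infinity>" for t x' v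
        by (rule C(2)[OF that(1) _ that(3)]) (use that(2) x in simp)
    qed
    obtain v where v: "norm v \<le> C" "\<And>p. nt + v \<bullet> nx - nu * (p \<bullet> v - Ham t x p) \<le> 0"
      using limit_velocity[OF t C' lim ks nu] by blast
    \<comment> \<open>Comparison with a velocity \<open>w\<close> of cost at most \<open>m\<close>
      gives \<open>2 * real k * C + m\<close>. The further summand \<open>K\<close> in
      \<open>M k\<close> makes it bound \<open>- lam\<close> as well.\<close>
    have ub: "p \<bullet> v - Ham t x p \<le> M k" if "norm p \<le> real k" for p
    proof -
      obtain w where w: "L t x w \<le> ereal m" using m(2)[OF t x] by blast
      then have "L t x w \<noteq> \<infinity>" by auto
      then have wC: "norm w \<le> C" using C(2)[OF t, of x w] x by simp
      have "p \<bullet> w - m \<le> Ham t x p" by (rule Ham_ge[OF t w])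
      moreover have "\<bar>p \<bullet> w\<bar> \<le> real k * C" "\<bar>p \<bullet> v\<bar> \<le> real k * C"
        using Cauchy_Schwarz_ineq2[of p w] Cauchy_Schwarz_ineq2[of p v] mult_mono[OF that wC] mult_mono[OF that v(1)]
        by auto
      ultimately show ?thesis using K(1) by (simp add: M_def)
    qed
    define lam where "lam = (SUP p\<in>{p. norm p \<le> real k}. p \<bullet> v - Ham t x p)"
    have bdd: "bdd_above ((\<lambda>p. p \<bullet> v - Ham t x p) ` {p. norm p \<le> real k})"
      using ub by (auto intro!: bdd_aboveI2[where M="M k"])
    have ne: "{p::'a. norm p \<le> real k} \<noteq> {}" by (auto intro!: exI[of _ 0])
    have up: "p \<bullet> v - Ham t x p \<le> lam" if "norm p \<le> real k" for p
      unfolding lam_def by (rule cSUP_upper[OF _ bdd]) (use that in simp)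
    have "lam \<le> M k" unfolding lam_def by (rule cSUP_least[OF ne]) (use ub in simp)
    have "Ham t x 0 \<le> K"
      by (rule Ham_le[OF t]) (use K(2)[OF t x] in \<open>metis add.inverse_inverse diff_0 ereal_less_eq(3) inner_zero_left neg_le_iff_le\<close>)
    then have "- K \<le> lam" using up[of 0] by simp
    moreover have "K \<le> M k" using m(1) C(1) by (simp add: M_def)
    \<comment> \<open>For \<open>nu = 0\<close> the cost drops out. For \<open>nu < 0\<close>
      division turns the inequality for each \<open>p\<close> into the same upper bound, which
      therefore passes to the supremum.\<close>
    moreover have "nt + v \<bullet> nx - nu * lam \<le> 0"
    proof (cases "nu = 0")
      case True
      then show ?thesis using v(2)[of 0] by simp
    next
      case False
      then have neg: "nu < 0" using nu by simp
      have "lam \<le> (nt + v \<bullet> nx) / nu"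
        unfolding lam_def
      proof (rule cSUP_least[OF ne])
        show "p \<bullet> v - Ham t x p \<le> (nt + v \<bullet> nx) / nu" for p
          using v(2)[of p] neg by (simp add: field_simps)
      qed
      then show ?thesis using neg by (simp add: field_simps)
    qed
    ultimately show "\<exists>v lam. norm v \<le> C \<and> - K \<le> lam \<and> \<bar>lam\<bar> \<le> M k \<and>
       (\<forall>p. norm p \<le> real k \<longrightarrow> p \<bullet> v - Ham t x p \<le> lam) \<and> nt + v \<bullet> nx - nu * lam \<le> 0"
      using v(1) up \<open>lam \<le> M k\<close> by (intro exI[of _ v] exI[of _ lam]) auto
  qed
qed

end

section \<open>Proximal aiming\<close>

text \<open>The squared distance to \<open>E\<close> gains at most \<open>h\<^sup>2 * B\<close> per
  step, hence at most \<open>(T - t0) * h * B\<close> before time \<open>T\<close>. The claims stop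
  at time \<open>T - 1 / Suc k\<close> and radius \<open>R - 1\<close> because the aiming condition
  is needed at the projection, which may be \<open>1 / Suc k\<close> away and must still have time
  below \<open>T\<close> and norm at most \<open>R\<close>.\<close>

lemma proximal_aiming_scheme:
  fixes E :: "((real \<times> 'a::euclidean_space) \<times> real) set" and Hm :: "real \<Rightarrow> 'a \<Rightarrow> 'a \<Rightarrow> real" and k :: nat
  assumes E: "closed E" "((t0, x0), u0) \<in> E" and "t0 < T" "C \<ge> 0" "K \<ge> 0"
    and aim: "\<And>s n. s \<in> E \<Longrightarrow> fst (fst s) < T \<Longrightarrow> norm (snd (fst s)) \<le> R \<Longrightarrow> n \<in> normal_cone E s \<Longrightarrow>
      \<exists>v l. norm v \<le> C \<and> - K \<le> l \<and> \<bar>l\<bar> \<le> M \<and>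
        (\<forall>p. norm p \<le> real k \<longrightarrow> p \<bullet> v - Hm (fst (fst s)) (snd (fst s)) p \<le> l) \<and>
        fst (fst n) + v \<bullet> snd (fst n) - snd n * l \<le> 0"
  shows "\<exists>h X u S. 0 < h \<and> h \<le> 1 / real (Suc k) \<and> X 0 = x0 \<and> u 0 = u0 \<and>
    (\<forall>i. norm (X (Suc i) - X i) \<le> C * h) \<and> (\<forall>i. u (Suc i) - u i \<le> K * h) \<and>
    (\<forall>i. t0 + real i * h < T - 1 / real (Suc k) \<and> (\<forall>j\<le>i. norm (X j) \<le> R - 1) \<longrightarrow>
      S i \<in> E \<and> dist (S i) ((t0 + real i * h, X i), u i) \<le> 1 / real (Suc k) \<and>
      (\<forall>p. norm p \<le> real k \<longrightarrow>
        p \<bullet> (X (Suc i) - X i) - h * Hm (fst (fst (S i))) (snd (fst (S i))) p \<le> u i - u (Suc i)))"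
proof -
  define good where "good s \<longleftrightarrow> fst (fst s) < T \<and> norm (snd (fst s)) \<le> R" for s :: "(real \<times> 'a) \<times> real"
  define P where "P w = closest_point E w" for w
  have normal: "w - closest_point E w \<in> normal_cone E (closest_point E w)" for w
    using E by (intro closest_point_normal_cone) auto
  have PE: "P w \<in> E" for w unfolding P_def using E by (intro closest_point_in_set) auto
  have "\<exists>v l. norm v \<le> C \<and> - K \<le> l \<and> \<bar>l\<bar> \<le> \<bar>M\<bar> \<and> (good (P w) \<longrightarrow>
        (\<forall>p. norm p \<le> real k \<longrightarrow> p \<bullet> v - Hm (fst (fst (P w))) (snd (fst (P w))) p \<le> l) \<and>
        ((1, v), - l) \<bullet> (w - P w) \<le> 0)" for w
  proof (cases "good (P w)")
    case True
    from aim[OF PE, of w "w - P w"] normal[of w] True obtain v l where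
      "norm v \<le> C \<and> - K \<le> l \<and> \<bar>l\<bar> \<le> M \<and>
        (\<forall>p. norm p \<le> real k \<longrightarrow> p \<bullet> v - Hm (fst (fst (P w))) (snd (fst (P w))) p \<le> l) \<and>
        fst (fst (w - P w)) + v \<bullet> snd (fst (w - P w)) - snd (w - P w) * l \<le> 0"
      unfolding good_def P_def by blast
    then show ?thesis
      by (intro exI[of _ v] exI[of _ l]) (cases "w - P w", auto simp: mult.commute)
  next
    case False
    then show ?thesis using assms by (intro exI[of _ 0]) auto
  qed
  then obtain V l where V: "\<And>w. norm (V w) \<le> C" and l: "\<And>w. - K \<le> l w" "\<And>w. \<bar>l w\<bar> \<le> \<bar>M\<bar>"
    and minor: "\<And>w p. good (P w) \<Longrightarrow> norm p \<le> real k \<Longrightarrow> p \<bullet> V w - Hm (fst (fst (P w))) (snd (fst (P w))) p \<le> l w"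
    and descent: "\<And>w. good (P w) \<Longrightarrow> ((1, V w), - l w) \<bullet> (w - P w) \<le> 0"
    by metis
  define F where "F w = ((1::real, V w), - l w)" for w
  define B where "B = 1 + C\<^sup>2 + M\<^sup>2"
  have FB: "(norm (F w))\<^sup>2 \<le> B" for w
  proof -
    have "(norm (V w))\<^sup>2 \<le> C\<^sup>2" using V by (intro power_mono) auto
    moreover have "(l w)\<^sup>2 \<le> M\<^sup>2" using l(2)[of w] by (simp add: abs_le_square_iff)
    ultimately show ?thesis by (simp add: F_def B_def norm_Pair)
  qed
  have "B \<ge> 1" by (simp add: B_def)
  define N where "N = real (Suc k)"
  have "N \<ge> 1" by (simp add: N_def)
  \<comment> \<open>Small enough for both demands: \<open>h \<le> 1 / N\<close>, and an accumulated
    squared distance \<open>(T - t0) * h * B\<close> of at most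
    \<open>(1 / N)\<^sup>2\<close>.\<close>
  define h where "h = 1 / (N\<^sup>2 * (1 + (T - t0) * B))"
  have TB: "(T - t0) * B \<ge> 0" using \<open>t0 < T\<close> \<open>B \<ge> 1\<close> by simp
  have h: "h > 0" using TB \<open>N \<ge> 1\<close> by (simp add: h_def)
  have "N \<le> N\<^sup>2 * (1 + (T - t0) * B)"
  proof -
    have "N * 1 \<le> N * (N * (1 + (T - t0) * B))"
      using \<open>N \<ge> 1\<close> TB by (intro mult_left_mono) (auto intro: order_trans[OF _ mult_mono[of 1 N 1]])
    then show ?thesis by (simp add: power2_eq_square mult.assoc)
  qed
  then have hN: "h \<le> 1 / N" unfolding h_def using \<open>N \<ge> 1\<close> by (intro divide_left_mono) auto
  have "(T - t0) * h * B = ((T - t0) * B) / (1 + (T - t0) * B) * (1 / N\<^sup>2)"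
    by (simp add: h_def)
  also have "\<dots> \<le> 1 * (1 / N\<^sup>2)" using TB by (intro mult_right_mono) auto
  finally have hB: "(T - t0) * h * B \<le> (1 / N)\<^sup>2" by (simp add: power_divide)
  define w where "w = rec_nat ((t0, x0), u0) (\<lambda>_ w. w + h *\<^sub>R F w)"
  have w0: "w 0 = ((t0, x0), u0)" and wS: "w (Suc i) = w i + h *\<^sub>R F (w i)" for i
    by (simp_all add: w_def)
  have time: "fst (fst (w i)) = t0 + real i * h" for i
    by (induction i) (simp_all add: w0 wS F_def algebra_simps)
  have D: "(norm (w i - P (w i)))\<^sup>2 \<le> real i * (h\<^sup>2 * B)" if "\<forall>j<i. good (P (w j))" for i
    using that
  proof (induction i)
    case 0
    have "P (w 0) = w 0" unfolding P_def w0 by (rule closest_point_self[OF E(2)])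
    then show ?case by simp
  next
    case (Suc i)
    have "dist (w (Suc i)) (P (w (Suc i))) \<le> dist (w (Suc i)) (P (w i))"
      unfolding P_def by (rule closest_point_le[OF E(1)]) (use PE[of "w i"] in \<open>simp add: P_def\<close>)
    then have "(norm (w (Suc i) - P (w (Suc i))))\<^sup>2 \<le> (norm ((w i - P (w i)) + h *\<^sub>R F (w i)))\<^sup>2"
      by (intro power_mono) (auto simp: dist_norm wS algebra_simps)
    also have "\<dots> = (norm (w i - P (w i)))\<^sup>2 + 2 * h * (F (w i) \<bullet> (w i - P (w i))) + h\<^sup>2 * (norm (F (w i)))\<^sup>2"
      unfolding power2_norm_eq_inner inner_add_left inner_add_right inner_scaleR_left inner_scaleR_right
      by (simp add: inner_commute power2_eq_square distrib_left)
    also have "\<dots> \<le> real i * (h\<^sup>2 * B) + 0 + h\<^sup>2 * B"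
    proof (intro add_mono)
      show "(norm (w i - P (w i)))\<^sup>2 \<le> real i * (h\<^sup>2 * B)" using Suc by auto
      have "F (w i) \<bullet> (w i - P (w i)) \<le> 0" unfolding F_def by (rule descent) (use Suc in auto)
      then show "2 * h * (F (w i) \<bullet> (w i - P (w i))) \<le> 0" using h by (simp add: mult_nonneg_nonpos)
      show "h\<^sup>2 * (norm (F (w i)))\<^sup>2 \<le> h\<^sup>2 * B" using FB by (intro mult_left_mono) auto
    qed
    finally show ?case by (simp add: algebra_simps)
  qed
  define X where "X i = snd (fst (w i))" for i
  define u where "u i = snd (w i)" for i
  have wi: "w i = ((t0 + real i * h, X i), u i)" for i
    using time[of i] by (simp add: X_def u_def prod_eq_iff)
  \<comment> \<open>Strong induction: the distance estimate at \<open>i\<close> presupposes good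
    projections at all earlier indices, and a small distance at \<open>i\<close> makes the
    projection there good.\<close>
  have near: "good (P (w i)) \<and> dist (P (w i)) (w i) \<le> 1 / N"
    if "t0 + real i * h < T - 1 / N" "\<forall>j\<le>i. norm (X j) \<le> R - 1" for i
    using that
  proof (induction i rule: less_induct)
    case (less i)
    have "good (P (w j))" if "j < i" for j
    proof -
      have "real j * h \<le> real i * h" using that h by (intro mult_right_mono) auto
      then have "t0 + real j * h < T - 1 / N" using less.prems by linarith
      then show ?thesis using less.IH[OF that] less.prems(2) that by auto
    qed
    then have "(norm (w i - P (w i)))\<^sup>2 \<le> real i * (h\<^sup>2 * B)" by (intro D) auto
    also have "\<dots> = (real i * h) * (h * B)" by (simp add: power2_eq_square)
    also have "\<dots> \<le> (T - t0) * (h * B)"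
    proof (rule mult_right_mono)
      have "1 / N > 0" using \<open>N \<ge> 1\<close> by simp
      then show "real i * h \<le> T - t0" using less.prems(1) by linarith
    qed (use h \<open>B \<ge> 1\<close> in simp)
    also have "\<dots> \<le> (1 / N)\<^sup>2" using hB by (simp add: mult.assoc)
    finally have d: "dist (P (w i)) (w i) \<le> 1 / N"
      using \<open>N \<ge> 1\<close> by (simp add: dist_norm norm_minus_commute power2_le_iff_abs_le)
    have "dist (fst (P (w i))) (fst (w i)) \<le> 1 / N" using dist_fst_le d order_trans by blast
    then have "dist (fst (fst (P (w i)))) (fst (fst (w i))) \<le> 1 / N" "dist (snd (fst (P (w i)))) (X i) \<le> 1 / N"
      using dist_fst_le dist_snd_le order_trans unfolding X_def by blast+
    then have "fst (fst (P (w i))) < T" "norm (snd (fst (P (w i)))) \<le> norm (X i) + 1 / N"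
      using less.prems(1) time[of i] norm_triangle_ineq2[of "snd (fst (P (w i)))" "X i"]
      by (auto simp: dist_norm)
    moreover have "1 / N \<le> 1" using \<open>N \<ge> 1\<close> by simp
    moreover have "norm (X i) \<le> R - 1" using less.prems(2) by blast
    ultimately show ?case using d by (simp add: good_def)
  qed
  have XS: "X (Suc i) - X i = h *\<^sub>R V (w i)" and uS: "u (Suc i) - u i = - h * l (w i)" for i
    by (simp_all add: X_def u_def wS F_def)
  show ?thesis
  proof (intro exI[of _ h] exI[of _ X] exI[of _ u] exI[of _ "\<lambda>i. P (w i)"] conjI allI impI)
    show "0 < h" "h \<le> 1 / real (Suc k)" "X 0 = x0" "u 0 = u0"
      using h hN by (auto simp: N_def X_def u_def w0)
    show "norm (X (Suc i) - X i) \<le> C * h" for i using V[of "w i"] h by (simp add: XS)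
    show "u (Suc i) - u i \<le> K * h" for i
      using mult_left_mono[OF l(1)[of "w i"], of h] h by (simp add: uS algebra_simps)
    show "P (w i) \<in> E" for i by (rule PE)
    fix i assume i: "t0 + real i * h < T - 1 / real (Suc k) \<and> (\<forall>j\<le>i. norm (X j) \<le> R - 1)"
    then have n: "good (P (w i)) \<and> dist (P (w i)) (w i) \<le> 1 / N" by (intro near) (auto simp: N_def)
    then show "dist (P (w i)) ((t0 + real i * h, X i), u i) \<le> 1 / real (Suc k)"
      by (simp add: wi N_def)
    fix p :: 'a assume "norm p \<le> real k"
    then have "p \<bullet> V (w i) - Hm (fst (fst (P (w i)))) (snd (fst (P (w i)))) p \<le> l (w i)"
      using n by (intro minor) auto
    then have "h * (p \<bullet> V (w i) - Hm (fst (fst (P (w i)))) (snd (fst (P (w i)))) p) \<le> h * l (w i)"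
      using h by simp
    then show "p \<bullet> (X (Suc i) - X i) - h * Hm (fst (fst (P (w i)))) (snd (fst (P (w i)))) p \<le> u i - u (Suc i)"
      using uS[of i] by (simp add: XS algebra_simps)
  qed
qed

section \<open>Passage to the limit\<close>

text \<open>A version of Arzela-Ascoli for step functions, which are discontinuous but Lipschitz up
  to an error tending to 0. A diagonal subsequence converges at the rationals, and the estimate
  carries the Cauchy property to all times.\<close>

lemma almost_lipschitz_convergent_subsequence:
  fixes f :: "nat \<Rightarrow> real \<Rightarrow> 'a::euclidean_space"
  assumes lip: "\<And>n s t. norm (f n s - f n t) \<le> C * \<bar>s - t\<bar> + e n" and e: "e \<longlonglongrightarrow> 0"
    and bd: "\<And>n t. norm (f n t) \<le> M" and C: "C \<ge> 0"
  obtains r x where "strict_mono (r :: nat \<Rightarrow> nat)" "\<And>t. (\<lambda>n. f (r n) t) \<longlonglongrightarrow> x t"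
    "\<And>s t. norm (x s - x t) \<le> C * \<bar>s - t\<bar>"
proof -
  have "\<exists>r::nat\<Rightarrow>nat. strict_mono r \<and> (\<forall>q\<in>\<rat>. \<exists>l. (\<lambda>n. f (r n) q) \<longlonglongrightarrow> l)"
    by (rule function_convergent_subsequence[of "\<rat>::real set" f M, OF countable_rat bd]) auto
  then obtain r :: "nat \<Rightarrow> nat" where r: "strict_mono r" and cv: "\<And>q. q \<in> \<rat> \<Longrightarrow> \<exists>l. (\<lambda>n. f (r n) q) \<longlonglongrightarrow> l"
    by blast
  have er: "(\<lambda>n. e (r n)) \<longlonglongrightarrow> 0" using LIMSEQ_subseq_LIMSEQ[OF e r] by (simp add: o_def)
  have "Cauchy (\<lambda>n. f (r n) t)" for t
  proof (rule metric_CauchyI)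
    fix \<epsilon> :: real assume "\<epsilon> > 0"
    \<comment> \<open>Passing from \<open>t\<close> to a rational costs at most \<epsilon> / 8 for
      the Lipschitz part and less than \<epsilon> / 8 for the error \<open>e (r n)\<close>; two such
      passages and the distance at the rational stay below \<epsilon>.\<close>
    define d where "d = \<epsilon> / (8 * (C + 1))"
    have "d > 0" using \<open>\<epsilon> > 0\<close> C by (simp add: d_def)
    have Cd: "C * d \<le> \<epsilon> / 8"
    proof -
      have "C * d \<le> (C + 1) * d" using \<open>d > 0\<close> by simp
      also have "\<dots> = \<epsilon> / 8" using C by (simp add: d_def field_simps)
      finally show ?thesis .
    qed
    obtain q where q: "q \<in> \<rat>" "t < q" "q < t + d" using Rats_dense_in_real[of t "t + d"] \<open>d > 0\<close> by auto
    have "Cauchy (\<lambda>n. f (r n) q)" using cv[OF q(1)] LIMSEQ_imp_Cauchy by blast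
    then obtain N1 where N1: "\<And>m n. m \<ge> N1 \<Longrightarrow> n \<ge> N1 \<Longrightarrow> dist (f (r m) q) (f (r n) q) < \<epsilon> / 4"
      using metric_CauchyD[of _ "\<epsilon> / 4"] \<open>\<epsilon> > 0\<close> by (metis zero_less_divide_iff zero_less_numeral)
    have "eventually (\<lambda>n. e (r n) < \<epsilon> / 8) sequentially" by (rule order_tendstoD[OF er]) (use \<open>\<epsilon> > 0\<close> in simp)
    then obtain N2 where N2: "\<And>n. n \<ge> N2 \<Longrightarrow> e (r n) < \<epsilon> / 8" by (auto simp: eventually_sequentially)
    have near: "dist (f (r n) t) (f (r n) q) < \<epsilon> / 4" if "n \<ge> N2" for n
    proof -
      have "C * \<bar>t - q\<bar> \<le> C * d" using q C by (intro mult_left_mono) auto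
      then show ?thesis using lip[of "r n" t q] N2[OF that] Cd by (simp add: dist_norm)
    qed
    show "\<exists>N. \<forall>m\<ge>N. \<forall>n\<ge>N. dist (f (r m) t) (f (r n) t) < \<epsilon>"
    proof (intro exI[of _ "max N1 N2"] allI impI)
      fix m n assume "m \<ge> max N1 N2" "n \<ge> max N1 N2"
      then have "dist (f (r m) t) (f (r m) q) < \<epsilon> / 4" "dist (f (r n) t) (f (r n) q) < \<epsilon> / 4"
        "dist (f (r m) q) (f (r n) q) < \<epsilon> / 4" using near N1 by auto
      moreover have "dist (f (r m) t) (f (r n) t) \<le> dist (f (r m) t) (f (r m) q) + dist (f (r m) q) (f (r n) q) + dist (f (r n) t) (f (r n) q)"
        using dist_triangle[of "f (r m) t" "f (r n) t" "f (r m) q"] dist_triangle[of "f (r m) q" "f (r n) t" "f (r n) q"]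
        by (simp add: dist_commute)
      ultimately show "dist (f (r m) t) (f (r n) t) < \<epsilon>" using \<open>\<epsilon> > 0\<close> by linarith
    qed
  qed
  then have "\<exists>l. (\<lambda>n. f (r n) t) \<longlonglongrightarrow> l" for t by (simp add: Cauchy_convergent convergentD)
  then obtain x where x: "\<And>t. (\<lambda>n. f (r n) t) \<longlonglongrightarrow> x t" by metis
  have "norm (x s - x t) \<le> C * \<bar>s - t\<bar>" for s t
  proof -
    have "(\<lambda>n. norm (f (r n) s - f (r n) t)) \<longlonglongrightarrow> norm (x s - x t)" by (intro tendsto_intros x)
    moreover have "(\<lambda>n. C * \<bar>s - t\<bar> + e (r n)) \<longlonglongrightarrow> C * \<bar>s - t\<bar> + 0" by (intro tendsto_intros er)
    ultimately show ?thesis using lip by (intro LIMSEQ_le) auto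
  qed
  with r x show ?thesis by (rule that)
qed

text \<open>Replaces uniform convergence: times at which the bound fails would accumulate at some
  \<open>t\<close>, and the estimate would transport the failure to the limit at
  \<open>t\<close>.\<close>

lemma almost_lipschitz_eventually_bounded:
  fixes f :: "nat \<Rightarrow> real \<Rightarrow> 'a::euclidean_space"
  assumes lip: "\<And>n s t. s \<in> {a..b} \<Longrightarrow> t \<in> {a..b} \<Longrightarrow> norm (f n s - f n t) \<le> C * \<bar>s - t\<bar> + e n" and e: "e \<longlonglongrightarrow> 0"
    and lim: "\<And>t. t \<in> {a..b} \<Longrightarrow> (\<lambda>n. f n t) \<longlonglongrightarrow> x t" and bd: "\<And>t. t \<in> {a..b} \<Longrightarrow> norm (x t) < \<rho>"
  shows "eventually (\<lambda>n. \<forall>t\<in>{a..b}. norm (f n t) < \<rho>) sequentially"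
proof (rule ccontr)
  assume "\<not> ?thesis"
  from not_eventually_sequentiallyD[OF this]
  obtain r0 :: "nat \<Rightarrow> nat" where r0: "strict_mono r0" "\<And>n. \<exists>t\<in>{a..b}. norm (f (r0 n) t) \<ge> \<rho>"
    by (auto simp: not_less)
  then obtain tn where tn: "\<And>n. tn n \<in> {a..b}" "\<And>n. norm (f (r0 n) (tn n)) \<ge> \<rho>" by metis
  obtain t r1 where r1: "t \<in> {a..b}" "strict_mono (r1 :: nat \<Rightarrow> nat)" "(tn \<circ> r1) \<longlonglongrightarrow> t"
    using compact_Icc[of a b] tn(1) unfolding compact_def by metis
  define r where "r n = r0 (r1 n)" for n
  have "strict_mono r" using r0(1) r1(2) by (auto simp: r_def strict_mono_def)
  have fr: "(\<lambda>n. f (r n) t) \<longlonglongrightarrow> x t" and er: "(\<lambda>n. e (r n)) \<longlonglongrightarrow> 0"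
    using LIMSEQ_subseq_LIMSEQ[OF lim[OF r1(1)] \<open>strict_mono r\<close>] LIMSEQ_subseq_LIMSEQ[OF e \<open>strict_mono r\<close>] by (auto simp: o_def)
  have "(\<lambda>n. norm (f (r n) t) + (C * \<bar>(tn \<circ> r1) n - t\<bar> + e (r n))) \<longlonglongrightarrow> norm (x t) + (C * \<bar>t - t\<bar> + 0)"
    by (intro tendsto_intros fr er r1)
  moreover have "\<rho> \<le> norm (f (r n) t) + (C * \<bar>(tn \<circ> r1) n - t\<bar> + e (r n))" for n
    using lip[OF tn(1)[of "r1 n"] r1(1), of "r n"] tn(2)[of "r1 n"] norm_triangle_ineq2[of "f (r n) (tn (r1 n))" "f (r n) t"]
    by (simp add: r_def)
  ultimately have "\<rho> \<le> norm (x t) + (C * \<bar>t - t\<bar> + 0)" by (intro LIMSEQ_le_const) auto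
  then show False using bd[OF r1(1)] by simp
qed

lemma norm_diff_le_steps:
  fixes X :: "nat \<Rightarrow> 'a::real_normed_vector"
  assumes "\<And>i. norm (X (Suc i) - X i) \<le> c" and "i \<le> j"
  shows "norm (X j - X i) \<le> real (j - i) * c"
  using \<open>i \<le> j\<close>
proof (induction j rule: dec_induct)
  case (step j)
  have "norm (X (Suc j) - X i) \<le> norm (X (Suc j) - X j) + norm (X j - X i)"
    using norm_triangle_ineq[of "X (Suc j) - X j" "X j - X i"] by simp
  also have "\<dots> \<le> c + real (j - i) * c" using step assms(1) by (intro add_mono) auto
  also have "\<dots> = real (Suc j - i) * c" using step by (simp add: Suc_diff_le algebra_simps)
  finally show ?case .
qed simp

text \<open>Rounding down to the grid can separate two times by one additional step, hence the
  additional \<open>C * h\<close>.\<close>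

lemma norm_step_function_diff_le:
  fixes X :: "nat \<Rightarrow> 'a::real_normed_vector"
  assumes h: "h > 0" and C: "C \<ge> 0" and X: "\<And>i. norm (X (Suc i) - X i) \<le> C * h" and "t0 \<le> s" "t0 \<le> t"
  shows "norm (X (nat \<lfloor>(s - t0) / h\<rfloor>) - X (nat \<lfloor>(t - t0) / h\<rfloor>)) \<le> C * \<bar>s - t\<bar> + C * h"
proof -
  define ix where "ix t = nat \<lfloor>(t - t0) / h\<rfloor>" for t
  have bounds: "real (ix t) * h \<le> t - t0" "t - t0 - h < real (ix t) * h" if "t0 \<le> t" for t
  proof -
    have "real (ix t) = of_int \<lfloor>(t - t0) / h\<rfloor>" using that h by (simp add: ix_def)
    then have "real (ix t) \<le> (t - t0) / h" "(t - t0) / h - 1 < real (ix t)" by linarith+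
    then show "real (ix t) * h \<le> t - t0" "t - t0 - h < real (ix t) * h" using h by (simp_all add: field_simps)
  qed
  have *: "norm (X (ix s) - X (ix t)) \<le> C * \<bar>s - t\<bar> + C * h" if "t \<le> s" "t0 \<le> t" for s t
  proof -
    have "ix t \<le> ix s" unfolding ix_def using h that by (intro nat_mono floor_mono divide_right_mono) auto
    then have "norm (X (ix s) - X (ix t)) \<le> real (ix s - ix t) * (C * h)"
      by (rule norm_diff_le_steps[of X, OF X])
    also have "\<dots> = C * (real (ix s) * h - real (ix t) * h)"
      using \<open>ix t \<le> ix s\<close> by (simp add: of_nat_diff algebra_simps)
    also have "\<dots> \<le> C * (s - t + h)"
      using bounds[of s] bounds[of t] that C by (intro mult_left_mono) auto
    finally show ?thesis using that by (simp add: algebra_simps)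
  qed
  show ?thesis
    using *[of t s] *[of s t] assms(4,5) unfolding ix_def[symmetric]
    by (cases "t \<le> s") (auto simp: norm_minus_commute abs_minus_commute)
qed

text \<open>The index \<open>i\<close> of the \<open>k\<close>-th polygon \<open>(X k, u k)\<close> stands for the time \<open>t0 + i * h k\<close>; \<open>S k i\<close> is the projection on
  the epigraph. Nothing is required of the polygon after it has left the ball of radius \<open>R - 1\<close>.\<close>

locale aiming_limit =
  fixes T t0 C K R :: real and Ue :: "real \<times> 'a::euclidean_space \<Rightarrow> ereal"
    and Hm :: "real \<Rightarrow> 'a \<Rightarrow> 'a \<Rightarrow> real"
    and h :: "nat \<Rightarrow> real" and X :: "nat \<Rightarrow> nat \<Rightarrow> 'a" and u :: "nat \<Rightarrow> nat \<Rightarrow> real"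
    and S :: "nat \<Rightarrow> nat \<Rightarrow> (real \<times> 'a) \<times> real" and x :: "real \<Rightarrow> 'a" and u0 :: real
  assumes t0: "t0 < T" and C: "C \<ge> 0" and K: "K \<ge> 0"
    and h: "0 < h k" "h k \<le> 1 / real (Suc k)"
    and u_init: "u k 0 = u0"
    and X_step: "norm (X k (Suc i) - X k i) \<le> C * h k"
    and u_step: "u k (Suc i) - u k i \<le> K * h k"
    and near: "t0 + real i * h k < T - 1 / real (Suc k) \<Longrightarrow> \<forall>j\<le>i. norm (X k j) \<le> R - 1 \<Longrightarrow>
      S k i \<in> ext_epi Ue \<and> dist (S k i) ((t0 + real i * h k, X k i), u k i) \<le> 1 / real (Suc k)"
    and minor: "t0 + real i * h k < T - 1 / real (Suc k) \<Longrightarrow> \<forall>j\<le>i. norm (X k j) \<le> R - 1 \<Longrightarrow> norm p \<le> real k \<Longrightarrow>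
      p \<bullet> (X k (Suc i) - X k i) - h k * Hm (fst (fst (S k i))) (snd (fst (S k i))) p \<le> u k i - u k (Suc i)"
    and lim: "t \<in> {t0..T} \<Longrightarrow> (\<lambda>k. X k (nat \<lfloor>(t - t0) / h k\<rfloor>)) \<longlonglongrightarrow> x t"
    and x_lip: "norm (x s - x t) \<le> C * \<bar>s - t\<bar>"
    and lsc: "lsc_on UNIV Ue"
    and usc: "t \<in> {t0..T} \<Longrightarrow> \<epsilon> > 0 \<Longrightarrow> \<exists>\<delta>>0. \<forall>t' x'. Ue (t', x') < \<infinity> \<longrightarrow> \<bar>t' - t\<bar> < \<delta> \<longrightarrow>
      norm (x' - y) < \<delta> \<longrightarrow> Hm t' x' p \<le> Hm t y p + \<epsilon>"
begin

definition ix :: "nat \<Rightarrow> real \<Rightarrow> nat" where "ix k t = nat \<lfloor>(t - t0) / h k\<rfloor>"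

text \<open>\<open>u\<close> has a one-sided step bound only; the drift \<open>K\<close> converts it
  into monotonicity.\<close>

definition \<phi> :: "nat \<Rightarrow> real \<Rightarrow> real" where "\<phi> k t = - u k (ix k t) + K * (real (ix k t) * h k)"

definition quot :: "nat \<Rightarrow> nat \<Rightarrow> real \<Rightarrow> ennreal" where
  "quot n k s = ennreal ((\<phi> k (s + 1 / real (Suc n)) - \<phi> k s) / (1 / real (Suc n)))"

text \<open>Working with lower limits of difference quotients of the monotone functions \<open>\<phi> k\<close> makes it unnecessary
  to select a convergent subsequence of the costs or to differentiate a monotone function.\<close>

definition rate :: "real \<Rightarrow> ennreal" where "rate s = liminf (\<lambda>n. liminf (\<lambda>k. quot n k s))"

text \<open>Both inequalities are strict in order to leave room: forward difference quotients at
  \<open>b\<close> look slightly past \<open>b\<close>, and the polygons approach \<open>x\<close>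
  only in the limit.\<close>

definition confined :: "real \<Rightarrow> bool" where "confined b \<longleftrightarrow> t0 \<le> b \<and> b < T \<and> (\<forall>t\<in>{t0..b}. norm (x t) < R - 1)"

definition valid :: "nat \<Rightarrow> nat \<Rightarrow> bool" where
  "valid k i \<longleftrightarrow> t0 + real i * h k < T - 1 / real (Suc k) \<and> (\<forall>j\<le>i. norm (X k j) \<le> R - 1)"

lemma lim_ix: "t \<in> {t0..T} \<Longrightarrow> (\<lambda>k. X k (ix k t)) \<longlonglongrightarrow> x t"
  using lim by (simp add: ix_def)

lemma h_lim: "h \<longlonglongrightarrow> 0"
proof (rule tendsto_sandwich[where f="\<lambda>_. 0" and h="\<lambda>k. 1 / real (Suc k)"])
  show "(\<lambda>k. 1 / real (Suc k)) \<longlonglongrightarrow> 0" by (rule LIMSEQ_Suc[OF lim_1_over_n])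
qed (auto intro!: always_eventually less_imp_le[OF h(1)] h(2) simp del: of_nat_Suc)

lemma ix_bounds:
  assumes "t0 \<le> t"
  shows "t0 + real (ix k t) * h k \<le> t" "t - h k < t0 + real (ix k t) * h k"
proof -
  have "real (ix k t) = of_int \<lfloor>(t - t0) / h k\<rfloor>"
    using assms h(1)[of k] by (simp add: ix_def)
  then have "real (ix k t) \<le> (t - t0) / h k" "(t - t0) / h k - 1 < real (ix k t)" by linarith+
  then show "t0 + real (ix k t) * h k \<le> t" "t - h k < t0 + real (ix k t) * h k"
    using h(1)[of k] by (simp_all add: field_simps)
qed

lemma ix_mono: "s \<le> t \<Longrightarrow> ix k s \<le> ix k t"
  unfolding ix_def using h(1)[of k] by (intro nat_mono floor_mono divide_right_mono) auto

lemma ix_grid: "ix k (t0 + real i * h k) = i"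
  using h(1)[of k] by (simp add: ix_def)

lemma ix_t0: "ix k t0 = 0"
  by (simp add: ix_def)

lemma grid_lim:
  assumes "t0 \<le> t" shows "(\<lambda>k. real (ix k t) * h k) \<longlonglongrightarrow> t - t0"
proof (rule tendsto_sandwich[where f="\<lambda>k. t - t0 - h k" and h="\<lambda>k. t - t0"])
  show "(\<lambda>k. t - t0 - h k) \<longlonglongrightarrow> t - t0" using tendsto_diff[OF tendsto_const h_lim, of "t - t0"] by simp
  show "eventually (\<lambda>k. t - t0 - h k \<le> real (ix k t) * h k) sequentially"
  proof (rule always_eventually, rule allI)
    show "t - t0 - h k \<le> real (ix k t) * h k" for k using ix_bounds(2)[OF assms, of k] by linarith
  qed
  show "eventually (\<lambda>k. real (ix k t) * h k \<le> t - t0) sequentially"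
  proof (rule always_eventually, rule allI)
    show "real (ix k t) * h k \<le> t - t0" for k using ix_bounds(1)[OF assms, of k] by linarith
  qed
qed auto

lemma \<phi>_mono: "mono (\<phi> k)"
proof (rule monoI)
  fix s t :: real assume "s \<le> t"
  have "- u k i + K * (real i * h k) \<le> - u k j + K * (real j * h k)" if "i \<le> j" for i j
    using that
  proof (induction j rule: dec_induct)
    case (step j)
    then show ?case using u_step[of k j] by (simp add: algebra_simps)
  qed simp
  from this[OF ix_mono[OF \<open>s \<le> t\<close>]] show "\<phi> k s \<le> \<phi> k t" by (simp add: \<phi>_def)
qed

lemma quot_measurable[measurable]: "quot n k \<in> borel_measurable borel"
proof -
  have [measurable]: "\<phi> k \<in> borel_measurable borel" by (rule borel_measurable_mono[OF \<phi>_mono])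
  show ?thesis unfolding quot_def by measurable
qed

lemma rate_measurable[measurable]: "rate \<in> borel_measurable borel"
  unfolding rate_def by measurable

text \<open>The margin at \<open>b\<close> lasts for a short time because \<open>x\<close> is
  Lipschitz.\<close>

lemma confined_extend:
  assumes "confined b" obtains b' where "b < b'" "confined b'"
proof -
  have b: "t0 \<le> b" "b < T" "norm (x b) < R - 1" using assms by (auto simp: confined_def)
  define d where "d = (R - 1 - norm (x b)) / (2 * (C + 1))"
  have "d > 0" using b C by (simp add: d_def)
  have Cd: "C * d < R - 1 - norm (x b)"
  proof -
    have "C * d \<le> (C + 1) * d" using \<open>d > 0\<close> by simp
    also have "\<dots> = (R - 1 - norm (x b)) / 2" using C by (simp add: d_def field_simps)
    finally show ?thesis using b by simp
  qed
  define b' where "b' = min (b + d) ((b + T) / 2)"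
  have "norm (x t) < R - 1" if "t \<in> {t0..b'}" for t
  proof (cases "t \<le> b")
    case False
    have "norm (x t) \<le> norm (x b) + C * \<bar>t - b\<bar>" using x_lip[of t b] norm_triangle_ineq2[of "x t" "x b"] by simp
    also have "C * \<bar>t - b\<bar> \<le> C * d" using that False C by (intro mult_left_mono) (auto simp: b'_def)
    finally show ?thesis using Cd by simp
  qed (use assms that in \<open>auto simp: confined_def\<close>)
  then have "confined b'" using b \<open>d > 0\<close> by (auto simp: confined_def b'_def min_less_iff_disj)
  moreover have "b < b'" using b \<open>d > 0\<close> by (auto simp: b'_def)
  ultimately show ?thesis using that by blast
qed

text \<open>Confinement of the limit curve forces the polygons into the larger ball, uniformly in
  time. Grid indices are reached because each is the value of \<open>ix k\<close> at its own grid
  time.\<close>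

lemma confined_eventually_valid:
  assumes "confined b"
  shows "eventually (\<lambda>k. \<forall>i. t0 + real i * h k \<le> b \<longrightarrow> valid k i) sequentially"
proof -
  have "eventually (\<lambda>k. \<forall>t\<in>{t0..b}. norm (X k (ix k t)) < R - 1) sequentially"
  proof (rule almost_lipschitz_eventually_bounded[where e="\<lambda>k. C * h k" and C=C and x=x])
    fix k and s t :: real assume "s \<in> {t0..b}" "t \<in> {t0..b}"
    then show "norm (X k (ix k s) - X k (ix k t)) \<le> C * \<bar>s - t\<bar> + C * h k"
      unfolding ix_def by (intro norm_step_function_diff_le X_step C h) auto
  next
    show "(\<lambda>k. C * h k) \<longlonglongrightarrow> 0" using tendsto_mult_left[OF h_lim, of C] by simp
  next
    fix t assume "t \<in> {t0..b}"
    then show "(\<lambda>n. X n (ix n t)) \<longlonglongrightarrow> x t" "norm (x t) < R - 1"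
      using assms by (auto intro!: lim_ix simp: confined_def)
  qed
  moreover have "eventually (\<lambda>k. 1 / real (Suc k) < T - b) sequentially"
    by (rule order_tendstoD[OF LIMSEQ_Suc[OF lim_1_over_n]]) (use assms in \<open>auto simp: confined_def\<close>)
  ultimately show ?thesis
  proof eventually_elim
    case (elim k)
    show ?case
    proof (intro allI impI)
      fix i assume i: "t0 + real i * h k \<le> b"
      have "norm (X k j) \<le> R - 1" if "j \<le> i" for j
      proof -
        have "real j * h k \<le> real i * h k" "0 \<le> real j * h k" using that h(1)[of k] by (auto intro: mult_right_mono)
        then have "t0 + real j * h k \<in> {t0..b}" using i by auto
        from bspec[OF elim(1) this] show ?thesis by (simp add: ix_grid less_imp_le)
      qed
      then show "valid k i" using i elim(2) by (auto simp: valid_def)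
    qed
  qed
qed

section \<open>Lower bound on the limiting cost rate\<close>

lemma increment_lower_bound:
  assumes "i \<le> j" and "\<And>m. i \<le> m \<Longrightarrow> m < j \<Longrightarrow> p \<bullet> (X k (Suc m) - X k m) - h k * b \<le> u k m - u k (Suc m)"
  shows "p \<bullet> (X k j - X k i) - real (j - i) * h k * b \<le> u k i - u k j"
  using assms
proof (induction j rule: dec_induct)
  case (step j)
  have "p \<bullet> (X k j - X k i) - real (j - i) * h k * b \<le> u k i - u k j" using step by auto
  moreover have "p \<bullet> (X k (Suc j) - X k j) - h k * b \<le> u k j - u k (Suc j)" using step by auto
  ultimately show ?case using step.hyps by (simp add: Suc_diff_le algebra_simps inner_diff_right)
qed simp

text \<open>On a short window after \<open>s\<close> all projections are close to
  \<open>(s, x s)\<close>, where upper semicontinuity replaces the varying Hamiltonians by one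
  constant \<open>B\<close>. The inequalities along the polygon then telescope, and as
  \<open>k\<close> grows the displacement tends to that of \<open>x\<close>. Each \<open>p\<close>
  satisfies \<open>norm p \<le> real k\<close> eventually, so the restriction on momenta vanishes in
  the limit.\<close>

lemma rate_lower_bound_eventually:
  assumes "confined s" and d: "(x has_vector_derivative d) (at s)" and "\<epsilon> > 0"
  shows "eventually (\<lambda>n. eventually (\<lambda>k. p \<bullet> d + K - Hm s (x s) p - \<epsilon> \<le>
     (\<phi> k (s + 1 / real (Suc n)) - \<phi> k s) / (1 / real (Suc n))) sequentially) sequentially"
proof -
  obtain b where b: "s < b" "confined b" using confined_extend[OF assms(1)] by blast
  have s: "t0 \<le> s" "s < T" using assms(1) by (auto simp: confined_def)
  have "b < T" using b by (auto simp: confined_def)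
  \<comment> \<open>One quarter of \<epsilon> pays for semicontinuity and one for the difference
    quotient of \<open>x\<close>; the other half gives the strict inequality needed for the limit in
    \<open>k\<close>.\<close>
  have e4: "\<epsilon> / 4 > 0" using \<open>\<epsilon> > 0\<close> by simp
  define B where "B = Hm s (x s) p + \<epsilon> / 4"
  have "s \<in> {t0..T}" using s by simp
  from usc[OF this e4, of "x s" p] obtain \<delta> where \<delta>: "\<delta> > 0"
    "\<And>t' x'. Ue (t', x') < \<infinity> \<Longrightarrow> \<bar>t' - s\<bar> < \<delta> \<Longrightarrow> norm (x' - x s) < \<delta> \<Longrightarrow> Hm t' x' p \<le> B"
    unfolding B_def by blast
  have to0: "(\<lambda>n. 1 / real (Suc n)) \<longlonglongrightarrow> 0" by (rule LIMSEQ_Suc[OF lim_1_over_n])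
  have "(\<lambda>n. (x (s + 1 / real (Suc n)) - x s) /\<^sub>R (1 / real (Suc n))) \<longlonglongrightarrow> d"
  proof -
    have "((\<lambda>h. norm (x (s + h) - x s - h *\<^sub>R d) / norm h) \<longlongrightarrow> 0) (at 0)"
      using d by (simp add: has_vector_derivative_def has_derivative_at)
    moreover have "filterlim (\<lambda>n. 1 / real (Suc n)) (at 0) sequentially"
      using to0 by (simp add: filterlim_at)
    ultimately have l0: "(\<lambda>n. norm (x (s + 1 / real (Suc n)) - x s - (1 / real (Suc n)) *\<^sub>R d) / norm (1 / real (Suc n))) \<longlonglongrightarrow> 0"
      by (rule filterlim_compose)
    have eq: "norm (a /\<^sub>R \<eta> - d) = norm (a - \<eta> *\<^sub>R d) / norm \<eta>" if "\<eta> > 0" for a and \<eta> :: real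
    proof -
      have "a /\<^sub>R \<eta> - d = (a - \<eta> *\<^sub>R d) /\<^sub>R \<eta>" using that by (simp add: scaleR_diff_right)
      then show ?thesis by (simp add: divide_inverse mult.commute)
    qed
    have "norm ((x (s + 1 / real (Suc n)) - x s) /\<^sub>R (1 / real (Suc n)) - d) =
        norm (x (s + 1 / real (Suc n)) - x s - (1 / real (Suc n)) *\<^sub>R d) / norm (1 / real (Suc n))" for n
      by (rule eq) simp
    with l0 have "(\<lambda>n. norm ((x (s + 1 / real (Suc n)) - x s) /\<^sub>R (1 / real (Suc n)) - d)) \<longlonglongrightarrow> 0"
      by (simp only:)
    then show ?thesis by (rule LIM_zero_cancel[OF tendsto_norm_zero_cancel])
  qed
  then have "(\<lambda>n. p \<bullet> ((x (s + 1 / real (Suc n)) - x s) /\<^sub>R (1 / real (Suc n)))) \<longlonglongrightarrow> p \<bullet> d"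
    by (intro tendsto_intros)
  then have "eventually (\<lambda>n. p \<bullet> d - \<epsilon> / 4 < p \<bullet> ((x (s + 1 / real (Suc n)) - x s) /\<^sub>R (1 / real (Suc n)))) sequentially"
    by (rule order_tendstoD) (use \<open>\<epsilon> > 0\<close> in simp)
  \<comment> \<open>Half of \<delta> is reserved for motion during the window, in time and in space;
    the other half later absorbs the mesh size, the projection error and the distance from
    \<open>X k\<close> to \<open>x\<close>.\<close>
  moreover have "eventually (\<lambda>n. 1 / real (Suc n) < min (b - s) (\<delta> / (2 * (C + 1)))) sequentially"
    by (rule order_tendstoD[OF to0]) (use b \<delta> C in auto)
  ultimately show ?thesis
  proof eventually_elim
    case (elim n)
    define \<eta> where "\<eta> = 1 / real (Suc n)"
    have \<eta>: "\<eta> > 0" "s + \<eta> < b" "(C + 1) * \<eta> < \<delta> / 2"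
    proof -
      have "\<eta> < b - s" "\<eta> < \<delta> / (2 * (C + 1))" using elim(2) by (simp_all add: \<eta>_def)
      then show "s + \<eta> < b" "(C + 1) * \<eta> < \<delta> / 2"
        using C by (simp_all add: pos_less_divide_eq algebra_simps)
    qed (simp add: \<eta>_def)
    have s\<eta>: "s + \<eta> \<in> {t0..T}" using \<eta> s \<open>b < T\<close> by auto
    have dq: "\<eta> * (p \<bullet> d - \<epsilon> / 4) < p \<bullet> (x (s + \<eta>) - x s)"
    proof -
      have "\<eta> * (p \<bullet> d - \<epsilon> / 4) < \<eta> * (p \<bullet> ((x (s + \<eta>) - x s) /\<^sub>R \<eta>))"
        using elim(1) \<eta>(1) unfolding \<eta>_def[symmetric] by simp
      also have "\<dots> = p \<bullet> (x (s + \<eta>) - x s)" using \<eta>(1) by simp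
      finally show ?thesis .
    qed
    have xs: "(\<lambda>k. X k (ix k s)) \<longlonglongrightarrow> x s" using s by (intro lim_ix) auto
    have "(\<lambda>k. 1 / real (Suc k) + (C + 1) * h k + norm (X k (ix k s) - x s)) \<longlonglongrightarrow> 0 + (C + 1) * 0 + norm (x s - x s)"
      by (intro tendsto_intros to0 h_lim xs)
    then have "eventually (\<lambda>k. 1 / real (Suc k) + (C + 1) * h k + norm (X k (ix k s) - x s) < \<delta> / 2) sequentially"
      by (rule order_tendstoD) (use \<delta> in simp)
    moreover have "(\<lambda>k. p \<bullet> (X k (ix k (s + \<eta>)) - X k (ix k s)) +
        (K - B) * (real (ix k (s + \<eta>)) * h k - real (ix k s) * h k)) \<longlonglongrightarrow>
       p \<bullet> (x (s + \<eta>) - x s) + (K - B) * ((s + \<eta> - t0) - (s - t0))"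
      by (intro tendsto_intros lim_ix grid_lim) (use s\<eta> s in auto)
    then have "eventually (\<lambda>k. \<eta> * (p \<bullet> d + K - Hm s (x s) p - \<epsilon>) < p \<bullet> (X k (ix k (s + \<eta>)) - X k (ix k s)) +
        (K - B) * (real (ix k (s + \<eta>)) * h k - real (ix k s) * h k)) sequentially"
    proof (rule order_tendstoD)
      have "\<eta> * \<epsilon> > 0" using \<eta>(1) \<open>\<epsilon> > 0\<close> by simp
      then show "\<eta> * (p \<bullet> d + K - Hm s (x s) p - \<epsilon>) < p \<bullet> (x (s + \<eta>) - x s) + (K - B) * ((s + \<eta> - t0) - (s - t0))"
        using dq by (simp add: B_def algebra_simps)
    qed
    moreover have "eventually (\<lambda>k. nat \<lceil>norm p\<rceil> \<le> k) sequentially" by (rule eventually_ge_at_top)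
    ultimately show ?case using confined_eventually_valid[OF b(2)]
    proof eventually_elim
      case (elim k)
      define i j where "i = ix k s" and "j = ix k (s + \<eta>)"
      have "i \<le> j" unfolding i_def j_def using \<eta> by (intro ix_mono) simp
      have pk: "norm p \<le> real k" using elim(3) by linarith
      have "p \<bullet> (X k (Suc m) - X k m) - h k * B \<le> u k m - u k (Suc m)" if m: "i \<le> m" "m < j" for m
      proof -
        have mt: "t0 + real m * h k \<le> s + \<eta>" "s - h k < t0 + real m * h k"
        proof -
          have "real m * h k \<le> real j * h k" "real i * h k \<le> real m * h k" using m h(1)[of k] by (auto intro: mult_right_mono)
          moreover have "t0 + real j * h k \<le> s + \<eta>" unfolding j_def by (rule ix_bounds) (use s \<eta> in simp)
          moreover have "s - h k < t0 + real i * h k" unfolding i_def by (rule ix_bounds[OF s(1)])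
          ultimately show "t0 + real m * h k \<le> s + \<eta>" "s - h k < t0 + real m * h k" by linarith+
        qed
        have v: "valid k m" using elim(4) mt(1) \<eta>(2) by auto
        have nr: "S k m \<in> ext_epi Ue" "dist (S k m) ((t0 + real m * h k, X k m), u k m) \<le> 1 / real (Suc k)"
          using near[of m k] v by (auto simp: valid_def)
        define \<sigma> y where "\<sigma> = fst (fst (S k m))" and "y = snd (fst (S k m))"
        have "dist (fst (S k m)) (t0 + real m * h k, X k m) \<le> 1 / real (Suc k)"
          using order_trans[OF dist_fst_le nr(2)] by simp
        from order_trans[OF dist_fst_le this] order_trans[OF dist_snd_le this]
        have \<sigma>y: "\<bar>\<sigma> - (t0 + real m * h k)\<bar> \<le> 1 / real (Suc k)" "norm (y - X k m) \<le> 1 / real (Suc k)"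
          by (simp_all add: \<sigma>_def y_def dist_norm)
        have "norm (X k m - X k i) \<le> real (m - i) * (C * h k)"
          by (rule norm_diff_le_steps[of "X k", OF X_step m(1)])
        also have "\<dots> = C * (real m * h k - real i * h k)" using m by (simp add: of_nat_diff algebra_simps)
        also have "\<dots> \<le> C * (\<eta> + h k)"
          using mt(1) ix_bounds(2)[OF s(1), of k] C by (intro mult_left_mono) (auto simp: i_def)
        finally have Xm: "norm (X k m - X k i) \<le> C * \<eta> + C * h k" by (simp add: algebra_simps)
        have "norm (y - x s) \<le> norm (y - X k m) + norm (X k m - X k i) + norm (X k i - x s)"
          using norm_triangle_ineq[of "y - X k m" "X k m - x s"] norm_triangle_ineq[of "X k m - X k i" "X k i - x s"] by simp
        moreover have "0 \<le> h k" "0 \<le> C * h k" "0 \<le> C * \<eta>" "0 \<le> \<eta>" "0 \<le> norm (X k i - x s)" using h(1)[of k] C \<eta> by auto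
        moreover have "C * \<eta> + \<eta> < \<delta> / 2" using \<eta>(3) by (simp add: algebra_simps)
        moreover have "1 / real (Suc k) + (C * h k + h k) + norm (X k i - x s) < \<delta> / 2"
          using elim(1) by (simp add: i_def algebra_simps)
        ultimately have "norm (y - x s) < \<delta>" "\<bar>\<sigma> - s\<bar> < \<delta>" using \<sigma>y Xm mt by linarith+
        moreover have "Ue (\<sigma>, y) < \<infinity>" using nr(1) by (auto simp: ext_epi_def \<sigma>_def y_def split_beta)
        ultimately have "Hm \<sigma> y p \<le> B" by (intro \<delta>(2))
        then have "h k * Hm \<sigma> y p \<le> h k * B" using h(1)[of k] by simp
        moreover have "p \<bullet> (X k (Suc m) - X k m) - h k * Hm \<sigma> y p \<le> u k m - u k (Suc m)"
          using minor[of m k p] v pk by (auto simp: valid_def \<sigma>_def y_def)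
        ultimately show ?thesis by linarith
      qed
      from increment_lower_bound[OF \<open>i \<le> j\<close> this]
      have "p \<bullet> (X k j - X k i) - real (j - i) * h k * B \<le> u k i - u k j" .
      then have "p \<bullet> (X k j - X k i) + (K - B) * (real j * h k - real i * h k) \<le> \<phi> k (s + \<eta>) - \<phi> k s"
        using \<open>i \<le> j\<close> by (simp add: \<phi>_def i_def j_def of_nat_diff algebra_simps)
      then have "\<eta> * (p \<bullet> d + K - Hm s (x s) p - \<epsilon>) \<le> \<phi> k (s + \<eta>) - \<phi> k s"
        using elim(2) by (simp add: i_def j_def)
      then show ?case using \<eta>(1) unfolding \<eta>_def[symmetric] by (simp add: field_simps)
    qed
  qed
qed

text \<open>Subtracting the drift contained in \<phi> leaves the true cost rate. Negative lower
  bounds are harmless, as \<open>ennreal\<close> sends them to 0.\<close>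

lemma rate_lower_bound:
  assumes "confined s" and "(x has_vector_derivative d) (at s)" and "rate s \<noteq> \<infinity>"
  shows "p \<bullet> d - Hm s (x s) p \<le> enn2real (rate s) - K"
proof -
  have "p \<bullet> d + K - Hm s (x s) p \<le> enn2real (rate s)"
  proof (rule field_le_epsilon)
    fix \<epsilon> :: real assume "\<epsilon> > 0"
    have "ennreal (p \<bullet> d + K - Hm s (x s) p - \<epsilon>) \<le> rate s"
      unfolding rate_def
    proof (rule Liminf_bounded)
      show "eventually (\<lambda>n. ennreal (p \<bullet> d + K - Hm s (x s) p - \<epsilon>) \<le> liminf (\<lambda>k. quot n k s)) sequentially"
        using rate_lower_bound_eventually[OF assms(1,2) \<open>\<epsilon> > 0\<close>, of p]
      proof eventually_elim
        case (elim n)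
        show ?case
          by (rule Liminf_bounded) (use elim in eventually_elim, auto simp: quot_def intro: ennreal_leI)
      qed
    qed
    also have "rate s = ennreal (enn2real (rate s))" using assms(3) by (simp add: less_top)
    finally show "p \<bullet> d + K - Hm s (x s) p \<le> enn2real (rate s) + \<epsilon>" by (simp add: ennreal_le_iff)
  qed
  then show ?thesis by simp
qed

text \<open>Just after \<open>b\<close> the polygon is near a point of the epigraph over a neighbour
  of \<open>(b, x b)\<close>, where \<open>Ue\<close> exceeds \<open>c\<close>. So its cost
  coordinate is at least about \<open>c\<close>, and its total decrease is limited. The time
  \<open>b + 1 / Suc n\<close> is where the integrated difference quotients end.\<close>

lemma increment_upper_bound_eventually:
  assumes "confined b" and c: "ereal c < Ue (b, x b)" and "\<epsilon> > 0"
  shows "eventually (\<lambda>n. eventually (\<lambda>k. \<phi> k (b + 1 / real (Suc n)) - \<phi> k t0 \<le> u0 + K * (b - t0) - c + \<epsilon>) sequentially) sequentially"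
proof -
  obtain b' where b': "b < b'" "confined b'" using confined_extend[OF assms(1)] by blast
  have b: "t0 \<le> b" "b < T" "b' < T" using assms(1) b' by (auto simp: confined_def)
  have "eventually (\<lambda>z. ereal c < Ue z) (nhds (b, x b))"
    using lsc_on_eventually[OF lsc _ c] by simp
  then obtain \<rho> where \<rho>: "\<rho> > 0" "\<And>z. dist z (b, x b) < \<rho> \<Longrightarrow> ereal c < Ue z"
    by (auto simp: eventually_nhds_metric)
  have to0: "(\<lambda>n. 1 / real (Suc n)) \<longlonglongrightarrow> 0" by (rule LIMSEQ_Suc[OF lim_1_over_n])
  have "eventually (\<lambda>n. 1 / real (Suc n) < min (b' - b) (min (\<rho> / (2 * (C + 1))) (\<epsilon> / (2 * (K + 1))))) sequentially"
    by (rule order_tendstoD[OF to0]) (use b' \<rho> C K \<open>\<epsilon> > 0\<close> in auto)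
  then show ?thesis
  proof eventually_elim
    case (elim n)
    define \<eta> where "\<eta> = 1 / real (Suc n)"
    have \<eta>: "\<eta> > 0" "b + \<eta> < b'" "(C + 1) * \<eta> < \<rho> / 2" "(K + 1) * \<eta> < \<epsilon> / 2"
    proof -
      have "\<eta> < b' - b" "\<eta> < \<rho> / (2 * (C + 1))" "\<eta> < \<epsilon> / (2 * (K + 1))" using elim by (simp_all add: \<eta>_def)
      then show "b + \<eta> < b'" "(C + 1) * \<eta> < \<rho> / 2" "(K + 1) * \<eta> < \<epsilon> / 2"
        using C K by (simp_all add: pos_less_divide_eq algebra_simps)
    qed (simp add: \<eta>_def)
    have K\<eta>: "K * \<eta> < \<epsilon> / 2" using \<eta>(1,4) by (simp add: algebra_simps)
    have b\<eta>: "b + \<eta> \<in> {t0..T}" using \<eta> b by auto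
    have "(\<lambda>k. 1 / real (Suc k) + h k + norm (X k (ix k (b + \<eta>)) - x (b + \<eta>))) \<longlonglongrightarrow> 0 + 0 + norm (x (b + \<eta>) - x (b + \<eta>))"
      by (intro tendsto_intros to0 h_lim lim_ix b\<eta>)
    then have "eventually (\<lambda>k. 1 / real (Suc k) + h k + norm (X k (ix k (b + \<eta>)) - x (b + \<eta>)) < min (\<rho> / 2) (\<epsilon> / 2)) sequentially"
      by (rule order_tendstoD) (use \<rho> \<open>\<epsilon> > 0\<close> in simp)
    with confined_eventually_valid[OF b'(2)] show ?case
    proof eventually_elim
      case (elim k)
      define j where "j = ix k (b + \<eta>)"
      have jt: "t0 + real j * h k \<le> b + \<eta>" "b + \<eta> - h k < t0 + real j * h k"
        unfolding j_def using b \<eta> by (auto intro: ix_bounds)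
      have "valid k j" using elim(1) jt \<eta> by auto
      then have nr: "S k j \<in> ext_epi Ue" "dist (S k j) ((t0 + real j * h k, X k j), u k j) \<le> 1 / real (Suc k)"
        using near[of j k] by (auto simp: valid_def)
      have d1: "dist (fst (S k j)) (t0 + real j * h k, X k j) \<le> 1 / real (Suc k)"
        and d2: "\<bar>snd (S k j) - u k j\<bar> \<le> 1 / real (Suc k)"
        using order_trans[OF dist_fst_le nr(2)] order_trans[OF dist_snd_le nr(2)] by (simp_all add: dist_real_def)
      have "dist (t0 + real j * h k, X k j) (b, x b) \<le> \<bar>t0 + real j * h k - b\<bar> + norm (X k j - x b)"
        by (metis dist_Pair_Pair dist_norm real_norm_def sqrt_sum_squares_le_sum zero_le_dist)
      also have "\<bar>t0 + real j * h k - b\<bar> \<le> \<eta> + h k" using jt \<eta>(1) h(1)[of k] by auto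
      also have "norm (X k j - x b) \<le> norm (X k j - x (b + \<eta>)) + C * \<eta>"
        using norm_triangle_ineq[of "X k j - x (b + \<eta>)" "x (b + \<eta>) - x b"] x_lip[of "b + \<eta>" b] \<eta>(1) by simp
      finally have "dist (t0 + real j * h k, X k j) (b, x b) \<le> \<eta> + h k + (norm (X k j - x (b + \<eta>)) + C * \<eta>)" by simp
      with d1 have "dist (fst (S k j)) (b, x b) \<le> 1 / real (Suc k) + (\<eta> + h k + (norm (X k j - x (b + \<eta>)) + C * \<eta>))"
        using dist_triangle[of "fst (S k j)" "(b, x b)" "(t0 + real j * h k, X k j)"] by linarith
      also have "\<dots> < \<rho>" using elim(2) \<eta>(3) by (simp add: j_def algebra_simps)
      finally have "ereal c < Ue (fst (S k j))" by (rule \<rho>(2))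
      also have "Ue (fst (S k j)) \<le> ereal (snd (S k j))" using nr(1) by (auto simp: ext_epi_def split_beta)
      finally have cu: "c < u k j + 1 / real (Suc k)" using d2 by simp
      have "1 / real (Suc k) < \<epsilon> / 2"
        using elim(2) h(1)[of k] norm_ge_zero[of "X k (ix k (b + \<eta>)) - x (b + \<eta>)"] by linarith
      moreover have "K * (real j * h k) \<le> K * (b + \<eta> - t0)" using jt K by (intro mult_left_mono) auto
      ultimately have "- u k j + K * (real j * h k) + u0 \<le> u0 + K * (b - t0) - c + \<epsilon>"
        using cu K\<eta> by (simp add: algebra_simps)
      then show ?case by (simp add: \<phi>_def ix_t0 u_init j_def \<eta>_def)
    qed
  qed
qed

text \<open>Fatou's lemma is applied twice, to the limit in \<open>k\<close> for a fixed window and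
  then to the limit in \<open>n\<close>. Nonnegativity of the bound is stated separately because
  \<open>ennreal\<close> would hide a negative one.\<close>

lemma nn_integral_rate_le:
  assumes "confined b" and "ereal c < Ue (b, x b)"
  shows "0 \<le> u0 + K * (b - t0) - c"
    "(\<integral>\<^sup>+s. rate s * indicator {t0..b} s \<partial>lborel) \<le> ennreal (u0 + K * (b - t0) - c)"
proof -
  define q where "q = u0 + K * (b - t0) - c"
  have b: "t0 \<le> b" using assms by (simp add: confined_def)
  have pos: "0 \<le> q + \<epsilon>" if "\<epsilon> > 0" for \<epsilon>
  proof -
    have "eventually (\<lambda>n. 0 \<le> q + \<epsilon>) sequentially"
      using increment_upper_bound_eventually[OF assms that]
    proof eventually_elim
      case (elim n)
      then obtain k where "\<phi> k (b + 1 / real (Suc n)) - \<phi> k t0 \<le> q + \<epsilon>"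
        unfolding q_def by (meson eventually_happens trivial_limit_sequentially)
      moreover have "\<phi> k t0 \<le> \<phi> k (b + 1 / real (Suc n))" using b by (intro monoD[OF \<phi>_mono]) (simp add: add_increasing2)
      ultimately show ?case by simp
    qed
    then show ?thesis by simp
  qed
  then have "0 \<le> q" by (rule field_le_epsilon)
  then show "0 \<le> u0 + K * (b - t0) - c" by (simp add: q_def)
  have "(\<integral>\<^sup>+s. rate s * indicator {t0..b} s \<partial>lborel) \<le> ennreal q"
  proof (rule ennreal_le_epsilon)
    fix \<epsilon> :: real assume "\<epsilon> > 0"
    have "(\<integral>\<^sup>+s. rate s * indicator {t0..b} s \<partial>lborel)
       = (\<integral>\<^sup>+s. liminf (\<lambda>n. liminf (\<lambda>k. quot n k s * indicator {t0..b} s)) \<partial>lborel)"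
      by (intro nn_integral_cong) (auto simp: rate_def Liminf_const split: split_indicator)
    also have "\<dots> \<le> liminf (\<lambda>n. \<integral>\<^sup>+s. liminf (\<lambda>k. quot n k s * indicator {t0..b} s) \<partial>lborel)"
      by (rule nn_integral_liminf) measurable
    also have "\<dots> \<le> liminf (\<lambda>n. ennreal (q + \<epsilon>))"
    proof (rule Liminf_mono)
      show "eventually (\<lambda>n. (\<integral>\<^sup>+s. liminf (\<lambda>k. quot n k s * indicator {t0..b} s) \<partial>lborel) \<le> ennreal (q + \<epsilon>)) sequentially"
        using increment_upper_bound_eventually[OF assms \<open>\<epsilon> > 0\<close>]
      proof eventually_elim
        case (elim n)
        have "(\<integral>\<^sup>+s. liminf (\<lambda>k. quot n k s * indicator {t0..b} s) \<partial>lborel)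
            \<le> liminf (\<lambda>k. \<integral>\<^sup>+s. quot n k s * indicator {t0..b} s \<partial>lborel)"
          by (rule nn_integral_liminf) measurable
        also have "\<dots> \<le> liminf (\<lambda>k. ennreal (q + \<epsilon>))"
        proof (rule Liminf_mono)
          show "eventually (\<lambda>k. (\<integral>\<^sup>+s. quot n k s * indicator {t0..b} s \<partial>lborel) \<le> ennreal (q + \<epsilon>)) sequentially"
            using elim
          proof eventually_elim
            case (elim k)
            have "(\<integral>\<^sup>+s. quot n k s * indicator {t0..b} s \<partial>lborel) \<le> ennreal (\<phi> k (b + 1 / real (Suc n)) - \<phi> k t0)"
              unfolding quot_def by (rule nn_integral_mono_diff_quotient_le[OF \<phi>_mono]) (use b in auto)
            also have "\<dots> \<le> ennreal (q + \<epsilon>)" using elim by (intro ennreal_leI) (simp add: q_def)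
            finally show ?case .
          qed
        qed
        finally show ?case by (simp add: Liminf_const)
      qed
    qed
    also have "\<dots> = ennreal q + ennreal \<epsilon>" using \<open>0 \<le> q\<close> \<open>\<epsilon> > 0\<close> by (simp add: Liminf_const)
    finally show "(\<integral>\<^sup>+s. rate s * indicator {t0..b} s \<partial>lborel) \<le> ennreal q + ennreal \<epsilon>" .
  qed
  then show "(\<integral>\<^sup>+s. rate s * indicator {t0..b} s \<partial>lborel) \<le> ennreal (u0 + K * (b - t0) - c)" by (simp add: q_def)
qed

text \<open>Continuation with a uniform time step \<eta>: since \<open>C * \<eta> < 1\<close>, a
  norm of at most \<open>R - 2\<close> stays below \<open>R - 1\<close> for that long, so
  confinement persists, and the a priori bound restores \<open>R - 2\<close>.\<close>

lemma confined_if_a_priori_bound: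
  assumes bound: "\<And>b. confined b \<Longrightarrow> norm (x b) \<le> R - 2" and init: "norm (x t0) \<le> R - 2"
    and b: "t0 \<le> b" "b < T"
  shows "confined b"
proof -
  define \<eta> where "\<eta> = 1 / (2 * (C + 1))"
  have \<eta>: "\<eta> > 0" using C by (simp add: \<eta>_def)
  have C\<eta>: "C * \<eta> < 1" using C by (simp add: \<eta>_def field_simps)
  have *: "\<forall>t. t0 \<le> t \<longrightarrow> t < T \<longrightarrow> t \<le> t0 + real n * \<eta> \<longrightarrow> confined t \<and> norm (x t) \<le> R - 2" for n
  proof (induction n)
    case 0
    have "confined t0" using init t0 by (auto simp: confined_def)
    then show ?case using init by (auto dest: antisym)
  next
    case (Suc n)
    show ?case
    proof (intro allI impI)
      fix t assume t: "t0 \<le> t" "t < T" "t \<le> t0 + real (Suc n) * \<eta>"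
      have "norm (x s) < R - 1" if s: "s \<in> {t0..t}" for s
      proof -
        define s' where "s' = max t0 (s - \<eta>)"
        have "norm (x s') \<le> R - 2" using Suc s t \<eta> by (auto simp: s'_def algebra_simps)
        moreover have "norm (x s) \<le> norm (x s') + C * \<bar>s - s'\<bar>"
          using x_lip[of s s'] norm_triangle_ineq2[of "x s" "x s'"] by simp
        moreover have "C * \<bar>s - s'\<bar> \<le> C * \<eta>" using s \<eta> C by (intro mult_left_mono) (auto simp: s'_def)
        ultimately show ?thesis using C\<eta> by linarith
      qed
      then have "confined t" using t by (simp add: confined_def)
      then show "confined t \<and> norm (x t) \<le> R - 2" using bound by blast
    qed
  qed
  obtain n :: nat where "b - t0 \<le> real n * \<eta>" using reals_Archimedean3[OF \<eta>] less_imp_le by blast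
  then show ?thesis using *[of n] b by auto
qed

text \<open>The terminal time is reached through \<open>bn n\<close>, increasing to
  \<open>T\<close>: lower semicontinuity of \<open>Ue\<close> keeps \<open>c\<close> below the
  values there, the missing endpoint is a null set, and Fatou's lemma gives the integral over the
  whole interval.\<close>

lemma nn_integral_rate_le_closed:
  assumes all: "\<And>b. t0 \<le> b \<Longrightarrow> b < T \<Longrightarrow> confined b" and b: "b \<in> {t0..T}" and c: "ereal c < Ue (b, x b)"
  shows "0 \<le> u0 + K * (b - t0) - c \<and>
    (\<integral>\<^sup>+s. rate s * indicator {t0..b} s \<partial>lborel) \<le> ennreal (u0 + K * (b - t0) - c)"
proof (cases "b < T")
  case True
  then show ?thesis using nn_integral_rate_le[OF all c] b by auto
next
  case False
  then have bT: "b = T" using b by simp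
  define bn where "bn n = T - (T - t0) / real (Suc n)" for n
  have bn: "t0 \<le> bn n" "bn n < T" for n
  proof -
    have "(T - t0) / real (Suc n) \<le> (T - t0) / 1" using t0 by (intro divide_left_mono) auto
    then show "t0 \<le> bn n" by (simp add: bn_def)
    show "bn n < T" using t0 by (simp add: bn_def)
  qed
  have bn_lim: "bn \<longlonglongrightarrow> T"
    using tendsto_diff[OF tendsto_const[of T] tendsto_mult_right[OF LIMSEQ_Suc[OF lim_1_over_n], of "T - t0"]]
    by (simp add: bn_def[abs_def])
  have "continuous_on UNIV x"
    using x_lip C by (intro lipschitz_on_continuous_on[where L=C] lipschitz_onI) (auto simp: dist_norm)
  then have "(\<lambda>n. x (bn n)) \<longlonglongrightarrow> x T"
    using bn_lim by (simp add: continuous_on_tendsto_compose[where f=x and s=UNIV])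
  then have ev: "eventually (\<lambda>n. ereal c < Ue (bn n, x (bn n))) sequentially"
    using c bT by (intro lsc_on_seq[OF lsc, where z="(T, x T)"] tendsto_Pair bn_lim) auto
  define q where "q = u0 + K * (T - t0) - c"
  have ev2: "eventually (\<lambda>n. 0 \<le> q \<and> (\<integral>\<^sup>+s. rate s * indicator {t0..bn n} s \<partial>lborel) \<le> ennreal q) sequentially"
    using ev
  proof eventually_elim
    case (elim n)
    have "K * (bn n - t0) \<le> K * (T - t0)" using K bn(2)[of n] by (intro mult_left_mono) auto
    then have "u0 + K * (bn n - t0) - c \<le> q" by (simp add: q_def)
    then show ?case
      using nn_integral_rate_le[OF all[OF bn] elim] by (meson ennreal_leI order_trans)
  qed
  then have "0 \<le> q" by (auto dest: eventually_happens)
  have "(\<integral>\<^sup>+s. rate s * indicator {t0..T} s \<partial>lborel) \<le> (\<integral>\<^sup>+s. liminf (\<lambda>n. rate s * indicator {t0..bn n} s) \<partial>lborel)"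
  proof (rule nn_integral_mono_AE)
    show "AE s in lborel. rate s * indicator {t0..T} s \<le> liminf (\<lambda>n. rate s * indicator {t0..bn n} s)"
      using AE_lborel_singleton[of T]
    proof eventually_elim
      case (elim s)
      show ?case
      proof (cases "s \<in> {t0..T}")
        case True
        then have "s < T" using elim by simp
        have "eventually (\<lambda>n. s < bn n) sequentially" by (rule order_tendstoD(1)[OF bn_lim \<open>s < T\<close>])
        then have "eventually (\<lambda>n. rate s * indicator {t0..T} s \<le> rate s * indicator {t0..bn n} s) sequentially"
          by eventually_elim (use True in auto)
        then show ?thesis by (rule Liminf_bounded)
      qed auto
    qed
  qed
  also have "\<dots> \<le> liminf (\<lambda>n. \<integral>\<^sup>+s. rate s * indicator {t0..bn n} s \<partial>lborel)"
    by (rule nn_integral_liminf) measurable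
  also have "\<dots> \<le> liminf (\<lambda>n. ennreal q)"
    by (rule Liminf_mono) (use ev2 in eventually_elim, auto)
  finally show ?thesis using \<open>0 \<le> q\<close> by (simp add: bT q_def Liminf_const)
qed

end

section \<open>The viability theorem\<close>

theorem theorem4p3:
  fixes T :: real
    and L :: "real \<Rightarrow> 'a::euclidean_space \<Rightarrow> 'a \<Rightarrow> ereal"
    and U :: "real \<Rightarrow> 'a \<Rightarrow> ereal"
  assumes "L1 T L" and "L2 T L" and "L3 T L" and "L4 T L" and "L5 T L"
    and "ext_proper (U_ext T U)"
    and "lsc_on UNIV (U_ext T U)"
    and hyp: "\<And>t x nt nx nu.
       (t, x) \<in> ext_dom (U_ext T U) \<Longrightarrow> t \<in> {0..<T} \<Longrightarrow>
       ((nt, nx), nu) \<in> normal_cone (ext_epi (U_ext T U)) ((t, x), real_of_ereal (U t x)) \<Longrightarrow>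
       \<exists>(tk::nat \<Rightarrow> real) (xk::nat \<Rightarrow> 'a) (\<alpha>::nat \<Rightarrow> real) (vk::nat \<Rightarrow> 'a).
          tk \<longlonglongrightarrow> t \<and> xk \<longlonglongrightarrow> x \<and> \<alpha> \<longlonglongrightarrow> 0 \<and>
          (\<forall>k. tk k \<in> {0..T} \<and> vk k \<in> ext_dom (L (tk k) (xk k)) \<and>
               ereal (nt + inner (vk k) nx) - ereal nu * L (tk k) (xk k) (vk k) \<le> ereal (\<alpha> k))"
    and "(t0, x0) \<in> ext_dom (U_ext T U)" and "t0 \<in> {0..<T}"
  shows "\<exists>(x::real \<Rightarrow> 'a) (u::real \<Rightarrow> real).
           abs_continuous_on t0 T (\<lambda>t. (x t, u t)) \<and>
           x t0 = x0 \<and> ereal (u t0) = U t0 x0 \<and>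
           (AE t in lborel. t \<in> {t0..T} \<longrightarrow>
              (\<exists>dx du. (x has_vector_derivative dx) (at t within {t0..T}) \<and>
                       (u has_real_derivative du) (at t within {t0..T}) \<and>
                       (dx, du) \<in> Qset L t (x t))) \<and>
           (\<forall>t\<in>{t0..T}. U t (x t) \<le> ereal (u t))"
proof -
  interpret lagrangian T L by (rule lagrangian.intro) (use assms in auto)
  define Ue where "Ue = U_ext T U"
  have lsc: "lsc_on UNIV Ue" using assms(7) by (simp add: Ue_def)
  have proper: "Ue z \<noteq> -\<infinity>" for z using assms(6) unfolding Ue_def ext_proper_def by blast
  have Ue_eq: "Ue (t, y) = U t y" if "t \<in> {0..T}" for t y using that by (simp add: Ue_def U_ext_def)
  have Ue_fin: "t \<in> {0..T}" if "Ue (t, y) < \<infinity>" for t y using that by (auto simp: Ue_def U_ext_def split: if_splits)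
  have t0: "0 \<le> t0" "t0 < T" using assms by auto
  define u0 where "u0 = real_of_ereal (U t0 x0)"
  have u0: "U t0 x0 = ereal u0"
    using assms(9) Ue_eq[of t0 x0] t0 by (auto simp: u0_def ext_dom_def Ue_def ereal_real)
  obtain c \<N> where c: "c integrable_on {0..T}" "\<And>t. t \<in> {0..T} \<Longrightarrow> c t \<ge> 0" and \<N>: "\<N> \<in> null_sets lborel"
    and growth: "\<And>t y v. t \<in> {0..T} - \<N> \<Longrightarrow> norm v > c t * (1 + norm y) \<Longrightarrow> L t y v = \<infinity>"
    using assms(5) unfolding L5_def by blast
  \<comment> \<open>The Gronwall bound and two units of margin: one separates the limit curve from
    the radius \<open>R - 1\<close> allowed to polygons, the other separates polygons from their
    projections.\<close>
  define R where "R = (1 + (norm x0)\<^sup>2) * exp (4 * integral {0..T} c) + 2"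
  have "R \<ge> 0" unfolding R_def by (intro add_nonneg_nonneg mult_nonneg_nonneg) auto
  from aiming_constants[OF this] obtain C K M where C: "C \<ge> 0" and K: "K \<ge> 0" and
    aim: "\<And>(k::nat) t x nt nx nu tk xk \<alpha> vk. \<lbrakk>t \<in> {0..T}; norm x \<le> R; nu \<le> 0; tk \<longlonglongrightarrow> t; xk \<longlonglongrightarrow> x; \<alpha> \<longlonglongrightarrow> 0;
      \<forall>k. tk k \<in> {0..T} \<and> vk k \<in> ext_dom (L (tk k) (xk k)) \<and>
               ereal (nt + inner (vk k) nx) - ereal nu * L (tk k) (xk k) (vk k) \<le> ereal (\<alpha> k)\<rbrakk> \<Longrightarrow>
      \<exists>v l. norm v \<le> C \<and> - K \<le> l \<and> \<bar>l\<bar> \<le> M k \<and> (\<forall>p. norm p \<le> real k \<longrightarrow> p \<bullet> v - Ham t x p \<le> l) \<and>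
        nt + v \<bullet> nx - nu * l \<le> 0"
    by metis
  define E where "E = ext_epi Ue"
  have E: "closed E" "((t0, x0), u0) \<in> E"
    using closed_ext_epi[OF lsc] u0 Ue_eq[of t0 x0] t0 by (auto simp: E_def ext_epi_def)
  \<comment> \<open>A normal at a point of the epigraph is moved down to the graph, where the
    hypothesis applies, and has a nonpositive last component.\<close>
  have aimE: "\<exists>v l. norm v \<le> C \<and> - K \<le> l \<and> \<bar>l\<bar> \<le> M k \<and>
        (\<forall>p. norm p \<le> real k \<longrightarrow> p \<bullet> v - Ham (fst (fst s)) (snd (fst s)) p \<le> l) \<and>
        fst (fst n) + v \<bullet> snd (fst n) - snd n * l \<le> 0"
    if s: "s \<in> E" "fst (fst s) < T" "norm (snd (fst s)) \<le> R" "n \<in> normal_cone E s" for s n k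
  proof -
    obtain t y r where sv: "s = ((t, y), r)" by (metis prod.exhaust)
    obtain nt nx nu where nv: "n = ((nt, nx), nu)" by (metis prod.exhaust)
    have le: "Ue (t, y) \<le> ereal r" using s(1) by (simp add: sv E_def ext_epi_def)
    then have t: "t \<in> {0..T}" by (intro Ue_fin[of t y]) auto
    have fin: "Ue (t, y) = ereal (real_of_ereal (Ue (t, y)))"
      using le proper[of "(t, y)"] by (auto simp: ereal_real)
    then have dom: "(t, y) \<in> ext_dom (U_ext T U)" by (auto simp: ext_dom_def Ue_def)
    have "real_of_ereal (Ue (t, y)) \<le> r" using le fin by (metis ereal_less_eq(3))
    then have "((nt, nx), nu) \<in> normal_cone E ((t, y), real_of_ereal (U t y))"
      using normal_cone_ext_epi_mono[of _ r Ue "(t, y)"] s(4) Ue_eq[OF t] by (auto simp: E_def sv nv)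
    from hyp[OF dom _ this[unfolded E_def Ue_def]] obtain tk xk \<alpha> vk where k: "tk \<longlonglongrightarrow> t" "xk \<longlonglongrightarrow> y" "\<alpha> \<longlonglongrightarrow> 0"
      "\<forall>k. tk k \<in> {0..T} \<and> vk k \<in> ext_dom (L (tk k) (xk k)) \<and>
               ereal (nt + inner (vk k) nx) - ereal nu * L (tk k) (xk k) (vk k) \<le> ereal (\<alpha> k)"
      using t s(2) by (auto simp: sv)
    have "nu \<le> 0" using normal_cone_ext_epi_nonpos[of "(nt, nx)" nu Ue "(t, y)" r] le s(4) by (simp add: sv nv E_def)
    from aim[OF t _ this k, of k] s(3) show ?thesis by (simp add: sv nv)
  qed
  define good where "good k h X u S \<longleftrightarrow> 0 < h \<and> h \<le> 1 / real (Suc k) \<and> X 0 = x0 \<and> u 0 = u0 \<and>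
    (\<forall>i. norm (X (Suc i) - X i) \<le> C * h) \<and> (\<forall>i. u (Suc i) - u i \<le> K * h) \<and>
    (\<forall>i. t0 + real i * h < T - 1 / real (Suc k) \<and> (\<forall>j\<le>i. norm (X j) \<le> R - 1) \<longrightarrow>
      S i \<in> E \<and> dist (S i) ((t0 + real i * h, X i), u i) \<le> 1 / real (Suc k) \<and>
      (\<forall>p. norm p \<le> real k \<longrightarrow>
        p \<bullet> (X (Suc i) - X i) - h * Ham (fst (fst (S i))) (snd (fst (S i))) p \<le> u i - u (Suc i)))"
    for k :: nat and h :: real and X :: "nat \<Rightarrow> 'a" and u :: "nat \<Rightarrow> real" and S :: "nat \<Rightarrow> (real \<times> 'a) \<times> real"
  have "\<exists>h X u S. good k h X u S" for k
    unfolding good_def by (rule proximal_aiming_scheme[OF E t0(2) C K, where M="M k"]) (rule aimE)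
  then obtain h X u S where g: "\<And>k. good k (h k) (X k) (u k) (S k)" by metis
  have h: "0 < h k" "h k \<le> 1 / real (Suc k)" and X0: "X k 0 = x0" and X_step: "norm (X k (Suc i) - X k i) \<le> C * h k" for k i
    using g[of k] by (auto simp: good_def)
  \<comment> \<open>The compactness lemma wants estimates at all real times; clamping to
    \<open>{t0..T}\<close> extends the step functions without increasing distances.\<close>
  define cl where "cl t = max t0 (min T t)" for t
  have cl: "cl t \<in> {t0..T}" "t \<in> {t0..T} \<Longrightarrow> cl t = t" "\<bar>cl s - cl t\<bar> \<le> \<bar>s - t\<bar>" for s t
    using t0 by (auto simp: cl_def)
  define f where "f k t = X k (nat \<lfloor>(cl t - t0) / h k\<rfloor>)" for k t
  have f_lip: "norm (f k s - f k t) \<le> C * \<bar>s - t\<bar> + C * h k" for k s t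
  proof -
    have "norm (f k s - f k t) \<le> C * \<bar>cl s - cl t\<bar> + C * h k"
      unfolding f_def using cl(1) by (intro norm_step_function_diff_le h C X_step) auto
    also have "C * \<bar>cl s - cl t\<bar> \<le> C * \<bar>s - t\<bar>" using C cl(3) by (intro mult_left_mono)
    finally show ?thesis by simp
  qed
  have f0: "f k t0 = x0" for k using cl(2)[of t0] t0 X0 by (simp add: f_def)
  have f_bd: "norm (f k t) \<le> norm x0 + C * (T - t0) + C" for k t
  proof -
    have "f k t = f k (cl t)" using cl by (simp add: f_def)
    then have "norm (f k t - x0) \<le> C * \<bar>cl t - t0\<bar> + C * h k" using f_lip[of k "cl t" t0] by (simp add: f0)
    moreover have "C * \<bar>cl t - t0\<bar> \<le> C * (T - t0)" using C cl(1)[of t] by (intro mult_left_mono) auto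
    moreover have "h k \<le> 1" using h(2)[of k] by (rule order_trans) simp
    then have "C * h k \<le> C * 1" using C by (intro mult_left_mono)
    ultimately show ?thesis using norm_triangle_ineq2[of "f k t" x0] by linarith
  qed
  have h_lim: "h \<longlonglongrightarrow> 0"
    by (rule tendsto_sandwich[OF _ _ tendsto_const LIMSEQ_Suc[OF lim_1_over_n]])
      (auto intro!: always_eventually less_imp_le[OF h(1)] h(2) simp del: of_nat_Suc)
  have "(\<lambda>k. C * h k) \<longlonglongrightarrow> 0" using tendsto_mult_left[OF h_lim, of C] by simp
  from almost_lipschitz_convergent_subsequence[of f C "\<lambda>k. C * h k", OF f_lip this f_bd C]
  obtain r x where r: "strict_mono (r :: nat \<Rightarrow> nat)" and x_lim: "\<And>t. (\<lambda>n. f (r n) t) \<longlonglongrightarrow> x t"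
    and x_lip: "\<And>s t. norm (x s - x t) \<le> C * \<bar>s - t\<bar>" by blast
  have xt0: "x t0 = x0" using x_lim[of t0] by (simp add: f0 LIMSEQ_const_iff)
  have rk: "k \<le> r k" for k using seq_suble[OF r] .
  have r1: "1 / real (Suc (r k)) \<le> 1 / real (Suc k)" for k using rk[of k] by (simp add: frac_le)
  \<comment> \<open>Along the subsequence \<open>r k \<ge> k\<close>, so the errors only shrink and
    every momentum admissible for \<open>k\<close> is admissible for \<open>r k\<close>.\<close>
  interpret lim: aiming_limit T t0 C K R Ue Ham "\<lambda>k. h (r k)" "\<lambda>k. X (r k)" "\<lambda>k. u (r k)" "\<lambda>k. S (r k)" x u0
  proof (unfold_locales)
    show "t0 < T" "0 \<le> C" "0 \<le> K" by fact+
    fix k i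
    note gk = g[of "r k", unfolded good_def]
    show "0 < h (r k)" "h (r k) \<le> 1 / real (Suc k)" using h[of "r k"] r1[of k] by auto
    show "u (r k) 0 = u0" "norm (X (r k) (Suc i) - X (r k) i) \<le> C * h (r k)" "u (r k) (Suc i) - u (r k) i \<le> K * h (r k)"
      using gk by auto
    assume 1: "t0 + real i * h (r k) < T - 1 / real (Suc k)" "\<forall>j\<le>i. norm (X (r k) j) \<le> R - 1"
    then have "t0 + real i * h (r k) < T - 1 / real (Suc (r k)) \<and> (\<forall>j\<le>i. norm (X (r k) j) \<le> R - 1)"
      using less_le_trans[OF 1(1) diff_left_mono[OF r1[of k]]] by blast
    then have 2: "S (r k) i \<in> E" "dist (S (r k) i) ((t0 + real i * h (r k), X (r k) i), u (r k) i) \<le> 1 / real (Suc (r k))"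
      "\<And>p. norm p \<le> real (r k) \<Longrightarrow> p \<bullet> (X (r k) (Suc i) - X (r k) i) - h (r k) * Ham (fst (fst (S (r k) i))) (snd (fst (S (r k) i))) p
         \<le> u (r k) i - u (r k) (Suc i)"
      using gk by blast+
    then show "S (r k) i \<in> ext_epi Ue \<and> dist (S (r k) i) ((t0 + real i * h (r k), X (r k) i), u (r k) i) \<le> 1 / real (Suc k)"
      using r1[of k] by (auto simp: E_def)
    fix p :: 'a assume "norm p \<le> real k"
    then have "norm p \<le> real (r k)" using rk[of k] by linarith
    then show "p \<bullet> (X (r k) (Suc i) - X (r k) i) - h (r k) * Ham (fst (fst (S (r k) i))) (snd (fst (S (r k) i))) p
         \<le> u (r k) i - u (r k) (Suc i)" by (rule 2(3))
  next
    fix t assume "t \<in> {t0..T}"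
    then show "(\<lambda>k. X (r k) (nat \<lfloor>(t - t0) / h (r k)\<rfloor>)) \<longlonglongrightarrow> x t" using x_lim[of t] cl(2) by (simp add: f_def)
  next
    show "norm (x s - x t) \<le> C * \<bar>s - t\<bar>" for s t by (rule x_lip)
    show "lsc_on UNIV Ue" by (rule lsc)
  next
    fix t and \<epsilon> :: real and y p assume "t \<in> {t0..T}" "\<epsilon> > 0"
    then have "t \<in> {0..T}" using t0 by auto
    from Ham_usc[OF this \<open>\<epsilon> > 0\<close>, where x=y and p=p]
    obtain \<delta> where "\<delta> > 0" "\<And>t' x'. t' \<in> {0..T} \<Longrightarrow> \<bar>t' - t\<bar> < \<delta> \<Longrightarrow> norm (x' - y) < \<delta> \<Longrightarrow> Ham t' x' p \<le> Ham t y p + \<epsilon>" by blast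
    then show "\<exists>\<delta>>0. \<forall>t' x'. Ue (t', x') < \<infinity> \<longrightarrow> \<bar>t' - t\<bar> < \<delta> \<longrightarrow> norm (x' - y) < \<delta> \<longrightarrow> Ham t' x' p \<le> Ham t y p + \<epsilon>"
      using Ue_fin by blast
  qed
  obtain d where d: "AE t in lborel. (x has_vector_derivative d t) (at t)"
    using lipschitz_has_integral_derivative[OF x_lip] by blast
  have below: "\<exists>a. ereal a < Ue z" for z using proper[of z] by (metis ereal_dense2 ereal_infty_less(2))
  have L_le: "L t (x t) (d t) \<le> ereal (enn2real (lim.rate t) - K)"
    if "lim.confined t" "(x has_vector_derivative d t) (at t)" "lim.rate t \<noteq> \<infinity>" for t
    by (rule L_le_if_Ham) (use that t0 lim.rate_lower_bound[OF that] in \<open>auto simp: lim.confined_def\<close>)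
  \<comment> \<open>A finite integral makes the rate finite almost everywhere, so the velocity of
    \<open>x\<close> lies in the domain of \<open>L\<close> and (L5) limits it. Only confinement up
    to \<open>b\<close> is used, so the continuation argument is not circular.\<close>
  have apriori: "norm (x b) \<le> R - 2" if "lim.confined b" for b
  proof -
    have b: "t0 \<le> b" "b < T" using that by (auto simp: lim.confined_def)
    obtain a where "ereal a < Ue (b, x b)" using below by blast
    from lim.nn_integral_rate_le(2)[OF that this] have "(\<integral>\<^sup>+s. lim.rate s * indicator {t0..b} s \<partial>lborel) \<noteq> \<infinity>"
      by (auto simp: top_unique)
    then have "AE s in lborel. lim.rate s * indicator {t0..b} s \<noteq> \<infinity>"
      by (intro nn_integral_PInf_AE) measurable
    then have "AE t in lborel. t \<in> {t0..b} \<longrightarrow>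
        (\<exists>d. (x has_vector_derivative d) (at t) \<and> norm d \<le> c t * (1 + norm (x t)))"
      using d AE_not_in[OF \<N>]
    proof eventually_elim
      case (elim t)
      show ?case
      proof
        assume t: "t \<in> {t0..b}"
        then have "lim.confined t" using that by (auto simp: lim.confined_def)
        moreover have "lim.rate t \<noteq> \<infinity>" using elim(1) t by simp
        ultimately have "L t (x t) (d t) \<noteq> \<infinity>" using L_le[of t] elim(2) by auto
        moreover have "t \<in> {0..T} - \<N>" using t t0 b elim(3) by auto
        ultimately have "norm (d t) \<le> c t * (1 + norm (x t))" using growth by (meson not_le)
        then show "\<exists>d. (x has_vector_derivative d) (at t) \<and> norm d \<le> c t * (1 + norm (x t))"
          using elim(2) by blast
      qed
    qed
    moreover have sub: "{t0..b} \<subseteq> {0..T}" using t0 b by auto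
    moreover have cb: "c integrable_on {t0..b}" using integrable_on_subinterval[OF c(1) sub] .
    ultimately have "norm (x b) \<le> (1 + (norm (x t0))\<^sup>2) * exp (4 * integral {t0..b} c)"
      using c(2) by (intro gronwall_lipschitz[OF x_lip b(1)]) auto
    also have "\<dots> \<le> (1 + (norm (x t0))\<^sup>2) * exp (4 * integral {0..T} c)"
      using integral_subset_le[OF sub cb c(1)] c(2) by (intro mult_left_mono) auto
    finally show ?thesis by (simp add: R_def xt0)
  qed
  have init: "norm (x t0) \<le> R - 2"
  proof -
    have "0 \<le> integral {0..T} c" using c by (intro Henstock_Kurzweil_Integration.integral_nonneg) auto
    then have "1 \<le> exp (4 * integral {0..T} c)" by simp
    then have "(1 + (norm x0)\<^sup>2) * 1 \<le> (1 + (norm x0)\<^sup>2) * exp (4 * integral {0..T} c)"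
      by (intro mult_left_mono) auto
    moreover have "norm x0 \<le> 1 + (norm x0)\<^sup>2"
    proof -
      have "0 \<le> (norm x0 - 1)\<^sup>2" by simp
      then have "2 * norm x0 \<le> 1 + (norm x0)\<^sup>2" by (simp add: power2_eq_square algebra_simps)
      then show ?thesis using norm_ge_zero[of x0] by linarith
    qed
    ultimately show ?thesis by (simp add: R_def xt0)
  qed
  have all_confined: "lim.confined b" if "t0 \<le> b" "b < T" for b
    using lim.confined_if_a_priori_bound[OF apriori init that] .
  define \<rho> where "\<rho> s = enn2real (lim.rate s)" for s
  have \<rho>_int: "\<exists>q. (\<rho> has_integral q) {t0..b} \<and> (\<integral>\<^sup>+s. lim.rate s * indicator {t0..b} s \<partial>lborel) = ennreal q \<and> 0 \<le> q"
    if b: "b \<in> {t0..T}" for b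
  proof -
    obtain a where "ereal a < Ue (b, x b)" using below by blast
    from lim.nn_integral_rate_le_closed[OF all_confined b this]
    obtain q where q: "(\<integral>\<^sup>+s. lim.rate s * indicator {t0..b} s \<partial>lborel) = ennreal q" "0 \<le> q"
      by (metis ennreal_cases ennreal_less_top leD top_unique)
    then show ?thesis unfolding \<rho>_def[abs_def] by (intro exI[of _ q] conjI set_nn_integral_has_integral) auto
  qed
  have T_in: "T \<in> {t0..T}" using t0 by simp
  have \<rho>T: "\<rho> integrable_on {t0..T}" using \<rho>_int[OF T_in] by auto
  \<comment> \<open>The drift is removed again: the derivative of \<open>w\<close> is
    \<open>K - \<rho> t\<close>, whose negative dominates \<open>L\<close> at the velocity of
    \<open>x\<close>.\<close>
  define w where "w t = u0 + K * (t - t0) - integral {t0..t} \<rho>" for t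
  \<comment> \<open>Testing with reals \<open>a\<close> below \<open>Ue (b, x b)\<close> also covers
    the value infinity, which is not excluded beforehand.\<close>
  have viable: "Ue (b, x b) \<le> ereal (w b)" if b: "b \<in> {t0..T}" for b
  proof (rule ccontr)
    assume "\<not> ?thesis"
    then obtain a where a: "ereal (w b) < ereal a" "ereal a < Ue (b, x b)"
      using ereal_dense2 by (meson not_le)
    obtain q where q: "(\<rho> has_integral q) {t0..b}" "(\<integral>\<^sup>+s. lim.rate s * indicator {t0..b} s \<partial>lborel) = ennreal q" "0 \<le> q"
      using \<rho>_int[OF b] by blast
    have "q \<le> u0 + K * (b - t0) - a"
      using lim.nn_integral_rate_le_closed[OF all_confined b a(2)] unfolding q(2)
      by (auto simp: ennreal_le_iff2 q(3))
    then show False using a(1) integral_unique[OF q(1)] by (simp add: w_def)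
  qed
  show ?thesis
  proof (intro exI[of _ x] exI[of _ w] conjI ballI)
    show "abs_continuous_on t0 T (\<lambda>t. (x t, w t))"
    proof (rule abs_continuous_on_dominated[OF abs_continuous_on_integral[OF \<rho>T], where A="C + K"])
      fix s e assume se: "t0 \<le> s" "s \<le> e" "e \<le> T"
      have "dist (x s, w s) (x e, w e) \<le> dist (x s) (x e) + dist (w s) (w e)"
        by (simp add: dist_Pair_Pair sqrt_sum_squares_le_sum)
      moreover have "dist (x s) (x e) \<le> C * (e - s)" using x_lip[of s e] se by (simp add: dist_norm)
      moreover have "dist (w s) (w e) \<le> K * (e - s) + dist (integral {t0..s} \<rho>) (integral {t0..e} \<rho>)"
      proof -
        have "w s - w e = - (K * (e - s)) + (integral {t0..e} \<rho> - integral {t0..s} \<rho>)"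
          by (simp add: w_def algebra_simps)
        moreover have "0 \<le> K * (e - s)" using K se by simp
        ultimately show ?thesis by (simp add: dist_real_def)
      qed
      ultimately show "dist (x s, w s) (x e, w e) \<le> (C + K) * (e - s) + dist (integral {t0..s} \<rho>) (integral {t0..e} \<rho>)"
        by (simp add: algebra_simps)
    qed (use C K in \<open>auto simp: \<rho>_def\<close>)
    show "x t0 = x0" by (rule xt0)
    show "ereal (w t0) = U t0 x0" by (simp add: w_def u0)
    show "U t (x t) \<le> ereal (w t)" if "t \<in> {t0..T}" for t
      using viable[OF that] Ue_eq[of t "x t"] that t0 by simp
    have "(\<integral>\<^sup>+s. lim.rate s * indicator {t0..T} s \<partial>lborel) \<noteq> \<infinity>" using \<rho>_int[OF T_in] by auto
    then have "AE s in lborel. lim.rate s * indicator {t0..T} s \<noteq> \<infinity>"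
      by (intro nn_integral_PInf_AE) measurable
    \<comment> \<open>The indefinite integral is differentiated at interior points only, so both
      endpoints join the exceptional null set.\<close>
    then show "AE t in lborel. t \<in> {t0..T} \<longrightarrow>
              (\<exists>dx du. (x has_vector_derivative dx) (at t within {t0..T}) \<and>
                       (w has_real_derivative du) (at t within {t0..T}) \<and>
                       (dx, du) \<in> Qset L t (x t))"
      using d AE_has_vector_derivative_integral[OF \<rho>T] AE_lborel_singleton[of t0] AE_lborel_singleton[of T]
    proof eventually_elim
      case (elim t)
      show ?case
      proof
        assume t: "t \<in> {t0..T}"
        then have tt: "t0 < t" "t < T" using elim(4,5) by auto
        have "((\<lambda>t. integral {t0..t} \<rho>) has_real_derivative \<rho> t) (at t)"
          using elim(3) tt by (simp add: has_real_derivative_iff_has_vector_derivative)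
        then have "(w has_real_derivative K - \<rho> t) (at t)"
          unfolding w_def[abs_def] by (auto intro!: derivative_eq_intros)
        moreover have "L t (x t) (d t) \<le> ereal (\<rho> t - K)"
          unfolding \<rho>_def by (rule L_le[OF all_confined elim(2)]) (use tt t elim(1) in auto)
        ultimately show "\<exists>dx du. (x has_vector_derivative dx) (at t within {t0..T}) \<and>
             (w has_real_derivative du) (at t within {t0..T}) \<and> (dx, du) \<in> Qset L t (x t)"
          using elim(2) by (intro exI[of _ "d t"] exI[of _ "K - \<rho> t"])
            (auto simp: Qset_def intro: has_vector_derivative_at_within has_field_derivative_at_within)
      qed
    qed
  qed
qed

end
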